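(* Let $\mathbb{P}_{\Delta}$ be a complete simplicial toric variety of dimension $n$, with homogeneous coordinates $z_1,\ldots,z_{n+r}$, where $r=\mathrm{rank}\,\mathcal{A}_{n-1}(\mathbb{P}_{\Delta})$. Let $\mathcal{F}$ be a codimension one holomorphic foliation of degree $d$ on $\mathbb{P}_{\Delta}$. Set $h_{\alpha}=\dim_{\mathbb{C}}H^0(\mathbb{P}_{\Delta},\mathcal{O}_{\mathbb{P}_{\Delta}}(\alpha))=\dim_{\mathbb{C}}\mathrm{S}_{\alpha}$. If $\mathcal{F}$ admits $$\mathcal{N}_{\Delta}=2+\sum_{1\leq i<j\leq n+r}h_{d-\deg(z_i)-\deg(z_j)}$$ (distinct) invariant irreducible quasi-homogeneous hypersurfaces, then $\mathcal{F}$ admits a rational first integral. In particular, $\mathcal{F}$ admits a rational first integral if and only if it admits infinitely many invariant irreducible quasi-homogeneous hypersurfaces.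
   Context: Let $\Delta$ be a complete simplicial fan in $N_{\mathbb{R}}$, $N\simeq\mathbb{Z}^n$, with rays $\rho_1,\ldots,\rho_{n+r}$ and primitive ray generators $n_1,\ldots,n_{n+r}$. Let $D_i$ be the torus-invariant prime divisor of $\rho_i$, and $\mathcal{A}_{n-1}(\mathbb{P}_{\Delta})$ the Weil divisor class group. The homogeneous coordinate ring is $\mathrm{S}=\mathbb{C}[z_1,\ldots,z_{n+r}]$, graded by $\mathcal{A}_{n-1}(\mathbb{P}_{\Delta})$ with $\deg z_i=[D_i]$; $\mathrm{S}_\alpha$ is the degree $\alpha$ part. One has $\mathbb{P}_{\Delta}=(\mathbb{C}^{n+r}-\mathcal{Z})/G$, where $G=\mathrm{Hom}_{\mathbb{Z}}(\mathcal{A}_{n-1}(\mathbb{P}_{\Delta}),\mathbb{C}^* )$ and $\mathcal{Z}$ is the common zero set of the monomials $\prod_{\rho_i\not\prec\sigma}z_i$, $\sigma\in\Delta$. $\mathrm{Lie}(G)$ is spanned by the vector fields $\sum_i a_iz_i\frac{\partial}{\partial z_i}$ with integers $a_i$ satisfying $\sum_i a_in_i=0$. A codimension one holomorphic distribution of degree $d=\sum_i d_i[D_i]$ (with $\sum_i d_iD_i$ Cartier) is a (nonzero) global section $\omega$ of $\Omega^1_{\mathbb{P}_{\Delta}}(d)=\Omega^1_{\mathbb{P}_{\Delta}}\otimes\mathcal{O}_{\mathbb{P}_{\Delta}}(\sum_i d_iD_i)$, where $\Omega^1_{\mathbb{P}_{\Delta}}$ is the sheaf of Zariski $1$-forms.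 In homogeneous coordinates, $\omega=\sum_{i=1}^{n+r}P_i\,dz_i$ with $P_i\in\mathrm{S}_{d-[D_i]}$ and $i_R\omega=0$ for all $R\in\mathrm{Lie}(G)$. It is a foliation if $\omega\wedge d\omega=0$; foliations are assumed to have singular scheme of codimension greater than $1$. A quasi-homogeneous hypersurface is $V=\{f=0\}$ with $f\in\mathrm{S}_\alpha$ for some $\alpha$. $V$ is invariant by the foliation if there is a holomorphic $2$-form $\Theta$ in homogeneous coordinates with $\omega\wedge df=f\cdot\Theta$. A rational function on $\mathbb{P}_\Delta$ is a quotient $P/Q$ with $P,Q\in\mathrm{S}_\alpha$ for the same $\alpha$, $Q\neq0$. A rational first integral is a non-constant rational function $f$ on $\mathbb{P}_\Delta$ with $\omega\wedge df=0$. *)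

theory Defs
  imports
    "HOL-Analysis.Analysis"
    "HOL-Algebra.Coset"
    "HOL-Library.Poly_Mapping"
    "HOL-Computational_Algebra.Fraction_Field"
    "HOL-Library.Extended_Nat"
begin

text \<open>
  Conventions. The lattice \<open>N\<close> is \<open>int ^ 'n\<close>, its dual \<open>M\<close> is identified with \<open>int ^ 'n\<close> through
  the standard pairing, and \<open>N \<otimes> \<real>\<close> is \<open>real ^ 'n\<close>. The rays of a fan are indexed by a finite
  linearly ordered type \<open>'k\<close>, so \<open>n = CARD('n)\<close> and \<open>n + r = CARD('k)\<close>. A fan is a set \<open>\<Delta>\<close> of
  cones, and \<open>\<nu> i\<close> is the primitive generator of its \<open>i\<close>-th ray.
\<close>

section \<open>Fans\<close>

definition rvec :: "int ^ 'n \<Rightarrow> real ^ 'n" where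
  "rvec v = (\<chi> j. real_of_int (v $ j))"

definition pairing :: "int ^ 'n \<Rightarrow> int ^ 'n \<Rightarrow> int" where
  "pairing m v = (\<Sum>j\<in>UNIV. m $ j * v $ j)"

definition rational_polyhedral_cone :: "(real ^ 'n) set \<Rightarrow> bool" where
  "rational_polyhedral_cone \<sigma> \<longleftrightarrow> (\<exists>B. finite B \<and> \<sigma> = convex_cone hull (rvec ` B))"

definition strongly_convex :: "(real ^ 'n) set \<Rightarrow> bool" where
  "strongly_convex \<sigma> \<longleftrightarrow> \<sigma> \<inter> uminus ` \<sigma> = {0}"

text \<open>
  The library relation \<open>face_of\<close> also admits the empty set; the nonempty faces of a
  polyhedral cone in that sense are its faces in the sense of toric geometry.
\<close>

definition cone_face :: "(real ^ 'n) set \<Rightarrow> (real ^ 'n) set \<Rightarrow> bool" where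
  "cone_face \<tau> \<sigma> \<longleftrightarrow> \<tau> face_of \<sigma> \<and> \<tau> \<noteq> {}"

definition fan :: "(real ^ 'n) set set \<Rightarrow> bool" where
  "fan \<Delta> \<longleftrightarrow> finite \<Delta> \<and> \<Delta> \<noteq> {} \<and>
     (\<forall>\<sigma>\<in>\<Delta>. rational_polyhedral_cone \<sigma> \<and> strongly_convex \<sigma>) \<and>
     (\<forall>\<sigma>\<in>\<Delta>. \<forall>\<tau>. cone_face \<tau> \<sigma> \<longrightarrow> \<tau> \<in> \<Delta>) \<and>
     (\<forall>\<sigma>\<in>\<Delta>. \<forall>\<tau>\<in>\<Delta>. cone_face (\<sigma> \<inter> \<tau>) \<sigma> \<and> cone_face (\<sigma> \<inter> \<tau>) \<tau>)"

definition complete_fan :: "(real ^ 'n) set set \<Rightarrow> bool" where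
  "complete_fan \<Delta> \<longleftrightarrow> \<Union>\<Delta> = UNIV"

definition simplicial_fan :: "(real ^ 'n) set set \<Rightarrow> bool" where
  "simplicial_fan \<Delta> \<longleftrightarrow> (\<forall>\<sigma>\<in>\<Delta>. \<exists>B. independent B \<and> \<sigma> = convex_cone hull B)"

definition rays :: "(real ^ 'n) set set \<Rightarrow> (real ^ 'n) set set" where
  "rays \<Delta> = {\<rho> \<in> \<Delta>. dim \<rho> = 1}"

definition ray :: "int ^ 'n \<Rightarrow> (real ^ 'n) set" where
  "ray v = convex_cone hull {rvec v}"

definition primitive :: "int ^ 'n \<Rightarrow> bool" where
  "primitive v \<longleftrightarrow> Gcd (range (\<lambda>j. v $ j)) = 1"

definition ray_generators :: "(real ^ 'n) set set \<Rightarrow> ('k \<Rightarrow> int ^ 'n) \<Rightarrow> bool" where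
  "ray_generators \<Delta> \<nu> \<longleftrightarrow>
     (\<forall>i. primitive (\<nu> i)) \<and> bij_betw (\<lambda>i. ray (\<nu> i)) UNIV (rays \<Delta>)"

section \<open>Divisor classes\<close>

text \<open>The torus-invariant divisor \<open>\<Sum>\<^sub>i a\<^sub>i D\<^sub>i\<close> is represented by the function \<open>a\<close>.\<close>

definition tdiv_group :: "('k \<Rightarrow> int) monoid" where
  "tdiv_group = \<lparr>carrier = UNIV, mult = (\<lambda>a b i. a i + b i), one = (\<lambda>i. 0)\<rparr>"

definition principal_divisors :: "('k \<Rightarrow> int ^ 'n) \<Rightarrow> ('k \<Rightarrow> int) set" where
  "principal_divisors \<nu> = range (\<lambda>m i. pairing m (\<nu> i))"

definition class_group :: "('k \<Rightarrow> int ^ 'n) \<Rightarrow> ('k \<Rightarrow> int) set monoid" where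
  "class_group \<nu> = tdiv_group Mod principal_divisors \<nu>"

definition div_class :: "('k \<Rightarrow> int ^ 'n) \<Rightarrow> ('k \<Rightarrow> int) \<Rightarrow> ('k \<Rightarrow> int) set" where
  "div_class \<nu> a = principal_divisors \<nu> #>\<^bsub>tdiv_group\<^esub> a"

definition deg_var :: "('k \<Rightarrow> int ^ 'n) \<Rightarrow> 'k \<Rightarrow> ('k \<Rightarrow> int) set" where
  "deg_var \<nu> i = div_class \<nu> (\<lambda>j. if j = i then 1 else 0)"

definition class_minus ::
  "('k \<Rightarrow> int ^ 'n) \<Rightarrow> ('k \<Rightarrow> int) set \<Rightarrow> ('k \<Rightarrow> int) set \<Rightarrow> ('k \<Rightarrow> int) set" where
  "class_minus \<nu> \<alpha> \<beta> = \<alpha> \<otimes>\<^bsub>class_group \<nu>\<^esub> inv\<^bsub>class_group \<nu>\<^esub> \<beta>"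

text \<open>
  On the affine chart of a cone \<open>\<sigma>\<close>, a torus-invariant divisor is Cartier iff it is the divisor of
  a character \<open>\<chi>\<^sup>-\<^sup>m\<close>.
\<close>

definition cartier :: "(real ^ 'n) set set \<Rightarrow> ('k \<Rightarrow> int ^ 'n) \<Rightarrow> ('k \<Rightarrow> int) \<Rightarrow> bool" where
  "cartier \<Delta> \<nu> a \<longleftrightarrow>
     (\<forall>\<sigma>\<in>\<Delta>. \<exists>m. \<forall>i. cone_face (ray (\<nu> i)) \<sigma> \<longrightarrow> pairing m (\<nu> i) = - a i)"

section \<open>The homogeneous coordinate ring\<close>

type_synonym 'k cpoly = "('k \<Rightarrow>\<^sub>0 nat) \<Rightarrow>\<^sub>0 complex"

definition cconst :: "complex \<Rightarrow> 'k cpoly" where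
  "cconst c = Poly_Mapping.single 0 c"

definition cvar :: "'k \<Rightarrow> 'k cpoly" where
  "cvar i = Poly_Mapping.single (Poly_Mapping.single i 1) 1"

definition cscale :: "complex \<Rightarrow> 'k cpoly \<Rightarrow> 'k cpoly" where
  "cscale c p = cconst c * p"

lemma vector_space_cscale: "vector_space cscale"
  by unfold_locales
    (simp_all add: cscale_def cconst_def algebra_simps single_add mult_single
      flip: mult.assoc)

definition eval_poly :: "'k::finite cpoly \<Rightarrow> complex ^ 'k \<Rightarrow> complex" where
  "eval_poly p z =
     (\<Sum>m\<in>Poly_Mapping.keys p.
        Poly_Mapping.lookup p m * (\<Prod>i\<in>UNIV. (z $ i) ^ Poly_Mapping.lookup m i))"

text \<open>The truncated subtraction of exponents is harmless: where it truncates, the coefficient is 0.\<close>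

definition pdiff :: "'k \<Rightarrow> 'k cpoly \<Rightarrow> 'k cpoly" where
  "pdiff i p =
     (\<Sum>m\<in>Poly_Mapping.keys p.
        Poly_Mapping.single (m - Poly_Mapping.single i 1)
          (of_nat (Poly_Mapping.lookup m i) * Poly_Mapping.lookup p m))"

definition graded_part :: "('k \<Rightarrow> int ^ 'n) \<Rightarrow> ('k \<Rightarrow> int) set \<Rightarrow> 'k cpoly set" where
  "graded_part \<nu> \<alpha> =
     {p. \<forall>m\<in>Poly_Mapping.keys p. div_class \<nu> (\<lambda>i. int (Poly_Mapping.lookup m i)) = \<alpha>}"

definition hdim :: "('k \<Rightarrow> int ^ 'n) \<Rightarrow> ('k \<Rightarrow> int) set \<Rightarrow> nat" where
  "hdim \<nu> \<alpha> = vector_space.dim cscale (graded_part \<nu> \<alpha>)"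

section \<open>The toric variety as a quotient\<close>

definition irrelevant_locus ::
  "(real ^ 'n) set set \<Rightarrow> ('k::finite \<Rightarrow> int ^ 'n) \<Rightarrow> (complex ^ 'k) set" where
  "irrelevant_locus \<Delta> \<nu> =
     {z. \<forall>\<sigma>\<in>\<Delta>. (\<Prod>i\<in>{i. \<not> cone_face (ray (\<nu> i)) \<sigma>}. z $ i) = 0}"

definition complex_units :: "complex monoid" where
  "complex_units = \<lparr>carrier = UNIV - {0}, mult = (*), one = 1\<rparr>"

text \<open>\<open>G = Hom(class group, \<complex>\<^sup>*)\<close> acts on coordinates by \<open>(g \<cdot> z)\<^sub>i = g [D\<^sub>i] z\<^sub>i\<close>.\<close>

definition orbit :: "('k::finite \<Rightarrow> int ^ 'n) \<Rightarrow> complex ^ 'k \<Rightarrow> (complex ^ 'k) set" where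
  "orbit \<nu> z =
     {(\<chi> i. g (deg_var \<nu> i) * z $ i) | g. g \<in> hom (class_group \<nu>) complex_units}"

definition toric_variety ::
  "(real ^ 'n) set set \<Rightarrow> ('k::finite \<Rightarrow> int ^ 'n) \<Rightarrow> (complex ^ 'k) set set" where
  "toric_variety \<Delta> \<nu> = orbit \<nu> ` (- irrelevant_locus \<Delta> \<nu>)"

text \<open>The Zariski topology of the toric variety is the quotient topology.\<close>

definition zariski_closed ::
  "(real ^ 'n) set set \<Rightarrow> ('k::finite \<Rightarrow> int ^ 'n) \<Rightarrow> (complex ^ 'k) set set \<Rightarrow> bool" where
  "zariski_closed \<Delta> \<nu> W \<longleftrightarrow> W \<subseteq> toric_variety \<Delta> \<nu> \<and>
     (\<exists>I. {z \<in> - irrelevant_locus \<Delta> \<nu>. orbit \<nu> z \<in> W} =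
          {z \<in> - irrelevant_locus \<Delta> \<nu>. \<forall>p\<in>I. eval_poly p z = 0})"

definition irreducible_closed ::
  "(real ^ 'n) set set \<Rightarrow> ('k::finite \<Rightarrow> int ^ 'n) \<Rightarrow> (complex ^ 'k) set set \<Rightarrow> bool" where
  "irreducible_closed \<Delta> \<nu> W \<longleftrightarrow> zariski_closed \<Delta> \<nu> W \<and> W \<noteq> {} \<and>
     (\<forall>W1 W2. zariski_closed \<Delta> \<nu> W1 \<and> zariski_closed \<Delta> \<nu> W2 \<and> W = W1 \<union> W2
        \<longrightarrow> W1 = W \<or> W2 = W)"

text \<open>
  Krull codimension in the toric variety: the supremum of the lengths of chains of irreducible
  closed sets above an irreducible closed set, and for a general closed set the infimum over the
  irreducible closed sets it contains (infinite for the empty set).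
\<close>

definition codim_irreducible ::
  "(real ^ 'n) set set \<Rightarrow> ('k::finite \<Rightarrow> int ^ 'n) \<Rightarrow> (complex ^ 'k) set set \<Rightarrow> enat" where
  "codim_irreducible \<Delta> \<nu> W =
     Sup {enat l | l. \<exists>C. C 0 = W \<and> (\<forall>i\<le>l. irreducible_closed \<Delta> \<nu> (C i)) \<and>
                          (\<forall>i<l. C i \<subset> C (Suc i))}"

definition codim ::
  "(real ^ 'n) set set \<Rightarrow> ('k::finite \<Rightarrow> int ^ 'n) \<Rightarrow> (complex ^ 'k) set set \<Rightarrow> enat" where
  "codim \<Delta> \<nu> Y = (INF W\<in>{W. irreducible_closed \<Delta> \<nu> W \<and> W \<subseteq> Y}. codim_irreducible \<Delta> \<nu> W)"

section \<open>Differential forms in homogeneous coordinates\<close>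

text \<open>
  A 1-form \<open>\<Sum>\<^sub>i P\<^sub>i dz\<^sub>i\<close> is the family of its coefficients; 2- and 3-forms are the
  alternating families of their coefficients.
\<close>

definition wedge11 :: "('k \<Rightarrow> 'a::comm_ring) \<Rightarrow> ('k \<Rightarrow> 'a) \<Rightarrow> 'k \<Rightarrow> 'k \<Rightarrow> 'a" where
  "wedge11 \<omega> \<eta> i j = \<omega> i * \<eta> j - \<omega> j * \<eta> i"

definition wedge12 ::
  "('k \<Rightarrow> 'a::comm_ring) \<Rightarrow> ('k \<Rightarrow> 'k \<Rightarrow> 'a) \<Rightarrow> 'k \<Rightarrow> 'k \<Rightarrow> 'k \<Rightarrow> 'a" where
  "wedge12 \<omega> \<Theta> i j k = \<omega> i * \<Theta> j k - \<omega> j * \<Theta> i k + \<omega> k * \<Theta> i j"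

definition d0 :: "'k cpoly \<Rightarrow> 'k \<Rightarrow> 'k cpoly" where
  "d0 f i = pdiff i f"

definition d1 :: "('k \<Rightarrow> 'k cpoly) \<Rightarrow> 'k \<Rightarrow> 'k \<Rightarrow> 'k cpoly" where
  "d1 \<omega> i j = pdiff i (\<omega> j) - pdiff j (\<omega> i)"

text \<open>The vector field \<open>\<Sum>\<^sub>i a\<^sub>i z\<^sub>i \<partial>/\<partial>z\<^sub>i\<close> is represented by the vector \<open>a\<close>.\<close>

definition lie_G :: "('k::finite \<Rightarrow> int ^ 'n) \<Rightarrow> (complex ^ 'k) set" where
  "lie_G \<nu> = vec.span {(\<chi> i. of_int (a i)) | a. (\<Sum>i\<in>UNIV. a i *s \<nu> i) = 0}"

definition contract :: "complex ^ 'k \<Rightarrow> ('k::finite \<Rightarrow> 'k cpoly) \<Rightarrow> 'k cpoly" where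
  "contract a \<omega> = (\<Sum>i\<in>UNIV. cconst (a $ i) * cvar i * \<omega> i)"

text \<open>
  \<open>distribution \<Delta> \<nu> d \<omega>\<close>: \<open>\<omega>\<close> is the expression in homogeneous coordinates of a nonzero global
  section of the Zariski 1-forms twisted by the Cartier divisor \<open>d\<close>.
\<close>

definition distribution ::
  "(real ^ 'n) set set \<Rightarrow> ('k::finite \<Rightarrow> int ^ 'n) \<Rightarrow> ('k \<Rightarrow> int) \<Rightarrow> ('k \<Rightarrow> 'k cpoly) \<Rightarrow> bool" where
  "distribution \<Delta> \<nu> d \<omega> \<longleftrightarrow> cartier \<Delta> \<nu> d \<and> (\<exists>i. \<omega> i \<noteq> 0) \<and>
     (\<forall>i. \<omega> i \<in> graded_part \<nu> (class_minus \<nu> (div_class \<nu> d) (deg_var \<nu> i))) \<and>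
     (\<forall>R\<in>lie_G \<nu>. contract R \<omega> = 0)"

text \<open>
  The support of the zero scheme of \<open>\<omega>\<close>, described by the vanishing of its coefficients. This is
  the support over the smooth locus of the toric variety, whose complement has codimension at
  least 2, so it decides whether the codimension is greater than 1.
\<close>

definition singular_set ::
  "(real ^ 'n) set set \<Rightarrow> ('k::finite \<Rightarrow> int ^ 'n) \<Rightarrow> ('k \<Rightarrow> 'k cpoly) \<Rightarrow> (complex ^ 'k) set set" where
  "singular_set \<Delta> \<nu> \<omega> =
     orbit \<nu> ` {z \<in> - irrelevant_locus \<Delta> \<nu>. \<forall>i. eval_poly (\<omega> i) z = 0}"

definition foliation ::
  "(real ^ 'n) set set \<Rightarrow> ('k::finite \<Rightarrow> int ^ 'n) \<Rightarrow> ('k \<Rightarrow> int) \<Rightarrow> ('k \<Rightarrow> 'k cpoly) \<Rightarrow> bool" where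
  "foliation \<Delta> \<nu> d \<omega> \<longleftrightarrow> distribution \<Delta> \<nu> d \<omega> \<and>
     (\<forall>i j k. wedge12 \<omega> (d1 \<omega>) i j k = 0) \<and>
     codim \<Delta> \<nu> (singular_set \<Delta> \<nu> \<omega>) > 1"

section \<open>Invariant hypersurfaces and first integrals\<close>

definition hypersurface ::
  "(real ^ 'n) set set \<Rightarrow> ('k::finite \<Rightarrow> int ^ 'n) \<Rightarrow> 'k cpoly \<Rightarrow> (complex ^ 'k) set set" where
  "hypersurface \<Delta> \<nu> f = orbit \<nu> ` {z \<in> - irrelevant_locus \<Delta> \<nu>. eval_poly f z = 0}"

text \<open>Holomorphic functions of several variables: complex differentiable at every point.\<close>

definition holomorphic_several :: "(complex ^ 'k::finite \<Rightarrow> complex) \<Rightarrow> (complex ^ 'k) set \<Rightarrow> bool" where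
  "holomorphic_several h U \<longleftrightarrow>
     (\<forall>z\<in>U. \<exists>h'. (h has_derivative h') (at z) \<and> (\<forall>c v. h' (c *s v) = c * h' v))"

definition invariant_equation ::
  "(real ^ 'n) set set \<Rightarrow> ('k::finite \<Rightarrow> int ^ 'n) \<Rightarrow> ('k \<Rightarrow> 'k cpoly) \<Rightarrow> 'k cpoly \<Rightarrow> bool" where
  "invariant_equation \<Delta> \<nu> \<omega> f \<longleftrightarrow>
     (\<exists>\<Theta> :: 'k \<Rightarrow> 'k \<Rightarrow> complex ^ 'k \<Rightarrow> complex.
        (\<forall>i j. holomorphic_several (\<Theta> i j) (- irrelevant_locus \<Delta> \<nu>)) \<and>
        (\<forall>i j z. \<Theta> i j z = - \<Theta> j i z) \<and>
        (\<forall>i j. \<forall>z \<in> - irrelevant_locus \<Delta> \<nu>.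
           eval_poly (wedge11 \<omega> (d0 f) i j) z = eval_poly f z * \<Theta> i j z))"

text \<open>
  Irreducibility refers to the subset \<open>V = {f = 0}\<close> of the toric variety. If the class group has
  torsion, \<open>G\<close> is disconnected and \<open>V\<close> may be irreducible although the polynomial \<open>f\<close> is not
  (\<open>G\<close> then permutes its factors). Distinct hypersurfaces are distinct as point sets.
\<close>

definition invariant_irreducible_hypersurfaces ::
  "(real ^ 'n) set set \<Rightarrow> ('k::finite \<Rightarrow> int ^ 'n) \<Rightarrow> ('k \<Rightarrow> 'k cpoly) \<Rightarrow>
     (complex ^ 'k) set set set" where
  "invariant_irreducible_hypersurfaces \<Delta> \<nu> \<omega> =
     {V. \<exists>\<alpha>\<in>carrier (class_group \<nu>). \<exists>f\<in>graded_part \<nu> \<alpha>. f \<noteq> 0 \<and>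
           V = hypersurface \<Delta> \<nu> f \<and> irreducible_closed \<Delta> \<nu> V \<and> invariant_equation \<Delta> \<nu> \<omega> f}"

text \<open>The coefficients of \<open>d(P/Q)\<close>, in the field of fractions.\<close>

definition d_quotient :: "'k::linorder cpoly \<Rightarrow> 'k cpoly \<Rightarrow> 'k \<Rightarrow> 'k cpoly fract" where
  "d_quotient P Q i = Fract (Q * pdiff i P - P * pdiff i Q) (Q ^ 2)"

definition rational_first_integral ::
  "('k::{finite,linorder} \<Rightarrow> int ^ 'n) \<Rightarrow> ('k \<Rightarrow> 'k cpoly) \<Rightarrow> 'k cpoly fract \<Rightarrow> bool" where
  "rational_first_integral \<nu> \<omega> F \<longleftrightarrow>
     (\<exists>\<alpha>\<in>carrier (class_group \<nu>). \<exists>P\<in>graded_part \<nu> \<alpha>. \<exists>Q\<in>graded_part \<nu> \<alpha>.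
        Q \<noteq> 0 \<and> F = Fract P Q \<and> (\<forall>c. F \<noteq> Fract (cconst c) 1) \<and>
        (\<forall>i j. wedge11 (\<lambda>l. Fract (\<omega> l) 1) (d_quotient P Q) i j = 0))"

end

theory Submission
  imports Defs "HOL-Computational_Algebra.Fundamental_Theorem_Algebra"
begin

text \<open>
  If \<open>{f = 0}\<close> is invariant then \<open>f\<close> divides \<open>\<omega> \<and> df\<close>: on a generic line, which misses the
  irrelevant locus, the quotient \<open>\<Theta>\<close> is continuous, and divisibility on generic lines implies
  divisibility. So \<open>\<omega> \<and> df / f\<close> has coefficients in the graded pieces of degree
  \<open>d - [D\<^sub>i] - [D\<^sub>j]\<close>, and \<open>2 + \<Sum> h\<close> hypersurfaces give two independent closed logarithmic
  forms \<open>\<Sum> \<lambda>\<^sub>V df\<^sub>V / f\<^sub>V\<close> proportional to \<open>\<omega>\<close>; their ratio is a first integral.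

  Conversely, write a first integral as \<open>P / Q\<close> with \<open>P\<close>, \<open>Q\<close> coprime. Every \<open>P - c Q\<close> is
  invariant, and so are its homogeneous factors of minimal degree. These are prime with respect to
  homogeneous factors, hence define irreducible hypersurfaces, which are distinct for distinct
  \<open>c\<close>. Since the class group may have torsion, homogeneity of greatest common divisors comes from
  their invariance under the characters of the class group.
\<close>

section \<open>Polynomials as functions\<close>

text \<open>Each invariant hypersurface yields one antisymmetric form \<omega> \<and> df / f, in a
  space of dimension \<Sum> h with one summand per pair i < j. One hypersurface beyond that
  dimension forces a linear relation, and its logarithmic form is proportional to \<omega>. The
  second extra one leaves the freedom to omit any chosen hypersurface, so a second relation can
  avoid a pole of the first; this makes the two independent.

  The obstacle is that irreducibility is a condition on point sets in the quotient: an equation may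
  be a power, or a product of nonhomogeneous factors permuted by G. Hence independence of
  logarithmic forms is proved by orders of vanishing along a line, not by residues along prime
  divisors, and primality is tested only against homogeneous polynomials. Divisibility is always
  checked on f(x + t v): for generic v this has a constant leading coefficient in t, so division
  with remainder needs no denominators.\<close>

lemma dedekind_independence:
  fixes \<phi> :: "'s \<Rightarrow> 'g \<Rightarrow> complex" and c :: "'s \<Rightarrow> complex"
  assumes "finite S"
    and closed: "\<And>g h. g \<in> T \<Longrightarrow> h \<in> T \<Longrightarrow> mul g h \<in> T"
    and mult: "\<And>s g h. s \<in> S \<Longrightarrow> g \<in> T \<Longrightarrow> h \<in> T \<Longrightarrow> \<phi> s (mul g h) = \<phi> s g * \<phi> s h"
    and unit: "e \<in> T" "\<And>s. s \<in> S \<Longrightarrow> \<phi> s e = 1"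
    and sep: "\<And>s s'. s \<in> S \<Longrightarrow> s' \<in> S \<Longrightarrow> s \<noteq> s' \<Longrightarrow> \<exists>g\<in>T. \<phi> s g \<noteq> \<phi> s' g"
    and vanish: "\<And>g. g \<in> T \<Longrightarrow> (\<Sum>s\<in>S. c s * \<phi> s g) = 0"
    and "s \<in> S"
  shows "c s = 0"
  using assms(1) mult unit(2) sep vanish \<open>s \<in> S\<close>
proof (induction S arbitrary: c s rule: finite_induct)
  case empty
  then show ?case by simp
next
  case (insert r S)
  have "c s = 0" if s: "s \<in> S" for s
  proof -
    obtain h where h: "h \<in> T" "\<phi> s h \<noteq> \<phi> r h"
      using insert.prems(3)[of s r] s insert.hyps(2) by auto
    \<comment> \<open>Subtracting \<open>\<phi> r h\<close> times the relation at g from the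
      relation at \<open>mul g h\<close> cancels the term of r and leaves a shorter relation with
      these coefficients.\<close>
    have "c s * (\<phi> s h - \<phi> r h) = 0"
    proof (rule insert.IH[where c = "\<lambda>s. c s * (\<phi> s h - \<phi> r h)"])
      fix g assume g: "g \<in> T"
      have "(\<Sum>s\<in>insert r S. c s * \<phi> s (mul g h)) - \<phi> r h * (\<Sum>s\<in>insert r S. c s * \<phi> s g) = 0"
        using insert.prems(4) g h(1) closed by simp
      moreover have "(\<Sum>s\<in>S. c s * \<phi> s (mul g h)) = (\<Sum>s\<in>S. c s * (\<phi> s g * \<phi> s h))"
        using insert.prems(1) g h(1) by (intro sum.cong) auto
      moreover have "\<phi> r (mul g h) = \<phi> r g * \<phi> r h"
        using insert.prems(1) g h(1) by simp
      ultimately show "(\<Sum>s\<in>S. c s * (\<phi> s h - \<phi> r h) * \<phi> s g) = 0"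
        using insert.hyps
        by (simp add: algebra_simps sum_subtractf sum_distrib_left)
    qed (use insert.prems s in auto)
    then show ?thesis using h(2) by simp
  qed
  moreover have "c r = 0"
    using insert.prems(4)[OF unit(1)] insert.prems(2) insert.hyps calculation by simp
  ultimately show ?case using insert.prems(5) by auto
qed

lemma cpoly_eq_sum_single:
  "p = (\<Sum>m\<in>Poly_Mapping.keys p. Poly_Mapping.single m (Poly_Mapping.lookup p m))"
  by (rule poly_mapping_eqI)
    (simp add: lookup_sum lookup_single when_def in_keys_iff)

lemma cpoly_induct [case_names single add]:
  assumes "\<And>m c. P (Poly_Mapping.single m c)"
    and "\<And>p q. P p \<Longrightarrow> P q \<Longrightarrow> P (p + q)"
  shows "P (p :: ('a \<Rightarrow>\<^sub>0 'b::comm_monoid_add))"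
proof -
  have "P (\<Sum>m\<in>A. Poly_Mapping.single m (Poly_Mapping.lookup p m))" if "finite A" for A
    using that
  proof (induction A rule: finite_induct)
    case empty
    show ?case using assms(1)[of undefined 0] by simp
  qed (simp add: assms)
  then show ?thesis
    by (subst cpoly_eq_sum_single) simp
qed

text \<open>General in the target ring and in the map on constants, so that one set of lemmas covers
  evaluation at a point, restriction to a line with numerical or generic base point, and rescaling
  of the variables.\<close>

definition psubst ::
  "(complex \<Rightarrow> 'a::comm_ring_1) \<Rightarrow> ('k::finite \<Rightarrow> 'a) \<Rightarrow> 'k cpoly \<Rightarrow> 'a" where
  "psubst c x p = (\<Sum>m\<in>Poly_Mapping.keys p.
     c (Poly_Mapping.lookup p m) * (\<Prod>i\<in>UNIV. x i ^ Poly_Mapping.lookup m i))"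

locale const_hom =
  fixes c :: "complex \<Rightarrow> 'a::comm_ring_1"
  assumes c_add: "c (a + b) = c a + c b"
    and c_mult: "c (a * b) = c a * c b"
    and c_1: "c 1 = 1"
begin

lemma c_0: "c 0 = 0"
  using c_add[of 0 0] by simp

lemma psubst_single:
  "psubst c x (Poly_Mapping.single m a) = c a * (\<Prod>i\<in>UNIV. x i ^ Poly_Mapping.lookup m i)"
  by (simp add: psubst_def c_0)

lemma psubst_add: "psubst c x (p + q) = psubst c x p + psubst c x q"
  unfolding psubst_def
  by (rule setsum_keys_plus_distrib) (simp_all add: c_0 c_add algebra_simps)

lemma psubst_0 [simp]: "psubst c x 0 = 0"
  by (simp add: psubst_def)

lemma psubst_1 [simp]: "psubst c x 1 = 1"
  using psubst_single[of x 0 1] by (simp add: c_1)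

lemma psubst_mult: "psubst c x (p * q) = psubst c x p * psubst c x q"
proof (induction p rule: cpoly_induct)
  case (single m a)
  show ?case
    by (induction q rule: cpoly_induct)
      (simp_all add: psubst_single psubst_add mult_single c_mult lookup_add power_add
        prod.distrib algebra_simps)
qed (simp add: psubst_add algebra_simps)

lemma psubst_uminus: "psubst c x (- p) = - psubst c x p"
  using psubst_add[of x p "- p"] by (simp add: add_eq_0_iff)

lemma psubst_diff: "psubst c x (p - q) = psubst c x p - psubst c x q"
  using psubst_add[of x p "- q"] by (simp add: psubst_uminus)

lemma psubst_cconst [simp]: "psubst c x (cconst a) = c a"
  by (simp add: cconst_def psubst_single)

lemma psubst_cvar [simp]: "psubst c x (cvar i) = x i"
proof -
  have "(\<Prod>j\<in>UNIV. x j ^ Poly_Mapping.lookup (Poly_Mapping.single i (1::nat)) j) =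
      (\<Prod>j\<in>UNIV. if j = i then x i else 1)"
    by (intro prod.cong) (auto simp: lookup_single when_def)
  then show ?thesis
    by (simp add: cvar_def psubst_single c_1)
qed

lemma psubst_sum: "psubst c x (sum f A) = (\<Sum>a\<in>A. psubst c x (f a))"
  by (induction A rule: infinite_finite_induct) (simp_all add: psubst_add)

lemma psubst_prod: "psubst c x (prod f A) = (\<Prod>a\<in>A. psubst c x (f a))"
  by (induction A rule: infinite_finite_induct) (simp_all add: psubst_mult)

lemma psubst_power: "psubst c x (p ^ n) = psubst c x p ^ n"
  by (induction n) (simp_all add: psubst_mult)

end

interpretation eval_hom: const_hom "\<lambda>a. a"
  by unfold_locales simp_all

lemma eval_poly_eq_psubst: "eval_poly p z = psubst (\<lambda>a. a) (($) z) p"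
  by (simp add: eval_poly_def psubst_def)

lemma eval_poly_simps [simp]:
  "eval_poly (p + q) z = eval_poly p z + eval_poly q z"
  "eval_poly (p * q) z = eval_poly p z * eval_poly q z"
  "eval_poly (p - q) z = eval_poly p z - eval_poly q z"
  "eval_poly (- p) z = - eval_poly p z"
  "eval_poly (p ^ n) z = eval_poly p z ^ n"
  "eval_poly 0 z = 0" "eval_poly 1 z = 1"
  "eval_poly (cconst a) z = a" "eval_poly (cvar i) z = z $ i"
  "eval_poly (sum f A) z = (\<Sum>a\<in>A. eval_poly (f a) z)"
  "eval_poly (prod f A) z = (\<Prod>a\<in>A. eval_poly (f a) z)"
  by (simp_all add: eval_poly_eq_psubst eval_hom.psubst_add eval_hom.psubst_mult
      eval_hom.psubst_diff eval_hom.psubst_uminus eval_hom.psubst_power eval_hom.psubst_sum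
      eval_hom.psubst_prod)

lemma eval_poly_single:
  "eval_poly (Poly_Mapping.single m a) z = a * (\<Prod>i\<in>UNIV. (z $ i) ^ Poly_Mapping.lookup m i)"
  by (simp add: eval_poly_eq_psubst eval_hom.psubst_single)

lemma cconst_simps [simp]:
  "cconst 0 = 0" "cconst 1 = 1"
  "cconst (a + b) = cconst a + cconst b" "cconst (a * b) = cconst a * cconst b"
  "cconst (a - b) = cconst a - cconst b" "cconst (- a) = - cconst a"
  "cconst (sum f A) = (\<Sum>x\<in>A. cconst (f x))"
proof -
  show "cconst (sum f A) = (\<Sum>x\<in>A. cconst (f x))"
    by (induction A rule: infinite_finite_induct) (simp_all add: cconst_def single_add)
qed (simp_all add: cconst_def single_add single_diff single_uminus mult_single)

lemma cconst_eq_iff [simp]: "cconst a = cconst b \<longleftrightarrow> a = b"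
  by (simp add: cconst_def inj_eq)

lemma cconst_eq_0_iff [simp]: "cconst a = 0 \<longleftrightarrow> a = 0"
  using cconst_eq_iff[of a 0] by (simp only: cconst_simps(1))

lemma lookup_cconst_mult: "Poly_Mapping.lookup (cconst a * p) m = a * Poly_Mapping.lookup p m"
proof (induction p rule: cpoly_induct)
  case (single n b)
  then show ?case by (simp add: cconst_def mult_single lookup_single when_def)
qed (simp add: algebra_simps lookup_add)

text \<open>Monomials are characters of the monoid of points under coordinatewise multiplication,
  and distinct monomials are distinct characters; independence of characters kills every
  coefficient.\<close>

lemma eval_poly_eq_0_imp:
  fixes p :: "'k::finite cpoly"
  assumes "\<And>z. eval_poly p z = 0"
  shows "p = 0"
proof (rule poly_mapping_eqI)
  fix m
  show "Poly_Mapping.lookup p m = Poly_Mapping.lookup 0 m"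
  proof (cases "m \<in> Poly_Mapping.keys p")
    case True
    have "Poly_Mapping.lookup p m = 0"
    proof (rule dedekind_independence[where S = "Poly_Mapping.keys p" and T = UNIV
          and mul = "\<lambda>x y. \<chi> i. x $ i * y $ i" and e = "\<chi> i. 1"
          and \<phi> = "\<lambda>m z. \<Prod>i\<in>UNIV. (z $ i) ^ Poly_Mapping.lookup m i"])
      show "(\<Sum>m\<in>Poly_Mapping.keys p. Poly_Mapping.lookup p m *
          (\<Prod>i\<in>UNIV. (g $ i) ^ Poly_Mapping.lookup m i)) = 0" for g
        using assms[of g] by (simp add: eval_poly_def)
      fix m m' :: "'k \<Rightarrow>\<^sub>0 nat" assume "m \<noteq> m'"
      then obtain i where i: "Poly_Mapping.lookup m i \<noteq> Poly_Mapping.lookup m' i"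
        by (meson poly_mapping_eqI)
      \<comment> \<open>At this point a monomial takes the value 2 to its i-th exponent, which tells
        \<open>m\<close> from \<open>m'\<close>.\<close>
      define z :: "complex ^ 'k" where "z = (\<chi> j. if j = i then 2 else 1)"
      have *: "(\<Prod>j\<in>UNIV. (z $ j) ^ Poly_Mapping.lookup n j) = 2 ^ Poly_Mapping.lookup n i" for n
      proof -
        have "(\<Prod>j\<in>UNIV. (z $ j) ^ Poly_Mapping.lookup n j) =
            (\<Prod>j\<in>UNIV. if j = i then 2 ^ Poly_Mapping.lookup n i else 1)"
          by (intro prod.cong) (auto simp: z_def)
        then show ?thesis by simp
      qed
      have pow: "(2::complex) ^ a \<noteq> 2 ^ b" if "a \<noteq> b" for a b :: nat
      proof -
        have "(2::real) ^ a \<noteq> 2 ^ b" using that by simp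
        then show ?thesis
          by (metis norm_numeral norm_power)
      qed
      show "\<exists>g::complex ^ 'k\<in>UNIV. (\<Prod>i\<in>UNIV. (g $ i) ^ Poly_Mapping.lookup m i) \<noteq>
            (\<Prod>i\<in>UNIV. (g $ i) ^ Poly_Mapping.lookup m' i)"
        using pow[OF i] * by (intro bexI[of _ z]) auto
    qed (use True in \<open>auto simp: power_mult_distrib prod.distrib\<close>)
    then show ?thesis by simp
  qed (simp add: in_keys_iff)
qed

lemma eval_poly_eqI: "(\<And>z. eval_poly p z = eval_poly q z) \<Longrightarrow> p = q"
  using eval_poly_eq_0_imp[of "p - q"] by simp

lemma exists_eval_nonzero: "p \<noteq> 0 \<Longrightarrow> \<exists>z. eval_poly p z \<noteq> 0"
  using eval_poly_eq_0_imp by blast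

section \<open>Formal partial derivatives\<close>

lemma pdiff_single:
  "pdiff i (Poly_Mapping.single m a) =
     Poly_Mapping.single (m - Poly_Mapping.single i 1) (of_nat (Poly_Mapping.lookup m i) * a)"
  by (simp add: pdiff_def)

lemma pdiff_add: "pdiff i (p + q) = pdiff i p + pdiff i q"
  unfolding pdiff_def
  by (rule setsum_keys_plus_distrib[where f = "\<lambda>m a. Poly_Mapping.single
        (m - Poly_Mapping.single i 1) (of_nat (Poly_Mapping.lookup m i) * a)"])
    (simp_all add: algebra_simps single_add)

lemma pdiff_0 [simp]: "pdiff i 0 = 0"
  by (simp add: pdiff_def)

lemma pdiff_uminus: "pdiff i (- p) = - pdiff i p"
  using pdiff_add[of i p "- p"] by (simp add: add_eq_0_iff)

lemma pdiff_diff: "pdiff i (p - q) = pdiff i p - pdiff i q"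
  using pdiff_add[of i p "- q"] by (simp add: pdiff_uminus)

lemma pdiff_sum: "pdiff i (sum f A) = (\<Sum>a\<in>A. pdiff i (f a))"
  by (induction A rule: infinite_finite_induct) (simp_all add: pdiff_add)

text \<open>Truncated subtraction of exponents commutes with addition only where the i-th exponent
  is positive; where it is zero, the factor \<open>of_nat\<close> annihilates the term. Hence the
  case split.\<close>

lemma pdiff_single_mult_single:
  fixes m n :: "'k \<Rightarrow>\<^sub>0 nat"
  shows "pdiff i (Poly_Mapping.single m a * Poly_Mapping.single n b) =
    pdiff i (Poly_Mapping.single m a) * Poly_Mapping.single n b +
    Poly_Mapping.single m a * pdiff i (Poly_Mapping.single n b)"
proof -
  have 1: "m + n - Poly_Mapping.single i (Suc 0) = m - Poly_Mapping.single i (Suc 0) + n"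
    if "Poly_Mapping.lookup m i \<noteq> 0" for m n :: "'k \<Rightarrow>\<^sub>0 nat"
    using that by (intro poly_mapping_eqI) (auto simp: lookup_add lookup_minus lookup_single when_def)
  have 2: "m + n - Poly_Mapping.single i (Suc 0) = m + (n - Poly_Mapping.single i (Suc 0))"
    if "Poly_Mapping.lookup n i \<noteq> 0"
    using 1[of n m] that by (simp add: add.commute)
  have 3: "n + (m - Poly_Mapping.single i (Suc 0)) = m + n - Poly_Mapping.single i (Suc 0)"
    "m - Poly_Mapping.single i (Suc 0) + n = m + n - Poly_Mapping.single i (Suc 0)"
    if "Poly_Mapping.lookup m i \<noteq> 0"
    using 1[of m n] that by (simp_all add: add.commute)
  show ?thesis
    by (cases "Poly_Mapping.lookup m i = 0"; cases "Poly_Mapping.lookup n i = 0")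
      (simp_all add: pdiff_single mult_single 2[symmetric] 3 lookup_add ring_distribs mult_ac flip: single_add)
qed

lemma pdiff_mult: "pdiff i (p * q) = pdiff i p * q + p * pdiff i q"
proof (induction p rule: cpoly_induct)
  case (single m a)
  show ?case
    by (induction q rule: cpoly_induct)
      (simp_all add: pdiff_single_mult_single pdiff_add algebra_simps)
qed (simp add: pdiff_add algebra_simps)

lemma pdiff_cconst [simp]: "pdiff i (cconst a) = 0"
  by (simp add: cconst_def pdiff_single)

lemma pdiff_commute: "pdiff i (pdiff j p) = pdiff j (pdiff i p)"
proof (induction p rule: cpoly_induct)
  case (single m a)
  have "m - Poly_Mapping.single i 1 - Poly_Mapping.single j 1 =
        m - Poly_Mapping.single j 1 - Poly_Mapping.single i (1::nat)"
    by (intro poly_mapping_eqI) (auto simp: lookup_minus)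
  then show ?case
    by (auto simp: pdiff_single lookup_minus lookup_single when_def algebra_simps)
qed (simp add: pdiff_add)

lemma pdiff_cvar: "pdiff i (cvar j) = (if i = j then 1 else 0)"
  by (auto simp: cvar_def pdiff_single lookup_single when_def)

section \<open>Restriction to lines\<close>

definition fline :: "complex ^ 'k \<Rightarrow> complex ^ 'k \<Rightarrow> 'k::finite cpoly \<Rightarrow> complex poly" where
  "fline v z f = psubst (\<lambda>a. [:a:]) (\<lambda>i. [:z $ i, v $ i:]) f"

interpretation fline_hom: const_hom "\<lambda>a::complex. [:a:]"
  by unfold_locales (simp_all add: one_pCons)

lemma fline_simps [simp]:
  "fline v z (p + q) = fline v z p + fline v z q"
  "fline v z (p * q) = fline v z p * fline v z q"
  "fline v z (p - q) = fline v z p - fline v z q"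
  "fline v z (- p) = - fline v z p"
  "fline v z (p ^ n) = fline v z p ^ n"
  "fline v z 0 = 0" "fline v z 1 = 1"
  "fline v z (cconst a) = [:a:]" "fline v z (cvar i) = [:z $ i, v $ i:]"
  "fline v z (sum f A) = (\<Sum>a\<in>A. fline v z (f a))"
  "fline v z (prod f A) = (\<Prod>a\<in>A. fline v z (f a))"
  by (simp_all add: fline_def fline_hom.psubst_add fline_hom.psubst_mult
      fline_hom.psubst_diff fline_hom.psubst_uminus fline_hom.psubst_power fline_hom.psubst_sum
      fline_hom.psubst_prod)

lemma cpoly_algebra_induct [case_names const var add mult]:
  fixes p :: "'k::finite cpoly"
  assumes const: "\<And>a. P (cconst a)" and var: "\<And>i. P (cvar i)"
    and add: "\<And>p q. P p \<Longrightarrow> P q \<Longrightarrow> P (p + q)" and mult: "\<And>p q. P p \<Longrightarrow> P q \<Longrightarrow> P (p * q)"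
  shows "P p"
proof (induction p rule: cpoly_induct)
  case (single m a)
  have one: "P 1" using const[of 1] by simp
  have "P (cvar i ^ n)" for i n
    by (induction n) (simp_all add: one var mult)
  then have "P (\<Prod>i\<in>A. cvar i ^ Poly_Mapping.lookup m i)" for A
    by (induction A rule: infinite_finite_induct) (simp_all add: one mult)
  then have "P (cconst a * (\<Prod>i\<in>UNIV. cvar i ^ Poly_Mapping.lookup m i))"
    by (intro mult const)
  moreover have "Poly_Mapping.single m a = cconst a * (\<Prod>i\<in>UNIV. cvar i ^ Poly_Mapping.lookup m i)"
    by (rule eval_poly_eqI) (simp add: eval_poly_single)
  ultimately show ?case by simp
qed (rule add)

lemma poly_fline: "poly (fline v z p) t = eval_poly p (z + t *s v)"
  by (induction p rule: cpoly_algebra_induct) (simp_all add: algebra_simps)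

lemma pderiv_fline: "pderiv (fline v z p) = (\<Sum>i\<in>UNIV. [:v $ i:] * fline v z (pdiff i p))"
proof (induction p rule: cpoly_algebra_induct)
  case (var i)
  have "(\<Sum>j\<in>UNIV. [:v $ j:] * fline v z (pdiff j (cvar i))) = (\<Sum>j\<in>UNIV. if j = i then [:v $ i:] else 0)"
    by (intro sum.cong) (auto simp: pdiff_cvar)
  then show ?case by (simp add: pderiv_pCons)
next
  case (mult p q)
  then show ?case
    by (simp add: pderiv_mult pdiff_mult algebra_simps sum.distrib sum_distrib_left)
qed (simp_all add: pderiv_pCons pderiv_add pdiff_add algebra_simps sum.distrib)

text \<open>This is f(x + t v) with the base point x kept as the variables. Unlike
  \<open>fline\<close> it determines f, by t = 0, so divisibility can be pulled back from
  it.\<close>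

definition line :: "complex ^ 'k \<Rightarrow> 'k::finite cpoly \<Rightarrow> 'k cpoly poly" where
  "line v f = psubst (\<lambda>a. [:cconst a:]) (\<lambda>i. [:cvar i, cconst (v $ i):]) f"

interpretation line_hom: const_hom "\<lambda>a. [:cconst a:]"
  by unfold_locales (simp_all add: one_pCons)

lemma line_simps [simp]:
  "line v (p + q) = line v p + line v q"
  "line v (p * q) = line v p * line v q"
  "line v (p - q) = line v p - line v q"
  "line v 0 = 0" "line v 1 = 1"
  "line v (cconst a) = [:cconst a:]" "line v (cvar i) = [:cvar i, cconst (v $ i):]"
  by (simp_all add: line_def line_hom.psubst_add line_hom.psubst_mult line_hom.psubst_diff)

lemma poly_line_0 [simp]: "poly (line v f) 0 = f"
  by (induction f rule: cpoly_algebra_induct) simp_all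

lemma line_eq_0_iff [simp]: "line v f = 0 \<longleftrightarrow> f = 0"
proof
  assume "line v f = 0"
  then have "poly (line v f) 0 = 0" by (simp only: poly_0)
  then show "f = 0" by simp
qed simp

lemma line_dvd: "f dvd g \<Longrightarrow> line v f dvd line v g"
  by (auto simp: dvd_def)

definition spec :: "complex ^ 'k \<Rightarrow> 'k::finite cpoly poly \<Rightarrow> complex poly" where
  "spec z F = map_poly (\<lambda>p. eval_poly p z) F"

lemma coeff_spec [simp]: "coeff (spec z F) n = eval_poly (coeff F n) z"
  by (simp add: spec_def coeff_map_poly)

lemma spec_simps [simp]:
  "spec z (F + G) = spec z F + spec z G"
  "spec z (F * G) = spec z F * spec z G"
  "spec z (F - G) = spec z F - spec z G"
  "spec z 0 = 0"
  "spec z (smult a F) = smult (eval_poly a z) (spec z F)"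
  "spec z [:a:] = [:eval_poly a z:]"
  "spec z (pCons a F) = pCons (eval_poly a z) (spec z F)"
  by (simp_all add: poly_eq_iff coeff_mult coeff_pCons split: nat.split)

lemma degree_spec_le: "degree (spec z F) \<le> degree F"
  by (rule degree_le) (simp add: coeff_eq_0)

lemma spec_line: "spec z (line v f) = fline v z f"
  by (induction f rule: cpoly_algebra_induct) simp_all

section \<open>Total degree and leading forms\<close>

definition mdeg :: "('k::finite \<Rightarrow>\<^sub>0 nat) \<Rightarrow> nat" where
  "mdeg m = (\<Sum>i\<in>UNIV. Poly_Mapping.lookup m i)"

definition tdeg :: "'k::finite cpoly \<Rightarrow> nat" where
  "tdeg f = (if f = 0 then 0 else Max (mdeg ` Poly_Mapping.keys f))"

definition top_form :: "'k::finite cpoly \<Rightarrow> 'k cpoly" where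
  "top_form f = (\<Sum>m\<in>{m \<in> Poly_Mapping.keys f. mdeg m = tdeg f}.
     Poly_Mapping.single m (Poly_Mapping.lookup f m))"

lemma mdeg_le_tdeg: "m \<in> Poly_Mapping.keys f \<Longrightarrow> mdeg m \<le> tdeg f"
  by (auto simp: tdeg_def)

lemma top_form_nonzero:
  assumes "f \<noteq> 0"
  shows "top_form f \<noteq> 0"
proof -
  have "tdeg f \<in> mdeg ` Poly_Mapping.keys f"
    unfolding tdeg_def using assms by (simp add: Max_in)
  then obtain m where m: "m \<in> Poly_Mapping.keys f" "mdeg m = tdeg f"
    by auto
  have "Poly_Mapping.lookup (top_form f) m = Poly_Mapping.lookup f m"
    using m by (simp add: top_form_def lookup_sum lookup_single when_def)
  with m show ?thesis
    by (auto simp: in_keys_iff)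
qed

text \<open>The numbers \<open>a\<close> and \<open>b\<close> are only upper bounds for the degrees:
  the coefficients there may vanish for special directions, and the product formula still
  holds.\<close>

lemma degree_coeff_mult_le:
  assumes "degree p \<le> a" "degree q \<le> b"
  shows "degree (p * q) \<le> a + b" "coeff (p * q) (a + b) = coeff p a * coeff q b"
proof -
  show "degree (p * q) \<le> a + b"
    using assms degree_mult_le[of p q] by linarith
  show "coeff (p * q) (a + b) = coeff p a * coeff q b"
  proof (cases "degree p = a \<and> degree q = b")
    case True
    then show ?thesis using coeff_mult_degree_sum[of p q] by auto
  next
    case False
    then have "degree (p * q) < a + b"
      using assms degree_mult_le[of p q] by linarith
    with False assms show ?thesis
      by (auto simp: coeff_eq_0)
  qed
qed

lemma degree_coeff_linear_power:
  "degree ([:x, a:] ^ n) \<le> n \<and> coeff ([:x, a:] ^ n) n = (a::'a::comm_ring_1) ^ n"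
proof (induction n)
  case (Suc n)
  then show ?case
    using degree_coeff_mult_le[of "[:x, a:]" 1 "[:x, a:] ^ n" n] by simp
qed simp

lemma degree_coeff_prod_linear:
  fixes x a :: "'i \<Rightarrow> 'a::comm_ring_1"
  assumes "finite A"
  shows "degree (\<Prod>i\<in>A. [:x i, a i:] ^ n i) \<le> sum n A \<and>
    coeff (\<Prod>i\<in>A. [:x i, a i:] ^ n i) (sum n A) = (\<Prod>i\<in>A. a i ^ n i)"
  using assms
proof (induction A rule: finite_induct)
  case (insert i A)
  then show ?case
    using degree_coeff_mult_le[of "[:x i, a i:] ^ n i" "n i" "\<Prod>i\<in>A. [:x i, a i:] ^ n i" "sum n A"]
      degree_coeff_linear_power[of "x i" "a i" "n i"] by simp
qed simp

lemma cconst_power: "cconst (a ^ m) = cconst a ^ m"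
  by (induction m) simp_all

lemma cconst_prod_power: "cconst (\<Prod>i\<in>A. f i ^ n i) = (\<Prod>i\<in>A. cconst (f i) ^ n i)"
  by (induction A rule: infinite_finite_induct) (simp_all add: cconst_power)

text \<open>A monomial of degree k, shifted by t v, has t-degree at most k, and its k-th coefficient
  is its value at v, free of x. So only the leading form of f reaches the top power, with a constant
  coefficient.\<close>

lemma degree_line:
  shows degree_line_le: "degree (line v f) \<le> tdeg f"
    and coeff_line_tdeg: "coeff (line v f) (tdeg f) = cconst (eval_poly (top_form f) v)"
proof -
  let ?M = "\<lambda>m. \<Prod>i\<in>UNIV. [:cvar i, cconst (v $ i):] ^ Poly_Mapping.lookup m i"
  have line: "line v f = (\<Sum>m\<in>Poly_Mapping.keys f. smult (cconst (Poly_Mapping.lookup f m)) (?M m))"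
    by (simp add: line_def psubst_def)
  have M: "degree (?M m) \<le> mdeg m"
    "coeff (?M m) (mdeg m) = cconst (\<Prod>i\<in>UNIV. (v $ i) ^ Poly_Mapping.lookup m i)" for m
    using degree_coeff_prod_linear[of UNIV cvar "\<lambda>i. cconst (v $ i)" "Poly_Mapping.lookup m"]
    by (auto simp: mdeg_def cconst_prod_power)
  have "degree (smult (cconst (Poly_Mapping.lookup f m)) (?M m)) \<le> tdeg f"
    if "m \<in> Poly_Mapping.keys f" for m
    using M(1)[of m] mdeg_le_tdeg[OF that] degree_smult_le[of "cconst (Poly_Mapping.lookup f m)" "?M m"]
    by linarith
  then show "degree (line v f) \<le> tdeg f"
    unfolding line by (intro degree_sum_le) auto
  have "coeff (line v f) (tdeg f) = (\<Sum>m\<in>Poly_Mapping.keys f. if mdeg m = tdeg f then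
      cconst (Poly_Mapping.lookup f m) * cconst (\<Prod>i\<in>UNIV. (v $ i) ^ Poly_Mapping.lookup m i) else 0)"
    unfolding line coeff_sum coeff_smult
  proof (intro sum.cong refl)
    fix m assume "m \<in> Poly_Mapping.keys f"
    then have "mdeg m < tdeg f \<or> mdeg m = tdeg f"
      using mdeg_le_tdeg[of m f] by auto
    then show "cconst (Poly_Mapping.lookup f m) * coeff (?M m) (tdeg f) = (if mdeg m = tdeg f then
      cconst (Poly_Mapping.lookup f m) * cconst (\<Prod>i\<in>UNIV. (v $ i) ^ Poly_Mapping.lookup m i) else 0)"
      using M[of m] by (auto simp: coeff_eq_0)
  qed
  also have "\<dots> = cconst (eval_poly (top_form f) v)"
    by (simp add: top_form_def eval_poly_single sum.If_cases Int_def)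
  finally show "coeff (line v f) (tdeg f) = cconst (eval_poly (top_form f) v)" .
qed

lemma line_lead:
  assumes "eval_poly (top_form f) v \<noteq> 0"
  shows "degree (line v f) = tdeg f" "lead_coeff (line v f) = cconst (eval_poly (top_form f) v)"
proof -
  have "coeff (line v f) (tdeg f) \<noteq> 0"
    using assms by (simp add: coeff_line_tdeg)
  then show "degree (line v f) = tdeg f"
    using degree_line_le[of v f] le_degree le_antisym by blast
  then show "lead_coeff (line v f) = cconst (eval_poly (top_form f) v)"
    by (simp add: coeff_line_tdeg)
qed

text \<open>All conditions together say that one nonzero polynomial, the product of the variables
  and the leading forms, does not vanish at v.\<close>

lemma exists_good_direction:
  fixes A :: "'k::{finite,linorder} cpoly set"
  assumes "finite A" "0 \<notin> A"
  shows "\<exists>v. (\<forall>i. v $ i \<noteq> 0) \<and> (\<forall>f\<in>A. eval_poly (top_form f) v \<noteq> 0)"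
proof -
  have var: "cvar i \<noteq> (0 :: 'k cpoly)" for i
    using eval_poly_simps(9)[of i "\<chi> j. 1"] by fastforce
  have "(\<Prod>i\<in>UNIV. cvar i) * (\<Prod>f\<in>A. top_form f) \<noteq> (0 :: 'k cpoly)"
  proof -
    have "\<forall>f\<in>A. top_form f \<noteq> 0"
      using assms(2) top_form_nonzero by metis
    with assms(1) var show ?thesis by auto
  qed
  then obtain v where "eval_poly ((\<Prod>i\<in>UNIV. cvar i) * (\<Prod>f\<in>A. top_form f)) v \<noteq> 0"
    using exists_eval_nonzero by blast
  then show ?thesis
    using assms(1) by (intro exI[of _ v]) simp
qed

text \<open>One direction suited to f, g and f g reduces the claim to degrees of univariate
  polynomials.\<close>

lemma tdeg_mult:
  fixes f g :: "'k::{finite,linorder} cpoly"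
  assumes "f \<noteq> 0" "g \<noteq> 0"
  shows "tdeg (f * g) = tdeg f + tdeg g"
proof -
  obtain v where "\<forall>h\<in>{f, g, f * g}. eval_poly (top_form h) v \<noteq> 0"
    using exists_good_direction[of "{f, g, f * g}"] assms by auto
  then have "degree (line v (f * g)) = tdeg (f * g)" "degree (line v f) = tdeg f"
    "degree (line v g) = tdeg g"
    by (simp_all add: line_lead del: line_simps)
  then show ?thesis
    using assms by (simp add: degree_mult_eq)
qed

lemma tdeg_eq_0_imp:
  assumes "tdeg f = 0"
  shows "\<exists>a. f = cconst a"
proof
  have "m = 0" if "m \<in> Poly_Mapping.keys f" for m
    using mdeg_le_tdeg[OF that] assms by (intro poly_mapping_eqI) (simp add: mdeg_def)
  then have "Poly_Mapping.keys f \<subseteq> {0}" by auto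
  then show "f = cconst (Poly_Mapping.lookup f 0)"
    unfolding cconst_def
    by (intro poly_mapping_eqI) (auto simp: lookup_single when_def in_keys_iff)
qed

lemma tdeg_cconst [simp]: "tdeg (cconst a) = 0"
  by (simp add: tdeg_def cconst_def mdeg_def)

section \<open>Divisibility of polynomials\<close>

text \<open>The bound forces every root of q to be a root of p, and it survives cancelling the
  common linear factor; so the degree of q can be lowered to zero.\<close>

lemma poly_dvd_if_bounded_quotient:
  fixes p q :: "complex poly"
  assumes "q \<noteq> 0" "finite E" and C: "\<And>t. isCont C t"
    and "\<And>t. t \<notin> E \<Longrightarrow> cmod (poly p t) \<le> C t * cmod (poly q t)"
  shows "q dvd p"
  using assms(1,2,4)
proof (induction "degree q" arbitrary: p q E)
  case 0
  then have "is_unit q"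
    by (simp add: is_unit_iff_degree)
  then show ?case by (rule unit_imp_dvd)
next
  case (Suc n)
  then have "\<not> constant (poly q)"
    by (simp add: constant_degree)
  then obtain a where a: "poly q a = 0"
    using fundamental_theorem_of_algebra by blast
  \<comment> \<open>The exceptional set is finite, so the bound holds in a punctured neighbourhood
    of \<open>a\<close> even if \<open>a\<close> is exceptional itself.\<close>
  have ev: "\<forall>\<^sub>F t in at a. cmod (poly p t) \<le> C t * cmod (poly q t)"
    using islimpt_finite[OF Suc.prems(2), of a] Suc.prems(3)
    by (auto simp: islimpt_iff_eventually elim: eventually_mono)
  have "cmod (poly p a) \<le> C a * cmod (poly q a)"
    by (rule tendsto_le[OF _ _ _ ev])
      (use C in \<open>auto intro!: tendsto_intros simp: isCont_def\<close>)
  then have "poly p a = 0" using a by simp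
  then obtain p' where p': "p = [:-a, 1:] * p'"
    by (auto simp: poly_eq_0_iff_dvd)
  obtain q' where q': "q = [:-a, 1:] * q'"
    using a by (auto simp: poly_eq_0_iff_dvd)
  have "q' \<noteq> 0" using q' Suc.prems(1) by auto
  moreover have "n = degree q'"
    using Suc.hyps(2) \<open>q' \<noteq> 0\<close> by (simp add: q' degree_mult_eq del: mult_pCons_left)
  \<comment> \<open>The root joins the exceptional set, because the bound is divided by t -
    a.\<close>
  moreover have "cmod (poly p' t) \<le> C t * cmod (poly q' t)" if "t \<notin> insert a E" for t
  proof -
    have "cmod (t - a) * cmod (poly p' t) \<le> cmod (t - a) * (C t * cmod (poly q' t))"
    proof -
      have "poly p t = (t - a) * poly p' t" "poly q t = (t - a) * poly q' t"
        by (simp_all add: p' q' algebra_simps)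
      then show ?thesis
        using Suc.prems(3)[of t] that by (simp add: norm_mult mult.left_commute)
    qed
    then show ?thesis using that by simp
  qed
  ultimately have "q' dvd p'"
    using Suc.hyps(1)[of q' "insert a E" p'] Suc.prems(2) by auto
  then show ?case by (simp add: p' q' del: mult_pCons_left)
qed

text \<open>Pseudo-division multiplies H by a power of the leading coefficient of F; for a unit this
  can be undone.\<close>

lemma unit_lead_division:
  fixes F H :: "'a::idom poly"
  assumes "lead_coeff F dvd 1"
  shows "\<exists>Q R. H = Q * F + R \<and> (R = 0 \<or> degree R < degree F)"
proof -
  obtain q r where qr: "pseudo_divmod H F = (q, r)" by fastforce
  obtain u where u: "1 = lead_coeff F * u" using assms by auto
  define n where "n = Suc (degree H) - degree F"
  have "F \<noteq> 0" using u by auto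
  note * = pseudo_divmod[OF this qr, folded n_def]
  have "(u * lead_coeff F) ^ n = 1"
    using u by (simp add: mult.commute)
  then have "H = smult (u ^ n) (smult (lead_coeff F ^ n) H)"
    by (simp flip: power_mult_distrib)
  also have "\<dots> = smult (u ^ n) q * F + smult (u ^ n) r"
    by (subst *(1)) (simp add: smult_add_right mult.commute)
  finally show ?thesis
    using *(2) degree_smult_le[of "u ^ n" r]
    by (intro exI[of _ "smult (u ^ n) q"] exI[of _ "smult (u ^ n) r"]) auto
qed

text \<open>Stands in for Gauss's lemma: the remainder of X by F, multiplied by L, is a multiple of
  F of too small a degree, hence zero. It cancels factors introduced by working over the field of
  fractions.\<close>

lemma unit_lead_dvd_smult:
  fixes F X :: "'a::idom poly"
  assumes "lead_coeff F dvd 1" "L \<noteq> 0" "F dvd smult L X"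
  shows "F dvd X"
proof -
  obtain Q R where QR: "X = Q * F + R" "R = 0 \<or> degree R < degree F"
    using unit_lead_division[OF assms(1)] by blast
  have "F dvd smult L R"
    using assms(3) by (simp add: QR(1) smult_add_right dvd_add_right_iff flip: mult_smult_left)
  then have "R = 0"
    using QR(2) assms(2) dvd_imp_degree_le[of F "smult L R"] by (cases "R = 0") auto
  with QR(1) show ?thesis by simp
qed

text \<open>A unit leading coefficient vanishes at no point, so division by F commutes with
  specialisation. The remainder specialises to zero off D = 0, and its coefficients times D vanish
  identically.\<close>

lemma unit_lead_dvd_if_spec:
  fixes F H :: "'k::{finite,linorder} cpoly poly"
  assumes "lead_coeff F dvd 1" "D \<noteq> 0"
    and "\<And>z. eval_poly D z \<noteq> 0 \<Longrightarrow> spec z F dvd spec z H"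
  shows "F dvd H"
proof -
  obtain Q R where QR: "H = Q * F + R" "R = 0 \<or> degree R < degree F"
    using unit_lead_division[OF assms(1)] by blast
  have "spec z R = 0" if z: "eval_poly D z \<noteq> 0" for z
  proof (rule ccontr)
    assume R: "spec z R \<noteq> 0"
    have "spec z F dvd spec z R"
      using assms(3)[OF z] by (simp add: QR(1) dvd_add_right_iff)
    with R have "degree (spec z F) \<le> degree (spec z R)"
      by (rule dvd_imp_degree_le[rotated])
    moreover have "eval_poly (lead_coeff F) z \<noteq> 0"
    proof
      assume "eval_poly (lead_coeff F) z = 0"
      moreover obtain u where u: "1 = lead_coeff F * u" using assms(1) by auto
      have "eval_poly 1 z = eval_poly (lead_coeff F) z * eval_poly u z"
        by (subst u) (simp only: eval_poly_simps)
      ultimately show False by simp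
    qed
    then have "degree F \<le> degree (spec z F)"
      by (intro le_degree) simp
    ultimately show False
      using degree_spec_le[of z R] QR(2) R by auto
  qed
  then have "eval_poly (D * coeff R n) z = 0" for n z
    by (cases "eval_poly D z = 0") (auto simp flip: coeff_spec)
  then have "D * coeff R n = 0" for n
    by (rule eval_poly_eq_0_imp)
  then have "R = 0"
    using assms(2) by (simp add: poly_eq_iff)
  with QR(1) show ?thesis by simp
qed

lemma unit_lead_line:
  assumes "eval_poly (top_form f) v \<noteq> 0"
  shows "lead_coeff (line v f) dvd 1"
proof (rule dvdI)
  show "1 = lead_coeff (line v f) * cconst (1 / eval_poly (top_form f) v)"
    using assms by (simp add: line_lead(2) flip: cconst_simps)
qed

lemma poly_0_dvd: "F dvd H \<Longrightarrow> poly F 0 dvd poly H (0::'a::comm_ring_1)"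
  by (auto simp: dvd_def)

text \<open>In a direction where f has constant leading coefficient, divisibility on almost all
  parallel lines lifts to f(x + t v), and t = 0 gives the claim. Only directions without zero
  coordinates are tested, since these admit lines off the irrelevant locus.\<close>

lemma dvd_if_dvd_on_lines:
  fixes f h :: "'k::{finite,linorder} cpoly"
  assumes "f \<noteq> 0"
    and "\<And>v. \<forall>i. v $ i \<noteq> 0 \<Longrightarrow>
      \<exists>D. D \<noteq> 0 \<and> (\<forall>z. eval_poly D z \<noteq> 0 \<longrightarrow> fline v z f dvd fline v z h)"
  shows "f dvd h"
proof -
  obtain v where v: "\<forall>i. v $ i \<noteq> 0" "eval_poly (top_form f) v \<noteq> 0"
    using exists_good_direction[of "{f}"] assms(1) by auto
  obtain D where "D \<noteq> 0" "\<forall>z. eval_poly D z \<noteq> 0 \<longrightarrow> fline v z f dvd fline v z h"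
    using assms(2)[OF v(1)] by blast
  then have "line v f dvd line v h"
    by (intro unit_lead_dvd_if_spec[OF unit_lead_line[OF v(2)]]) (auto simp: spec_line)
  from poly_0_dvd[OF this] show ?thesis by simp
qed

lemma fline_nonzero: "eval_poly D z \<noteq> 0 \<Longrightarrow> fline v z D \<noteq> 0"
  using poly_fline[of v z D 0] by auto

lemma continuous_eval_poly [continuous_intros]:
  "continuous_on UNIV (eval_poly p)"
proof -
  have "continuous_on UNIV (\<lambda>z. \<Sum>m\<in>Poly_Mapping.keys p.
      Poly_Mapping.lookup p m * (\<Prod>i\<in>UNIV. (z $ i) ^ Poly_Mapping.lookup m i))"
    by (intro continuous_intros)
  then show ?thesis by (simp add: eval_poly_def[abs_def])
qed

text \<open>An algebraic form of Riemann's extension theorem: a quotient bounded, off a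
  hypersurface, by a continuous function is a polynomial.\<close>

lemma dvd_if_bounded_quotient:
  fixes L G D :: "'k::{finite,linorder} cpoly"
  assumes "L \<noteq> 0" "D \<noteq> 0" and C: "continuous_on UNIV C"
    and bound: "\<And>z. eval_poly D z \<noteq> 0 \<Longrightarrow> cmod (eval_poly G z) \<le> C z * cmod (eval_poly L z)"
  shows "L dvd G"
proof (rule dvd_if_dvd_on_lines[OF assms(1)])
  fix v :: "(complex, 'k) vec"
  \<comment> \<open>A base point off D = 0 leaves finitely many exceptional parameters, and one off
    L = 0 keeps the divisor nonzero on the line.\<close>
  have "fline v z L dvd fline v z G" if "eval_poly (D * L) z \<noteq> 0" for z
  proof (rule poly_dvd_if_bounded_quotient)
    show "fline v z L \<noteq> 0"
      using that by (intro fline_nonzero) auto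
    show "finite {t. poly (fline v z D) t = 0}"
      using that by (intro poly_roots_finite fline_nonzero) auto
    have "continuous_on UNIV (\<lambda>t. C (z + t *s v))"
      by (intro continuous_on_compose2[OF C] continuous_intros
          continuous_on_vec_lambda[where f = "\<lambda>i t. z $ i + t * v $ i", simplified]) 
        (auto simp: vector_scalar_mult_def intro!: continuous_intros)
    then show "isCont (\<lambda>t. C (z + t *s v)) t" for t
      by (simp add: continuous_on_eq_continuous_at)
    show "cmod (poly (fline v z G) t) \<le> C (z + t *s v) * cmod (poly (fline v z L) t)"
      if "t \<notin> {t. poly (fline v z D) t = 0}" for t
      using bound[of "z + t *s v"] that by (simp add: poly_fline)
  qed
  then show "\<exists>D. D \<noteq> 0 \<and> (\<forall>z. eval_poly D z \<noteq> 0 \<longrightarrow> fline v z L dvd fline v z G)"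
    using assms(1,2) by (intro exI[of _ "D * L"]) simp
qed

section \<open>Greatest common divisors of polynomials\<close>

lemma complex_root_bound:
  fixes f :: "complex poly"
  assumes "f \<noteq> 0" "poly f t = 0"
  shows "cmod t \<le> 1 + (\<Sum>i\<le>degree f. cmod (coeff f i)) / cmod (lead_coeff f)"
proof (cases "cmod t \<le> 1")
  \<comment> \<open>The summand 1 of the bound covers this case; outside the unit disc all lower
    powers of t are dominated by the n-th.\<close>
  case True
  then show ?thesis
    by (intro order_trans[OF True]) (simp add: sum_nonneg)
next
  case False
  define S where "S = (\<Sum>i\<le>degree f. cmod (coeff f i))"
  have deg: "degree f \<noteq> 0"
  proof
    assume "degree f = 0"
    then obtain c where "f = [:c:]" by (rule degree_eq_zeroE)
    with assms show False by simp
  qed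
  then obtain n where n: "degree f = Suc n"
    using not0_implies_Suc by blast
  have "0 = (\<Sum>i\<le>n. coeff f i * t ^ i) + lead_coeff f * t ^ Suc n"
    using assms(2) by (simp add: poly_altdef n)
  then have "lead_coeff f * t ^ Suc n = - (\<Sum>i\<le>n. coeff f i * t ^ i)"
    by (simp add: eq_neg_iff_add_eq_0 add.commute)
  then have "cmod (lead_coeff f) * cmod t ^ Suc n = cmod (\<Sum>i\<le>n. coeff f i * t ^ i)"
    by (metis norm_minus_cancel norm_mult norm_power)
  also have "\<dots> \<le> (\<Sum>i\<le>n. cmod (coeff f i) * cmod t ^ n)"
    using False by (intro sum_norm_le) (auto simp: norm_mult norm_power intro!: mult_left_mono power_increasing)
  also have "\<dots> = (\<Sum>i\<le>n. cmod (coeff f i)) * cmod t ^ n"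
    by (simp add: sum_distrib_right)
  also have "\<dots> \<le> S * cmod t ^ n"
    by (intro mult_right_mono) (simp_all add: S_def n)
  finally have "(cmod (lead_coeff f) * cmod t) * cmod t ^ n \<le> S * cmod t ^ n"
    by (simp add: algebra_simps)
  moreover have "cmod t ^ n > 0" using False by (intro zero_less_power) auto
  ultimately have "cmod (lead_coeff f) * cmod t \<le> S"
    by simp
  then have "cmod t \<le> S / cmod (lead_coeff f)"
    using assms(1) by (simp add: pos_le_divide_eq mult.commute)
  then show ?thesis unfolding S_def by linarith
qed

text \<open>Split off one root at a time: multiplication by t - a with |a| at most B enlarges the
  bound on the coefficients by the factor 1 + B.\<close>

lemma coeff_bound_of_roots:
  fixes g :: "complex poly"
  assumes "lead_coeff g = 1" "B \<ge> 0" "\<And>t. poly g t = 0 \<Longrightarrow> cmod t \<le> B"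
  shows "cmod (coeff g i) \<le> (1 + B) ^ degree g"
  using assms(1,3)
proof (induction "degree g" arbitrary: g i)
  case 0
  then have "g = 1"
    by (metis degree_eq_zeroE lead_coeff_pCons(2) one_pCons)
  then show ?case by (cases i) (auto simp: one_pCons)
next
  case (Suc n)
  then have "\<not> constant (poly g)"
    by (simp add: constant_degree)
  then obtain a where a: "poly g a = 0"
    using fundamental_theorem_of_algebra by blast
  then obtain h where h: "g = [:-a, 1:] * h"
    by (auto simp: poly_eq_0_iff_dvd)
  have "h \<noteq> 0" using h Suc.prems(1) by auto
  then have deg: "n = degree h"
    using Suc.hyps(2) by (simp add: h degree_mult_eq del: mult_pCons_left)
  have lead: "lead_coeff h = 1"
    using Suc.prems(1) unfolding h lead_coeff_mult by simp
  have IH: "cmod (coeff h i) \<le> (1 + B) ^ n" for i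
    using Suc.hyps(1)[OF deg lead] Suc.prems(2) deg by (simp add: h)
  have "coeff g i = (case i of 0 \<Rightarrow> 0 | Suc j \<Rightarrow> coeff h j) - a * coeff h i"
    by (simp add: h coeff_pCons split: nat.split)
  then have "cmod (coeff g i) \<le> (case i of 0 \<Rightarrow> 0 | Suc j \<Rightarrow> cmod (coeff h j)) + cmod a * cmod (coeff h i)"
    by (auto simp: norm_mult split: nat.splits intro: order_trans[OF norm_triangle_ineq4])
  also have "\<dots> \<le> (1 + B) ^ n + B * (1 + B) ^ n"
    using IH Suc.prems(2)[OF a] assms(2)
    by (intro add_mono mult_mono) (auto split: nat.split)
  also have "\<dots> = (1 + B) ^ degree g"
    by (simp add: Suc.hyps(2)[symmetric] algebra_simps)
  finally show ?case .
qed

text \<open>Euclid's algorithm with pseudo-remainders; \<open>b\<close> collects the scalars by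
  which F and A have to be multiplied.\<close>

lemma pseudo_bezout:
  fixes F A :: "'a::idom poly"
  assumes "F \<noteq> 0"
  shows "\<exists>G U W F' A' b. b \<noteq> 0 \<and> G \<noteq> 0 \<and> smult b F = G * F' \<and> smult b A = G * A' \<and> G = U * F + W * A"
  using assms
\<comment> \<open>The zero polynomial has degree 0 like a nonzero constant; the shift makes its
  measure strictly smaller.\<close>
proof (induction "if A = 0 then 0 else Suc (degree A)" arbitrary: F A rule: less_induct)
  case less
  show ?case
  proof (cases "A = 0")
    case True
    then show ?thesis
      using less.prems by (intro exI[of _ F] exI[of _ 1] exI[of _ 0]) simp
  next
    case False
    define r where "r = pseudo_mod F A"
    obtain c q where c: "c \<noteq> 0" "smult c F = A * q + r"
      using pseudo_mod(1)[OF False, of F] unfolding r_def by blast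
    have r: "r = 0 \<or> degree r < degree A"
      using pseudo_mod(2)[OF False, of F] unfolding r_def .
    have "(if r = 0 then 0 else Suc (degree r)) < (if A = 0 then 0 else Suc (degree A))"
      using r False by auto
    from less.hyps[OF this False] obtain G U W A' r' b where *: "b \<noteq> 0" "G \<noteq> 0"
      "smult b A = G * A'" "smult b r = G * r'" "G = U * A + W * r"
      by blast
    have "smult (b * c) F = smult b A * q + smult b r"
      by (simp add: c(2) smult_add_right flip: smult_smult)
    also have "\<dots> = G * (A' * q + r')"
      by (simp add: * algebra_simps)
    finally have 1: "smult (b * c) F = G * (A' * q + r')" .
    have 2: "smult (b * c) A = G * smult c A'"
      using arg_cong[OF *(3), of "smult c"] by (simp add: mult.commute)
    have "r = smult c F - A * q" by (simp add: c(2))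
    with *(5) have "G = U * A + W * (smult c F - A * q)" by simp
    then have 3: "G = smult c W * F + (U - W * q) * A"
      by (simp add: algebra_simps)
    show ?thesis
      using *(1,2) c(1) 1 2 3
      by (intro exI[of _ G] exI[of _ "smult c W"] exI[of _ "U - W * q"] exI[of _ "A' * q + r'"]
          exI[of _ "smult c A'"] exI[of _ "b * c"]) auto
  qed
qed

text \<open>
  A greatest common divisor over the field of fractions, computed along a direction in which
  \<open>f\<close> is monic, can be made monic without denominators: where its leading coefficient \<open>L\<close>
  does not vanish, its coefficients divided by \<open>L\<close> are bounded in terms of the roots of \<open>f\<close>, so
  \<open>L\<close> divides them.
\<close>

theorem exists_gcd_cpoly:
  fixes f a :: "'k::{finite,linorder} cpoly"
  assumes "f \<noteq> 0"
  shows "\<exists>g. g dvd f \<and> g dvd a \<and> (\<forall>b. b dvd f \<and> b dvd a \<longrightarrow> b dvd g) \<and>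
    (\<forall>b. f dvd a * b \<longrightarrow> f dvd g * b)"
proof -
  obtain v where v: "eval_poly (top_form f) v \<noteq> 0"
    using exists_good_direction[of "{f}"] assms by auto
  define F A where "F = line v f" and "A = line v a"
  have F: "F \<noteq> 0" "poly F 0 = f" "poly A 0 = a" using assms by (simp_all add: F_def A_def)
  define c where "c = eval_poly (top_form f) v"
  have c: "c \<noteq> 0" "lead_coeff F = cconst c" "lead_coeff F dvd 1"
    using v line_lead(2)[OF v] unit_lead_line[OF v] by (simp_all add: F_def c_def)
  obtain G U W F' A' b where G: "b \<noteq> 0" "G \<noteq> 0" "smult b F = G * F'" "smult b A = G * A'"
    "G = U * F + W * A"
    using pseudo_bezout[OF F(1), of A] by blast
  define L where "L = lead_coeff G"
  have L: "L \<noteq> 0" using G(2) by (simp add: L_def)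
  define n where "n = degree F"
  \<comment> \<open>The 2 is the 1 of \<open>coeff_bound_of_roots\<close> plus the 1 of
    \<open>complex_root_bound\<close>. The leading coefficient of F is the constant c, so C is
    continuous; the base is at least 1, so the exponent n covers divisors of smaller degree.\<close>
  define C where "C z = (2 + (\<Sum>i\<le>n. cmod (eval_poly (coeff F i) z)) / cmod c) ^ n" for z
  \<comment> \<open>Where \<open>b\<close> is nonzero, the specialised G divides the specialised F,
    and where L is nonzero, G keeps its degree. There the roots of G are roots of F, whose size is
    under control.\<close>
  have "L dvd coeff G i" for i
  proof (rule dvd_if_bounded_quotient[where D = "b * L" and C = C])
    show "L \<noteq> 0" "b * L \<noteq> 0" using L G(1) by auto
    show "continuous_on UNIV C"
      unfolding C_def by (intro continuous_intros) (use c(1) in auto)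
    fix z assume "eval_poly (b * L) z \<noteq> 0"
    then have z: "eval_poly b z \<noteq> 0" "eval_poly L z \<noteq> 0" by auto
    have degG: "degree (spec z G) = degree G"
      using z(2) le_degree[of "spec z G" "degree G"] degree_spec_le[of z G] by (auto simp: L_def)
    have degF: "degree (spec z F) = n"
      using c le_degree[of "spec z F" "degree F"] degree_spec_le[of z F] by (auto simp: n_def)
    have "smult (eval_poly b z) (spec z F) = spec z G * spec z F'"
      using arg_cong[OF G(3), of "spec z"] by simp
    then have "spec z G dvd smult (eval_poly b z) (spec z F)" by simp
    then have dvd: "spec z G dvd spec z F"
      using z(1) by (simp add: dvd_smult_iff)
    define g where "g = smult (1 / eval_poly L z) (spec z G)"
    have g: "lead_coeff g = 1" "degree g = degree G"
      using z(2) degG by (simp_all add: g_def L_def)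
    have "g dvd spec z F"
      using dvd z(2) by (simp add: g_def smult_dvd_iff)
    then have roots: "poly (spec z F) t = 0" if "poly g t = 0" for t
      using that by (auto simp: dvd_def)
    have "spec z F \<noteq> 0"
      using c degF by (metis coeff_spec eval_poly_simps(8) n_def coeff_0)
    then have "cmod (coeff g i) \<le> (1 + (1 + (\<Sum>i\<le>n. cmod (coeff (spec z F) i)) / cmod c)) ^ degree g"
      using complex_root_bound[of "spec z F"] roots c(2)
      by (intro coeff_bound_of_roots g(1)) (auto simp: degF n_def intro!: add_nonneg_nonneg divide_nonneg_nonneg sum_nonneg)
    also have "\<dots> \<le> C z"
    proof -
      have "degree g \<le> n"
        using dvd_imp_degree_le[OF dvd \<open>spec z F \<noteq> 0\<close>] degG degF g(2) by simp
      moreover have "1 \<le> 2 + (\<Sum>i\<le>n. cmod (eval_poly (coeff F i) z)) / cmod c"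
        by (rule order_trans[of _ 2]) (auto intro!: divide_nonneg_nonneg sum_nonneg)
      ultimately show ?thesis
        unfolding C_def by (simp add: power_increasing)
    qed
    finally have "cmod (coeff g i) \<le> C z" .
    then show "cmod (eval_poly (coeff G i) z) \<le> C z * cmod (eval_poly L z)"
      using z(2) by (simp add: g_def norm_divide pos_divide_le_eq)
  qed
  then obtain G' where G': "G = smult L G'"
  proof -
    have "[:L:] dvd G"
      using \<open>\<And>i. L dvd coeff G i\<close> by (simp add: const_poly_dvd_iff)
    then show ?thesis using that by (auto elim!: dvdE)
  qed
  have lead: "lead_coeff G' dvd 1"
  proof -
    have "L * lead_coeff G' = L * 1"
    proof -
      have "degree G = degree G'" using L by (simp add: G')
      then have "L = coeff G (degree G')" by (simp only: L_def)
      also have "\<dots> = L * lead_coeff G'" by (subst G') (simp only: coeff_smult)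
      finally show ?thesis by (simp only: mult_1_right)
    qed
    then show ?thesis using L by simp
  qed
  have "G' dvd smult b F" "G' dvd smult b A"
    using G(3,4) by (simp_all add: G' smult_dvd dvd_smult)
  then have *: "G' dvd F" "G' dvd A"
    using unit_lead_dvd_smult[OF lead G(1)] by blast+
  \<comment> \<open>As a factor of F, \<open>line v q\<close> inherits a unit leading coefficient,
    so the factor L can be removed from G = L G'.\<close>
  have "q dvd poly G' 0" if "q dvd f" "q dvd a" for q
  proof -
    have "line v q dvd F" "line v q dvd A"
      using line_dvd that by (auto simp: F_def A_def)
    then have "line v q dvd G" by (subst G(5)) (simp add: dvd_add)
    moreover have "lead_coeff (line v q) dvd 1"
    proof -
      obtain H where "F = line v q * H" using \<open>line v q dvd F\<close> by auto
      then have "lead_coeff (line v q) dvd lead_coeff F" by (simp add: lead_coeff_mult)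
      then show ?thesis using c(3) dvd_trans by blast
    qed
    ultimately have "line v q dvd G'"
      using unit_lead_dvd_smult L G' by blast
    from poly_0_dvd[OF this] show ?thesis by simp
  qed
  \<comment> \<open>This second property later gives Euclid's lemma; it follows from the Bezout
    identity for G.\<close>
  moreover have "f dvd poly G' 0 * q" if "f dvd a * q" for q
  proof -
    have "F dvd A * line v q"
      using line_dvd[OF that, of v] by (simp add: F_def A_def)
    then have "F dvd (U * F + W * A) * line v q"
      by (simp add: distrib_right mult.assoc dvd_add)
    then have "F dvd smult L (G' * line v q)"
      unfolding G(5)[symmetric] by (simp add: G')
    then have "F dvd G' * line v q"
      using unit_lead_dvd_smult[OF c(3) L] by blast
    from poly_0_dvd[OF this] show ?thesis by (simp add: F)
  qed
  ultimately show ?thesis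
    using poly_0_dvd[OF *(1)] poly_0_dvd[OF *(2)] by (intro exI[of _ "poly G' 0"]) (auto simp: F)
qed

section \<open>The irrelevant locus has codimension at least two\<close>

text \<open>If only the i-th coordinate vanishes, the monomial of the cone
  \<open>ray (\<nu> i)\<close> omits it and is nonzero. So the irrelevant locus lies where two
  coordinates vanish.\<close>

lemma not_irrelevant_if:
  assumes "fan \<Delta>" "ray_generators \<Delta> \<nu>" and "\<And>i j. z $ i = 0 \<Longrightarrow> z $ j = 0 \<Longrightarrow> i = j"
  shows "z \<notin> irrelevant_locus \<Delta> \<nu>"
proof -
  have "\<exists>\<sigma>\<in>\<Delta>. (\<Prod>i\<in>{i. \<not> cone_face (ray (\<nu> i)) \<sigma>}. z $ i) \<noteq> 0"
  proof (cases "\<exists>i. z $ i = 0")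
    case True
    then obtain i where i: "z $ i = 0" by blast
    have "ray (\<nu> i) \<in> rays \<Delta>"
      using assms(2) unfolding ray_generators_def bij_betw_def by auto
    then have "ray (\<nu> i) \<in> \<Delta>" by (simp add: rays_def)
    moreover have "cone_face (ray (\<nu> i)) (ray (\<nu> i))"
      unfolding cone_face_def ray_def
      by (simp add: face_of_refl convex_convex_cone_hull convex_cone_hull_nonempty)
    then have "\<forall>j. \<not> cone_face (ray (\<nu> j)) (ray (\<nu> i)) \<longrightarrow> z $ j \<noteq> 0"
      using assms(3)[OF i] by metis
    ultimately show ?thesis
      by (intro bexI[of _ "ray (\<nu> i)"]) auto
  next
    case False
    obtain \<sigma> where "\<sigma> \<in> \<Delta>" using assms(1) by (auto simp: fan_def)
    with False show ?thesis by (intro bexI[of _ \<sigma>]) auto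
  qed
  then show ?thesis unfolding irrelevant_locus_def by blast
qed

text \<open>The i-th coordinate vanishes on the line only at t = - z_i / v_i, and D is nonzero
  exactly when these parameters are pairwise distinct.\<close>

lemma generic_line_avoids_irrelevant:
  fixes \<nu> :: "'k::{finite,linorder} \<Rightarrow> int ^ 'n"
  assumes "fan \<Delta>" "ray_generators \<Delta> \<nu>" and v: "\<forall>i. v $ i \<noteq> 0"
  shows "\<exists>D. D \<noteq> 0 \<and> (\<forall>z. eval_poly D z \<noteq> 0 \<longrightarrow> (\<forall>t. z + t *s v \<notin> irrelevant_locus \<Delta> \<nu>))"
proof -
  define E where "E i j = cvar i * cconst (v $ j) - cvar j * cconst (v $ i)" for i j
  define D where "D = (\<Prod>(i, j)\<in>{(i, j). i \<noteq> j}. E i j)"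
  have "E i j \<noteq> 0" if "i \<noteq> j" for i j
  proof
    assume "E i j = 0"
    then have "eval_poly (E i j) (\<chi> l. if l = i then 1 else 0) = 0" by simp
    with that v show False by (simp add: E_def)
  qed
  then have "D \<noteq> 0"
    unfolding D_def by (subst prod_zero_iff) auto
  moreover have "z + t *s v \<notin> irrelevant_locus \<Delta> \<nu>" if z: "eval_poly D z \<noteq> 0" for z t
  proof (rule not_irrelevant_if[OF assms(1,2)])
    fix i j assume "(z + t *s v) $ i = 0" "(z + t *s v) $ j = 0"
    then have "z $ i = - t * v $ i" "z $ j = - t * v $ j"
      by (simp_all add: eq_neg_iff_add_eq_0)
    then have "eval_poly (E i j) z = 0"
      by (simp add: E_def)
    then show "i = j"
      using z by (auto simp: D_def split_def)
  qed
  ultimately show ?thesis by blast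
qed

lemma line_isCont:
  assumes "isCont \<Theta> (z + t *s (v :: (complex, 'k::finite) vec))"
  shows "isCont (\<lambda>t. \<Theta> (z + t *s v)) t"
proof (rule isCont_o2[where f = "\<lambda>t. z + t *s v", OF _ assms])
  have "continuous_on UNIV (\<lambda>t. z + t *s v)"
    by (intro continuous_intros continuous_on_vec_lambda[where f = "\<lambda>i t. z $ i + t * v $ i", simplified])
      (auto simp: vector_scalar_mult_def intro!: continuous_intros)
  then show "isCont (\<lambda>t. z + t *s v) t"
    by (simp add: continuous_on_eq_continuous_at)
qed

text \<open>A generic line misses the irrelevant locus altogether, so the quotient is continuous
  along all of it and no exceptional parameter arises. This takes the place of an extension across
  codimension two.\<close>

lemma dvd_if_continuous_quotient:
  fixes \<nu> :: "'k::{finite,linorder} \<Rightarrow> int ^ 'n"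
  assumes "fan \<Delta>" "ray_generators \<Delta> \<nu>" and "f \<noteq> 0"
    and cont: "\<And>z. z \<notin> irrelevant_locus \<Delta> \<nu> \<Longrightarrow> isCont \<Theta> z"
    and quot: "\<And>z. z \<notin> irrelevant_locus \<Delta> \<nu> \<Longrightarrow> eval_poly h z = eval_poly f z * \<Theta> z"
  shows "f dvd h"
proof (rule dvd_if_dvd_on_lines[OF assms(3)])
  fix v :: "(complex, 'k) vec" assume v: "\<forall>i. v $ i \<noteq> 0"
  obtain D where "D \<noteq> 0 \<and>
      (\<forall>z. eval_poly D z \<noteq> 0 \<longrightarrow> (\<forall>t. z + t *s v \<notin> irrelevant_locus \<Delta> \<nu>))"
    using generic_line_avoids_irrelevant[OF assms(1,2) v] ..
  then have D: "D \<noteq> 0"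
    "eval_poly D z \<noteq> 0 \<Longrightarrow> z + t *s v \<notin> irrelevant_locus \<Delta> \<nu>" for z t
    by simp_all
  have "fline v z f dvd fline v z h" if z: "eval_poly (D * f) z \<noteq> 0" for z
  proof (rule poly_dvd_if_bounded_quotient[where E = "{}" and C = "\<lambda>t. cmod (\<Theta> (z + t *s v))"])
    show "fline v z f \<noteq> 0" using z by (intro fline_nonzero) auto
    show "isCont (\<lambda>t. cmod (\<Theta> (z + t *s v))) t" for t
      using z D(2) cont by (intro continuous_intros line_isCont) auto
    show "cmod (poly (fline v z h) t) \<le> cmod (\<Theta> (z + t *s v)) * cmod (poly (fline v z f) t)" for t
      using z D(2) quot by (simp add: poly_fline norm_mult)
  qed simp
  then show "\<exists>D. D \<noteq> 0 \<and> (\<forall>z. eval_poly D z \<noteq> 0 \<longrightarrow> fline v z f dvd fline v z h)"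
    using D(1) assms(3) by (intro exI[of _ "D * f"]) simp
qed

text \<open>The univariate statement holds on each generic line with the degree of the restriction
  as exponent; the total degree bounds all of these, so one exponent serves every line.\<close>

lemma nullstellensatz_hypersurface:
  fixes \<nu> :: "'k::{finite,linorder} \<Rightarrow> int ^ 'n"
  assumes "fan \<Delta>" "ray_generators \<Delta> \<nu>" and "f \<noteq> 0"
    and zeros: "\<And>z. z \<notin> irrelevant_locus \<Delta> \<nu> \<Longrightarrow> eval_poly f z = 0 \<Longrightarrow> eval_poly p z = 0"
  shows "f dvd p ^ tdeg f"
proof (rule dvd_if_dvd_on_lines[OF assms(3)])
  fix v :: "(complex, 'k) vec" assume v: "\<forall>i. v $ i \<noteq> 0"
  obtain D where "D \<noteq> 0 \<and>
      (\<forall>z. eval_poly D z \<noteq> 0 \<longrightarrow> (\<forall>t. z + t *s v \<notin> irrelevant_locus \<Delta> \<nu>))"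
    using generic_line_avoids_irrelevant[OF assms(1,2) v] ..
  then have D: "D \<noteq> 0"
    "eval_poly D z \<noteq> 0 \<Longrightarrow> z + t *s v \<notin> irrelevant_locus \<Delta> \<nu>" for z t
    by simp_all
  have "fline v z f dvd fline v z (p ^ tdeg f)" if z: "eval_poly (D * f) z \<noteq> 0" for z
  proof -
    have "fline v z f \<noteq> 0" using z by (intro fline_nonzero) auto
    moreover have "\<forall>t. poly (fline v z f) t = 0 \<longrightarrow> poly (fline v z p) t = 0"
      using z D(2) zeros by (simp add: poly_fline)
    ultimately have "fline v z f dvd fline v z p ^ degree (fline v z f)"
      by (simp add: nullstellensatz_univariate)
    moreover have "degree (fline v z f) \<le> tdeg f"
      using degree_spec_le[of z "line v f"] degree_line_le[of v f] by (simp add: spec_line)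
    ultimately show ?thesis
      by (simp add: dvd_trans[OF _ le_imp_power_dvd])
  qed
  then show "\<exists>D. D \<noteq> 0 \<and> (\<forall>z. eval_poly D z \<noteq> 0 \<longrightarrow> fline v z f dvd fline v z (p ^ tdeg f))"
    using D(1) assms(3) by (intro exI[of _ "D * f"]) simp
qed

section \<open>The grading by the class group\<close>

lemma principal_0 [simp]: "(\<lambda>i. 0) \<in> principal_divisors \<nu>"
  by (auto simp: principal_divisors_def pairing_def intro!: image_eqI[of _ _ 0])

lemma principal_diff:
  assumes "a \<in> principal_divisors \<nu>" "b \<in> principal_divisors \<nu>"
  shows "(\<lambda>i. a i - b i) \<in> principal_divisors \<nu>"
proof -
  obtain m n where "a = (\<lambda>i. pairing m (\<nu> i))" "b = (\<lambda>i. pairing n (\<nu> i))"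
    using assms by (auto simp: principal_divisors_def)
  then have "(\<lambda>i. a i - b i) = (\<lambda>i. pairing (m - n) (\<nu> i))"
    by (simp add: pairing_def algebra_simps sum_subtractf)
  then show ?thesis unfolding principal_divisors_def by blast
qed

lemma principal_uminus: "a \<in> principal_divisors \<nu> \<Longrightarrow> (\<lambda>i. - a i) \<in> principal_divisors \<nu>"
  using principal_diff[OF principal_0, of a] by simp

lemma principal_add:
  "a \<in> principal_divisors \<nu> \<Longrightarrow> b \<in> principal_divisors \<nu> \<Longrightarrow> (\<lambda>i. a i + b i) \<in> principal_divisors \<nu>"
  using principal_diff[of a \<nu> "\<lambda>i. - b i"] principal_uminus[of b \<nu>] by simp

lemma div_class_eq_iff:
  "div_class \<nu> a = div_class \<nu> b \<longleftrightarrow> (\<lambda>i. a i - b i) \<in> principal_divisors \<nu>"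
proof -
  have mem: "x \<in> div_class \<nu> a \<longleftrightarrow> (\<lambda>i. x i - a i) \<in> principal_divisors \<nu>" for x a
  proof
    assume "x \<in> div_class \<nu> a"
    then show "(\<lambda>i. x i - a i) \<in> principal_divisors \<nu>"
      by (auto simp: div_class_def r_coset_def tdiv_group_def)
  next
    assume "(\<lambda>i. x i - a i) \<in> principal_divisors \<nu>"
    then show "x \<in> div_class \<nu> a"
      unfolding div_class_def r_coset_def tdiv_group_def
      by (intro UN_I[of "\<lambda>i. x i - a i"]) auto
  qed
  show ?thesis
  proof
    assume "div_class \<nu> a = div_class \<nu> b"
    then show "(\<lambda>i. a i - b i) \<in> principal_divisors \<nu>"
      using mem[of a a] mem[of a b] by simp
  next
    assume *: "(\<lambda>i. a i - b i) \<in> principal_divisors \<nu>"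
    have "(\<lambda>i. x i - a i) \<in> principal_divisors \<nu> \<longleftrightarrow> (\<lambda>i. x i - b i) \<in> principal_divisors \<nu>" for x
      using principal_add[OF _ *, of "\<lambda>i. x i - a i"] principal_diff[OF _ *, of "\<lambda>i. x i - b i"]
      by auto
    then show "div_class \<nu> a = div_class \<nu> b"
      by (auto simp: mem)
  qed
qed

lemma comm_group_tdiv_group: "comm_group tdiv_group"
proof (rule comm_groupI)
  fix x :: "'a \<Rightarrow> int"
  show "\<exists>y\<in>carrier tdiv_group. y \<otimes>\<^bsub>tdiv_group\<^esub> x = \<one>\<^bsub>tdiv_group\<^esub>"
    by (rule bexI[of _ "\<lambda>i. - x i"]) (auto simp: tdiv_group_def)
qed (auto simp: tdiv_group_def)

lemma normal_principal_divisors: "principal_divisors \<nu> \<lhd> tdiv_group"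
proof (rule comm_group.subgroup_imp_normal[OF comm_group_tdiv_group])
  show "subgroup (principal_divisors \<nu>) tdiv_group"
  proof
    fix x assume "x \<in> principal_divisors \<nu>"
    moreover have "inv\<^bsub>tdiv_group\<^esub> x = (\<lambda>i. - x i)"
      using comm_group_tdiv_group
      by (intro group.inv_equality) (auto simp: comm_group_def tdiv_group_def)
    ultimately show "inv\<^bsub>tdiv_group\<^esub> x \<in> principal_divisors \<nu>"
      by (simp add: principal_uminus)
  qed (auto simp: tdiv_group_def principal_add)
qed

lemma group_class_group: "group (class_group \<nu>)"
  unfolding class_group_def by (rule normal.factorgroup_is_group[OF normal_principal_divisors])

lemma carrier_class_group: "carrier (class_group \<nu>) = range (div_class \<nu>)"
proof -
  have "carrier tdiv_group = (UNIV :: ('a \<Rightarrow> int) set)" by (simp add: tdiv_group_def)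
  then show ?thesis
    by (simp add: class_group_def FactGroup_def RCOSETS_def UNION_singleton_eq_range div_class_def[abs_def])
qed

lemma div_class_mult:
  "div_class \<nu> a \<otimes>\<^bsub>class_group \<nu>\<^esub> div_class \<nu> b = div_class \<nu> (\<lambda>i. a i + b i)"
proof -
  have "a \<otimes>\<^bsub>tdiv_group\<^esub> b = (\<lambda>i. a i + b i)" "a \<in> carrier tdiv_group" "b \<in> carrier tdiv_group"
    by (simp_all add: tdiv_group_def)
  then show ?thesis
    using normal.rcos_sum[OF normal_principal_divisors, of a b \<nu>]
    by (simp add: class_group_def FactGroup_def div_class_def)
qed

lemma one_class_group: "\<one>\<^bsub>class_group \<nu>\<^esub> = div_class \<nu> (\<lambda>i. 0)"
  by (simp add: class_group_def FactGroup_def div_class_def tdiv_group_def r_coset_def)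

lemma class_minus_div_class:
  "class_minus \<nu> (div_class \<nu> a) (div_class \<nu> b) = div_class \<nu> (\<lambda>i. a i - b i)"
proof -
  have "inv\<^bsub>class_group \<nu>\<^esub> (div_class \<nu> b) = div_class \<nu> (\<lambda>i. - b i)"
    by (rule group.inv_equality[OF group_class_group])
      (simp_all add: div_class_mult one_class_group carrier_class_group)
  then show ?thesis by (simp add: class_minus_def div_class_mult)
qed

definition unit_div :: "'k \<Rightarrow> 'k \<Rightarrow> int" where
  "unit_div i = (\<lambda>j. if j = i then 1 else 0)"

lemma deg_var_eq: "deg_var \<nu> i = div_class \<nu> (unit_div i)"
  by (simp add: deg_var_def unit_div_def)

definition expo :: "('k \<Rightarrow>\<^sub>0 nat) \<Rightarrow> 'k \<Rightarrow> int" where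
  "expo m i = int (Poly_Mapping.lookup m i)"

abbreviation graded :: "('k \<Rightarrow> int ^ 'n) \<Rightarrow> ('k \<Rightarrow> int) \<Rightarrow> 'k cpoly set" where
  "graded \<nu> a \<equiv> graded_part \<nu> (div_class \<nu> a)"

lemma graded_part_iff: "p \<in> graded_part \<nu> C \<longleftrightarrow> (\<forall>m\<in>Poly_Mapping.keys p. div_class \<nu> (expo m) = C)"
  by (simp add: graded_part_def expo_def[abs_def])

lemma graded_part_0 [simp]: "0 \<in> graded_part \<nu> C"
  by (simp add: graded_part_iff)

lemma graded_part_add: "p \<in> graded_part \<nu> C \<Longrightarrow> q \<in> graded_part \<nu> C \<Longrightarrow> p + q \<in> graded_part \<nu> C"
  using keys_add[of p q] by (auto simp: graded_part_iff)

lemma graded_part_uminus: "p \<in> graded_part \<nu> C \<Longrightarrow> - p \<in> graded_part \<nu> C"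
  by (simp add: graded_part_iff in_keys_iff)

lemma graded_part_diff: "p \<in> graded_part \<nu> C \<Longrightarrow> q \<in> graded_part \<nu> C \<Longrightarrow> p - q \<in> graded_part \<nu> C"
  using graded_part_add[of p \<nu> C "- q"] graded_part_uminus[of q \<nu> C] by simp

lemma graded_part_sum: "(\<And>x. x \<in> A \<Longrightarrow> f x \<in> graded_part \<nu> C) \<Longrightarrow> sum f A \<in> graded_part \<nu> C"
  by (induction A rule: infinite_finite_induct) (simp_all add: graded_part_add)

lemma graded_part_cconst_mult: "p \<in> graded_part \<nu> C \<Longrightarrow> cconst c * p \<in> graded_part \<nu> C"
  by (simp add: graded_part_iff in_keys_iff lookup_cconst_mult)

lemma expo_add: "expo (m + n) = (\<lambda>i. expo m i + expo n i)"
  by (simp add: expo_def lookup_add fun_eq_iff)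

lemma graded_mult:
  assumes "p \<in> graded \<nu> a" "q \<in> graded \<nu> b"
  shows "p * q \<in> graded \<nu> (\<lambda>i. a i + b i)"
  unfolding graded_part_iff
proof
  fix k assume "k \<in> Poly_Mapping.keys (p * q)"
  then obtain m n where k: "k = m + n" "m \<in> Poly_Mapping.keys p" "n \<in> Poly_Mapping.keys q"
    using keys_mult[of p q] by auto
  then have "div_class \<nu> (expo m) = div_class \<nu> a" "div_class \<nu> (expo n) = div_class \<nu> b"
    using assms by (auto simp: graded_part_iff)
  then show "div_class \<nu> (expo k) = div_class \<nu> (\<lambda>i. a i + b i)"
    by (simp add: k(1) expo_add flip: div_class_mult)
qed

lemma graded_1: "1 \<in> graded \<nu> (\<lambda>i. 0)"
  by (simp add: graded_part_iff expo_def[abs_def])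

lemma graded_prod:
  assumes "\<And>x. x \<in> A \<Longrightarrow> f x \<in> graded \<nu> (a x)"
  shows "prod f A \<in> graded \<nu> (\<lambda>i. \<Sum>x\<in>A. a x i)"
  using assms
  by (induction A rule: infinite_finite_induct) (simp_all add: graded_1 graded_mult)

lemma graded_pdiff:
  assumes "p \<in> graded \<nu> a"
  shows "pdiff i p \<in> graded \<nu> (\<lambda>j. a j - unit_div i j)"
  unfolding pdiff_def
proof (rule graded_part_sum)
  fix m assume m: "m \<in> Poly_Mapping.keys p"
  show "Poly_Mapping.single (m - Poly_Mapping.single i 1)
      (of_nat (Poly_Mapping.lookup m i) * Poly_Mapping.lookup p m) \<in> graded \<nu> (\<lambda>j. a j - unit_div i j)"
  proof (cases "Poly_Mapping.lookup m i = 0")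
    case False
    then have "expo (m - Poly_Mapping.single i 1) = (\<lambda>j. expo m j - unit_div i j)"
      by (auto simp: expo_def lookup_minus lookup_single unit_div_def when_def fun_eq_iff)
    moreover have "div_class \<nu> (expo m) = div_class \<nu> a"
      using assms m by (simp add: graded_part_iff)
    ultimately have "div_class \<nu> (expo (m - Poly_Mapping.single i 1)) = div_class \<nu> (\<lambda>j. a j - unit_div i j)"
      by (simp flip: class_minus_div_class)
    then show ?thesis by (simp add: graded_part_iff)
  qed simp
qed

definition component :: "('k \<Rightarrow> int ^ 'n) \<Rightarrow> ('k \<Rightarrow> int) set \<Rightarrow> 'k cpoly \<Rightarrow> 'k cpoly" where
  "component \<nu> C p = (\<Sum>m\<in>{m \<in> Poly_Mapping.keys p. div_class \<nu> (expo m) = C}.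
     Poly_Mapping.single m (Poly_Mapping.lookup p m))"

lemma lookup_component:
  "Poly_Mapping.lookup (component \<nu> C p) m =
     (if div_class \<nu> (expo m) = C then Poly_Mapping.lookup p m else 0)"
  by (auto simp: component_def lookup_sum lookup_single when_def in_keys_iff)

lemma component_graded: "component \<nu> C p \<in> graded_part \<nu> C"
  by (auto simp: graded_part_iff in_keys_iff lookup_component split: if_splits)

text \<open>With torsion in the class group there is no order to compare extreme terms by. Instead
  the component of q of the expected class is subtracted: a monomial of f times the rest would force
  a monomial of that class in the rest.\<close>

lemma graded_quotient:
  fixes f q :: "'k::{finite,linorder} cpoly"
  assumes "f \<in> graded \<nu> a" "f \<noteq> 0" "f * q \<in> graded \<nu> b"
  shows "q \<in> graded \<nu> (\<lambda>i. b i - a i)"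
proof -
  define q' where "q' = component \<nu> (div_class \<nu> (\<lambda>i. b i - a i)) q"
  have "q' \<in> graded \<nu> (\<lambda>i. b i - a i)"
    unfolding q'_def by (rule component_graded)
  moreover have "f * q' \<in> graded \<nu> b"
    using graded_mult[OF assms(1) \<open>q' \<in> _\<close>] by simp
  then have r: "f * (q - q') \<in> graded \<nu> b"
    using graded_part_diff[OF assms(3)] by (simp add: algebra_simps)
  have "f * (q - q') = 0"
  proof (rule ccontr)
    assume "f * (q - q') \<noteq> 0"
    then obtain k where k: "k \<in> Poly_Mapping.keys (f * (q - q'))"
      by (metis all_not_in_conv keys_eq_empty)
    then obtain m n where mn: "k = m + n" "m \<in> Poly_Mapping.keys f" "n \<in> Poly_Mapping.keys (q - q')"
      using keys_mult[of f "q - q'"] by auto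
    have "div_class \<nu> (expo m) = div_class \<nu> a"
      using assms(1) mn(2) by (simp add: graded_part_iff)
    moreover have "div_class \<nu> (expo k) = div_class \<nu> b"
      using r k by (simp add: graded_part_iff)
    moreover have "expo n = (\<lambda>i. expo k i - expo m i)"
      by (simp add: mn(1) expo_add)
    ultimately have "div_class \<nu> (expo n) = div_class \<nu> (\<lambda>i. b i - a i)"
      by (simp flip: class_minus_div_class)
    then show False
      using mn(3) by (simp add: in_keys_iff lookup_minus q'_def lookup_component)
  qed
  with assms(2) have "q = q'" by simp
  ultimately show ?thesis by simp
qed

section \<open>Characters of the class group\<close>

definition div_subgroup :: "('k \<Rightarrow> int) set \<Rightarrow> bool" where
  "div_subgroup H \<longleftrightarrow> (\<lambda>i. 0) \<in> H \<and> (\<forall>a\<in>H. \<forall>b\<in>H. (\<lambda>i. a i - b i) \<in> H)"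

lemma div_subgroupD:
  assumes "div_subgroup H"
  shows "(\<lambda>i. 0) \<in> H" "a \<in> H \<Longrightarrow> b \<in> H \<Longrightarrow> (\<lambda>i. a i - b i) \<in> H"
    "a \<in> H \<Longrightarrow> (\<lambda>i. - a i) \<in> H" "a \<in> H \<Longrightarrow> b \<in> H \<Longrightarrow> (\<lambda>i. a i + b i) \<in> H"
proof -
  show 0: "(\<lambda>i. 0) \<in> H" and d: "a \<in> H \<Longrightarrow> b \<in> H \<Longrightarrow> (\<lambda>i. a i - b i) \<in> H" for a b
    using assms by (auto simp: div_subgroup_def)
  show m: "a \<in> H \<Longrightarrow> (\<lambda>i. - a i) \<in> H" for a
    using d[OF 0, of a] by simp
  show "a \<in> H \<Longrightarrow> b \<in> H \<Longrightarrow> (\<lambda>i. a i + b i) \<in> H"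
    using d[OF _ m, of a b] by simp
qed

lemma div_subgroup_scale:
  assumes "div_subgroup H" "a \<in> H"
  shows "(\<lambda>i. (n::int) * a i) \<in> H"
proof -
  have nat: "(\<lambda>i. int m * a i) \<in> H" for m
  proof (induction m)
    case (Suc m)
    then show ?case
      using div_subgroupD(4)[OF assms(1) Suc assms(2)] by (simp add: algebra_simps)
  qed (use div_subgroupD(1)[OF assms(1)] in simp)
  show ?thesis
  proof (cases "n \<ge> 0")
    case True
    then show ?thesis using nat[of "nat n"] by simp
  next
    case False
    then show ?thesis using div_subgroupD(3)[OF assms(1) nat[of "nat (- n)"]] by simp
  qed
qed

lemma div_subgroup_UNIV:
  assumes "div_subgroup H" "\<And>i::'k::finite. unit_div i \<in> H"
  shows "H = UNIV"
proof -
  have "(\<lambda>j. if j \<in> A then a j else 0) \<in> H" if "finite A" for a :: "'k \<Rightarrow> int" and A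
    using that
  proof (induction A rule: finite_induct)
    case (insert i A)
    have "(\<lambda>j. (\<lambda>j. if j \<in> A then a j else 0) j + (\<lambda>j. a i * unit_div i j) j) \<in> H"
      by (intro div_subgroupD(4)[OF assms(1)] insert.IH div_subgroup_scale assms)
    moreover have "(\<lambda>j. (\<lambda>j. if j \<in> A then a j else 0) j + (\<lambda>j. a i * unit_div i j) j) =
        (\<lambda>j. if j \<in> insert i A then a j else 0)"
      using insert.hyps(2) by (auto simp: unit_div_def fun_eq_iff)
    ultimately show ?case by simp
  qed (use div_subgroupD(1)[OF assms(1)] in simp)
  from this[of UNIV] show ?thesis by auto
qed

definition div_char :: "('k \<Rightarrow> int) set \<Rightarrow> (('k \<Rightarrow> int) \<Rightarrow> complex) \<Rightarrow> bool" where
  "div_char H \<theta> \<longleftrightarrow> div_subgroup H \<and> (\<forall>a\<in>H. \<theta> a \<noteq> 0) \<and>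
     (\<forall>a\<in>H. \<forall>b\<in>H. \<theta> (\<lambda>i. a i + b i) = \<theta> a * \<theta> b)"

lemma div_charD:
  assumes "div_char H \<theta>"
  shows "div_subgroup H" "a \<in> H \<Longrightarrow> \<theta> a \<noteq> 0"
    "a \<in> H \<Longrightarrow> b \<in> H \<Longrightarrow> \<theta> (\<lambda>i. a i + b i) = \<theta> a * \<theta> b" "\<theta> (\<lambda>i. 0) = 1"
proof -
  show *: "div_subgroup H" "a \<in> H \<Longrightarrow> \<theta> a \<noteq> 0"
    "a \<in> H \<Longrightarrow> b \<in> H \<Longrightarrow> \<theta> (\<lambda>i. a i + b i) = \<theta> a * \<theta> b" for a b
    using assms by (auto simp: div_char_def)
  show "\<theta> (\<lambda>i. 0) = 1"
    using *(2)[OF div_subgroupD(1)] *(3)[of "\<lambda>i. 0" "\<lambda>i. 0"] div_subgroupD(1)[OF *(1)] *(1) by simp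
qed

lemma div_char_scale:
  assumes "div_char H \<theta>" "a \<in> H"
  shows "\<theta> (\<lambda>i. n * a i) = \<theta> a powi n"
proof -
  note D = div_charD[OF assms(1)] and S = div_subgroup_scale[OF div_charD(1)[OF assms(1)] assms(2)]
  have nat: "\<theta> (\<lambda>i. int m * a i) = \<theta> a ^ m" for m
  proof (induction m)
    case (Suc m)
    have "\<theta> (\<lambda>i. (\<lambda>i. int m * a i) i + a i) = \<theta> (\<lambda>i. int m * a i) * \<theta> a"
      using D(3) S assms(2) by blast
    with Suc show ?case by (simp add: algebra_simps)
  qed (simp add: D(4))
  show ?thesis
  proof (cases "n \<ge> 0")
    case True
    then show ?thesis using nat[of "nat n"] by (simp add: power_int_def)
  next
    case False
    have "(\<lambda>i. (\<lambda>i. n * a i) i + (\<lambda>i. int (nat (- n)) * a i) i) = (\<lambda>i. 0)"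
      using False by (simp add: fun_eq_iff)
    moreover have "\<theta> (\<lambda>i. (\<lambda>i. n * a i) i + (\<lambda>i. int (nat (- n)) * a i) i) =
        \<theta> (\<lambda>i. n * a i) * \<theta> (\<lambda>i. int (nat (- n)) * a i)"
      using D(3) S by blast
    ultimately have "1 = \<theta> (\<lambda>i. n * a i) * \<theta> a ^ nat (- n)"
      by (simp only: nat D(4))
    then have "inverse (\<theta> a ^ nat (- n)) = \<theta> (\<lambda>i. n * a i)"
      by (intro inverse_unique) (simp add: mult.commute)
    then show ?thesis
      using False by (simp add: power_int_def power_inverse)
  qed
qed

lemma div_char_prod:
  assumes "div_char UNIV \<theta>"
  shows "\<theta> (a :: 'k::finite \<Rightarrow> int) = (\<Prod>i\<in>UNIV. \<theta> (unit_div i) powi a i)"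
proof -
  have "\<theta> (\<lambda>j. if j \<in> A then a j else 0) = (\<Prod>i\<in>A. \<theta> (unit_div i) powi a i)" if "finite A" for A
    using that
  proof (induction A rule: finite_induct)
    case (insert i A)
    have "(\<lambda>j. if j \<in> insert i A then a j else 0) =
        (\<lambda>j. (\<lambda>j. a i * unit_div i j) j + (\<lambda>j. if j \<in> A then a j else 0) j)"
      using insert.hyps(2) by (auto simp: unit_div_def fun_eq_iff)
    then have "\<theta> (\<lambda>j. if j \<in> insert i A then a j else 0) =
        \<theta> (\<lambda>j. a i * unit_div i j) * \<theta> (\<lambda>j. if j \<in> A then a j else 0)"
      using div_charD(3)[OF assms] by (simp del: insert_iff)
    then show ?case
      using insert div_char_scale[OF assms] by simp
  qed (simp add: div_charD(4)[OF assms])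
  from this[of UNIV] show ?thesis by simp
qed

text \<open>The generator 0 stands for the trivial subgroup; it occurs below for an element of
  infinite order modulo H.\<close>

lemma int_subgroup_generator:
  fixes P :: "int \<Rightarrow> bool"
  assumes "P 0" "\<And>m n. P m \<Longrightarrow> P n \<Longrightarrow> P (m - n)"
  shows "\<exists>n0::nat. \<forall>n. P n \<longleftrightarrow> int n0 dvd n"
proof -
  have neg: "P (- n)" if "P n" for n using assms(2)[OF assms(1) that] by simp
  have add: "P (m + n)" if "P m" "P n" for m n using assms(2)[OF that(1) neg[OF that(2)]] by simp
  have mult: "P (int k * n)" if "P n" for k n
  proof (induction k)
    case (Suc k)
    from add[OF that Suc] show ?case by (simp add: algebra_simps)
  qed (simp add: assms(1))
  have mult': "P (k * n)" if "P n" for k n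
  proof (cases "k \<ge> 0")
    case True
    with mult[OF that, of "nat k"] show ?thesis by simp
  next
    case False
    with neg[OF mult[OF that, of "nat (- k)"]] show ?thesis by simp
  qed
  show ?thesis
  proof (cases "\<exists>n>0. P n")
    case True
    then obtain n where n: "n > 0" "P n" by blast
    define n0 where "n0 = (LEAST m. m > 0 \<and> P (int m))"
    have ex: "nat n > 0 \<and> P (int (nat n))" using n by simp
    have n0: "n0 > 0" "P (int n0)"
      using LeastI[of "\<lambda>m. m > 0 \<and> P (int m)", OF ex] by (auto simp: n0_def)
    have "int n0 dvd k" if "P k" for k
    proof -
      have "P (k - (k div int n0) * int n0)"
        by (intro assms(2) that mult' n0)
      then have "P (k mod int n0)" by (simp add: minus_div_mult_eq_mod)
      moreover have "k mod int n0 < int n0" "k mod int n0 \<ge> 0" using n0(1) by simp_all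
      ultimately have "\<not> (0 < nat (k mod int n0))"
        using not_less_Least[of "nat (k mod int n0)" "\<lambda>m. m > 0 \<and> P (int m)"]
        by (auto simp: n0_def[symmetric] nat_less_iff)
      with \<open>k mod int n0 \<ge> 0\<close> show ?thesis by (simp add: dvd_eq_mod_eq_0)
    qed
    moreover have "P k" if "int n0 dvd k" for k
      using that mult'[OF n0(2)] by (auto simp: dvd_def mult.commute)
    ultimately show ?thesis by blast
  next
    case False
    then have "P n \<longleftrightarrow> n = 0" for n
      using neg[of n] assms(1) by (metis linorder_neqE neg_0_less_iff_less)
    then show ?thesis by (intro exI[of _ 0]) simp
  qed
qed

text \<open>If the root at hand is 1, then c = 1, and a primitive n-th root of unity is another
  root.\<close>

lemma nontrivial_complex_root:
  assumes "n \<noteq> 0" "n \<noteq> 1"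
  shows "\<exists>w::complex. w ^ n = c \<and> w \<noteq> 1"
proof -
  obtain w where w: "w ^ n = c"
    using exists_complex_root[OF assms(1), of c] by metis
  define u where "u = exp (2 * of_real pi * \<i> * of_nat 1 / of_nat n :: complex)"
  have "u ^ n = 1"
    unfolding u_def by (rule complex_root_unity[OF assms(1)])
  moreover have "u \<noteq> 1"
    using complex_root_unity_eq_1[of n 1] assms unfolding u_def by auto
  ultimately show ?thesis
    using w by (cases "w = 1") (auto intro: exI[of _ u] exI[of _ w])
qed

text \<open>Nonzero complex numbers have roots: if \<open>n0\<close> generates the integers n with n
  x in H, the value at x may be any \<open>n0\<close>-th root of the value at n0 x. For x outside H,
  \<open>n0\<close> is not 1, which leaves room for a root other than 1.\<close>

lemma div_char_extend:
  assumes \<theta>: "div_char H \<theta>"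
  shows "\<exists>H' \<theta>'. div_char H' \<theta>' \<and> H \<subseteq> H' \<and> x \<in> H' \<and> (\<forall>a\<in>H. \<theta>' a = \<theta> a) \<and> (x \<notin> H \<longrightarrow> \<theta>' x \<noteq> 1)"
proof -
  note D = div_charD[OF \<theta>] and S = div_subgroupD[OF div_charD(1)[OF \<theta>]]
  define P where "P n \<longleftrightarrow> (\<lambda>i. n * x i) \<in> H" for n
  have "\<exists>n0::nat. \<forall>n. P n \<longleftrightarrow> int n0 dvd n"
  proof (rule int_subgroup_generator)
    show "P 0" using S(1) by (simp add: P_def)
    show "P m \<Longrightarrow> P n \<Longrightarrow> P (m - n)" for m n
      using S(2)[of "\<lambda>i. m * x i" "\<lambda>i. n * x i"] by (simp add: P_def algebra_simps)
  qed
  then obtain n0 :: nat where n0: "\<And>n. P n \<longleftrightarrow> int n0 dvd n" by blast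
  have n0H: "(\<lambda>i. int n0 * x i) \<in> H" using n0[of n0] by (simp add: P_def)
  have xH: "x \<in> H \<longleftrightarrow> n0 = 1"
    using n0[of 1] by (simp add: P_def)
  obtain w where w: "w \<noteq> 0" "w ^ n0 = \<theta> (\<lambda>i. int n0 * x i)" "n0 \<noteq> 1 \<longrightarrow> w \<noteq> 1"
  proof (cases "n0 = 0")
    case True
    \<comment> \<open>No nonzero multiple of x lies in H, so every nonzero value is allowed; 2
      merely differs from 1.\<close>
    then show ?thesis using that[of 2] D(4) by simp
  next
    case False
    obtain u where u: "u ^ n0 = \<theta> (\<lambda>i. int n0 * x i)" "n0 \<noteq> 1 \<longrightarrow> u \<noteq> 1"
    proof (cases "n0 = 1")
      case True
      then show ?thesis using that[of "\<theta> (\<lambda>i. int n0 * x i)"] by simp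
    next
      case n1: False
      then show ?thesis using nontrivial_complex_root[OF False n1] that by blast
    qed
    moreover have "u \<noteq> 0" using u(1) False D(2)[OF n0H] by (auto simp: power_0_left)
    ultimately show ?thesis using that by blast
  qed
  have \<theta>w: "\<theta> (\<lambda>i. n * x i) = w powi n" if "P n" for n
  proof -
    have "int n0 dvd n" using that n0 by simp
    then obtain k where k: "n = int n0 * k" by (elim dvdE)
    have "\<theta> (\<lambda>i. k * (\<lambda>i. int n0 * x i) i) = \<theta> (\<lambda>i. int n0 * x i) powi k"
      by (rule div_char_scale[OF \<theta> n0H])
    also have "\<dots> = w powi n" by (simp add: k w(2)[symmetric] power_int_mult)
    finally show ?thesis by (simp add: k mult_ac)
  qed
  define H' where "H' = {(\<lambda>i. h i + n * x i) |h n. h \<in> H}"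
  define R where "R a p \<longleftrightarrow> fst p \<in> H \<and> a = (\<lambda>i. fst p i + snd p * x i)" for a and p :: "('a \<Rightarrow> int) \<times> int"
  \<comment> \<open>Defined through a chosen decomposition a = h + n x. Two decompositions differ by
    a multiple of x lying in H, where \<open>\<theta>w\<close> makes the values agree.\<close>
  define \<theta>' where "\<theta>' a = (let p = (SOME p. R a p) in \<theta> (fst p) * w powi snd p)" for a
  have \<theta>': "\<theta>' (\<lambda>i. h i + n * x i) = \<theta> h * w powi n" if h: "h \<in> H" for h n
  proof -
    define p where "p = (SOME p. R (\<lambda>i. h i + n * x i) p)"
    have "R (\<lambda>i. h i + n * x i) p"
      unfolding p_def by (rule someI[of _ "(h, n)"]) (simp add: R_def h)
    then have p: "fst p \<in> H" "\<And>i. h i + n * x i = fst p i + snd p * x i"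
      by (auto simp: R_def fun_eq_iff)
    have eq: "(\<lambda>i. fst p i - h i) = (\<lambda>i. (n - snd p) * x i)"
      using p(2) by (auto simp: fun_eq_iff algebra_simps)
    then have P: "P (n - snd p)"
      unfolding P_def using S(2)[OF p(1) h] by simp
    have "\<theta> (fst p) = \<theta> (\<lambda>i. h i + (\<lambda>i. (n - snd p) * x i) i)"
    proof -
      have "(n - snd p) * x i = fst p i - h i" for i
        using fun_cong[OF eq, of i] by simp
      then show ?thesis by simp
    qed
    also have "\<dots> = \<theta> h * w powi (n - snd p)"
      using D(3)[OF h, of "\<lambda>i. (n - snd p) * x i"] P \<theta>w[OF P] by (simp add: P_def)
    finally have "\<theta> (fst p) * w powi snd p = \<theta> h * (w powi (n - snd p) * w powi snd p)"
      by simp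
    also have "\<dots> = \<theta> h * w powi n"
      using w(1) power_int_add[of w "n - snd p" "snd p"] by simp
    finally show ?thesis by (simp add: \<theta>'_def p_def)
  qed
  have "div_char H' \<theta>'"
    unfolding div_char_def
  proof (intro conjI ballI)
    show "div_subgroup H'"
      unfolding div_subgroup_def
    proof (intro conjI ballI)
      show "(\<lambda>i. 0) \<in> H'" 
        unfolding H'_def mem_Collect_eq using S(1) by (intro exI[of _ "\<lambda>i. 0"] exI[of _ 0]) simp
      fix a b assume "a \<in> H'" "b \<in> H'"
      then obtain h m g n where ab: "h \<in> H" "g \<in> H" "a = (\<lambda>i. h i + m * x i)" "b = (\<lambda>i. g i + n * x i)"
        unfolding H'_def by blast
      then show "(\<lambda>i. a i - b i) \<in> H'"
        unfolding H'_def using S(2)[OF ab(1,2)]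
        by (intro CollectI exI[of _ "\<lambda>i. h i - g i"] exI[of _ "m - n"]) (simp add: algebra_simps)
    qed
    show "\<theta>' a \<noteq> 0" if "a \<in> H'" for a
      using that D(2) w(1) by (auto simp: H'_def \<theta>')
    fix a b assume "a \<in> H'" "b \<in> H'"
    then obtain h m g n where ab: "h \<in> H" "g \<in> H" "a = (\<lambda>i. h i + m * x i)" "b = (\<lambda>i. g i + n * x i)"
      unfolding H'_def by blast
    have "(\<lambda>i. a i + b i) = (\<lambda>i. (\<lambda>i. h i + g i) i + (m + n) * x i)"
      by (simp add: ab algebra_simps)
    then have "\<theta>' (\<lambda>i. a i + b i) = \<theta> (\<lambda>i. h i + g i) * w powi (m + n)"
      using \<theta>'[OF S(4)[OF ab(1,2)]] by simp
    then show "\<theta>' (\<lambda>i. a i + b i) = \<theta>' a * \<theta>' b"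
      using ab w(1) by (simp add: \<theta>' D(3) power_int_add)
  qed
  moreover have "H \<subseteq> H'"
  proof
    fix a assume "a \<in> H"
    then show "a \<in> H'"
      unfolding H'_def by (intro CollectI exI[of _ a] exI[of _ 0]) simp
  qed
  moreover have "x \<in> H'"
    unfolding H'_def using S(1) by (intro CollectI exI[of _ "\<lambda>i. 0"] exI[of _ 1]) simp
  moreover have "\<forall>a\<in>H. \<theta>' a = \<theta> a"
    using \<theta>'[of _ 0] by simp
  moreover have "\<theta>' x = w"
    using \<theta>'[OF S(1), of 1] D(4) by simp
  ultimately show ?thesis using w(3) xH by blast
qed

text \<open>The group G in coordinates: a homomorphism from the class group is recorded by its
  values at the classes of the D_i, and \<open>tchar\<close> recovers it on all divisors.\<close>

definition torus :: "('k::finite \<Rightarrow> int ^ 'n) \<Rightarrow> (complex ^ 'k) set" where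
  "torus \<nu> = {t. (\<forall>i. t $ i \<noteq> 0) \<and> (\<forall>a\<in>principal_divisors \<nu>. (\<Prod>i\<in>UNIV. (t $ i) powi a i) = 1)}"

definition tchar :: "complex ^ 'k::finite \<Rightarrow> ('k \<Rightarrow> int) \<Rightarrow> complex" where
  "tchar t a = (\<Prod>i\<in>UNIV. (t $ i) powi a i)"

definition tact :: "complex ^ 'k::finite \<Rightarrow> complex ^ 'k \<Rightarrow> complex ^ 'k" where
  "tact t z = (\<chi> i. t $ i * z $ i)"

lemma torus_nonzero: "t \<in> torus \<nu> \<Longrightarrow> t $ i \<noteq> 0"
  by (simp add: torus_def)

lemma tchar_principal: "t \<in> torus \<nu> \<Longrightarrow> a \<in> principal_divisors \<nu> \<Longrightarrow> tchar t a = 1"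
  by (simp add: torus_def tchar_def)

lemma tchar_nonzero: "t \<in> torus \<nu> \<Longrightarrow> tchar t a \<noteq> 0"
  by (simp add: tchar_def torus_def)

lemma tchar_add: "t \<in> torus \<nu> \<Longrightarrow> tchar t (\<lambda>i. a i + b i) = tchar t a * tchar t b"
  by (simp add: tchar_def torus_def power_int_add prod.distrib)

lemma tchar_unit: "tchar t (unit_div i) = t $ i"
proof -
  have "(\<Prod>j\<in>UNIV. (t $ j) powi unit_div i j) = (\<Prod>j\<in>UNIV. if j = i then t $ i else 1)"
    by (intro prod.cong) (auto simp: unit_div_def)
  then show ?thesis by (simp add: tchar_def)
qed

lemma tchar_class: "t \<in> torus \<nu> \<Longrightarrow> div_class \<nu> a = div_class \<nu> b \<Longrightarrow> tchar t a = tchar t b"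
  using tchar_add[of t \<nu> "\<lambda>i. a i - b i" b] tchar_principal[of t \<nu> "\<lambda>i. a i - b i"]
  by (simp add: div_class_eq_iff)

lemma torus_mult: "s \<in> torus \<nu> \<Longrightarrow> t \<in> torus \<nu> \<Longrightarrow> tact s t \<in> torus \<nu>"
  by (simp add: torus_def tact_def power_int_mult_distrib prod.distrib)

lemma torus_inverse: "t \<in> torus \<nu> \<Longrightarrow> (\<chi> i. inverse (t $ i)) \<in> torus \<nu>"
  by (simp add: torus_def power_int_inverse prod_inversef[unfolded comp_def])

lemma torus_1: "(\<chi> i. 1) \<in> torus \<nu>"
  by (simp add: torus_def)

lemma tact_tact: "tact s (tact t z) = tact (tact s t) z"
  by (simp add: tact_def vec_eq_iff)

lemma tact_inverse: "t \<in> torus \<nu> \<Longrightarrow> tact (\<chi> i. inverse (t $ i)) (tact t z) = z"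
  by (simp add: tact_def vec_eq_iff torus_nonzero)

lemma div_char_UNIV_torus:
  assumes "div_char UNIV \<theta>" "\<And>a. a \<in> principal_divisors \<nu> \<Longrightarrow> \<theta> a = 1"
  shows "(\<chi> i. \<theta> (unit_div i)) \<in> torus \<nu>" "tchar (\<chi> i. \<theta> (unit_div i)) a = \<theta> a"
  using assms div_charD(2)[OF assms(1)] div_char_prod[OF assms(1), symmetric]
  by (simp_all add: torus_def tchar_def)

text \<open>Start with the trivial character on principal divisors, give x = a - b a value other
  than 1, then extend to the finitely many unit divisors, which generate all divisors.\<close>

lemma torus_separates:
  fixes \<nu> :: "'k::finite \<Rightarrow> int ^ 'n"
  assumes "div_class \<nu> a \<noteq> div_class \<nu> b"
  shows "\<exists>t\<in>torus \<nu>. tchar t a \<noteq> tchar t b"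
proof -
  define x where "x = (\<lambda>i. a i - b i)"
  define L where "L = principal_divisors \<nu>"
  have x: "x \<notin> L" using assms by (simp add: x_def L_def div_class_eq_iff)
  have "div_char L (\<lambda>a. 1)"
    by (simp add: L_def div_char_def div_subgroup_def principal_diff)
  then obtain H1 \<theta>1 where 1: "div_char H1 \<theta>1" "L \<subseteq> H1" "x \<in> H1" "\<forall>a\<in>L. \<theta>1 a = 1" "\<theta>1 x \<noteq> 1"
    using div_char_extend[of L "\<lambda>a. 1" x] x by blast
  have steps: "\<exists>H \<theta>. div_char H \<theta> \<and> L \<subseteq> H \<and> x \<in> H \<and> (\<forall>a\<in>L. \<theta> a = 1) \<and> \<theta> x \<noteq> 1 \<and>
      (\<forall>i\<in>A. unit_div i \<in> H)" if "finite A" for A :: "'k set"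
    using that
  proof (induction A rule: finite_induct)
    case (insert i A)
    then obtain H \<theta> where IH: "div_char H \<theta>" "L \<subseteq> H" "x \<in> H" "\<forall>a\<in>L. \<theta> a = 1" "\<theta> x \<noteq> 1"
      "\<forall>i\<in>A. unit_div i \<in> H" by blast
    obtain H' \<theta>' where "div_char H' \<theta>'" "H \<subseteq> H'" "unit_div i \<in> H'" "\<forall>a\<in>H. \<theta>' a = \<theta> a"
      using div_char_extend[OF IH(1), of "unit_div i"] by blast
    with IH show ?case
      by (intro exI[of _ H'] exI[of _ \<theta>']) auto
  qed (use 1 in blast)
  obtain H \<theta> where H: "div_char H \<theta>" "\<forall>a\<in>L. \<theta> a = 1" "\<theta> x \<noteq> 1"
      "\<forall>i\<in>UNIV. unit_div i \<in> H"
    using steps[OF finite[of UNIV]] by blast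
  have "H = UNIV" using div_subgroup_UNIV div_charD(1) H(1,4) by blast
  with H have c: "div_char UNIV \<theta>" "\<And>a. a \<in> principal_divisors \<nu> \<Longrightarrow> \<theta> a = 1"
    by (auto simp: L_def)
  define t where "t = (\<chi> i. \<theta> (unit_div i))"
  have t: "t \<in> torus \<nu>" "\<And>a. tchar t a = \<theta> a"
    using div_char_UNIV_torus[OF c] by (auto simp: t_def)
  have "tchar t a = tchar t x * tchar t b"
    using tchar_add[OF t(1), of x b] by (simp add: x_def)
  with H(3) t show ?thesis
    using tchar_nonzero[OF t(1), of b] by (intro bexI[of _ t]) auto
qed

text \<open>A homomorphism from the class group is a character of the divisors trivial on principal
  ones, and such a character is determined by its values at the D_i.\<close>

lemma orbit_eq: "orbit \<nu> z = (\<lambda>t. tact t z) ` torus \<nu>"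
proof
  show "orbit \<nu> z \<subseteq> (\<lambda>t. tact t z) ` torus \<nu>"
  proof
    fix y assume "y \<in> orbit \<nu> z"
    then obtain g where g: "g \<in> hom (class_group \<nu>) complex_units" "y = (\<chi> i. g (deg_var \<nu> i) * z $ i)"
      by (auto simp: orbit_def)
    define \<theta> where "\<theta> a = g (div_class \<nu> a)" for a
    have "\<theta> a \<noteq> 0" for a
      using hom_carrier[OF g(1)] by (auto simp: \<theta>_def carrier_class_group complex_units_def)
    moreover have mult: "\<theta> (\<lambda>i. a i + b i) = \<theta> a * \<theta> b" for a b
      using hom_mult[OF g(1), of "div_class \<nu> a" "div_class \<nu> b"]
      by (simp add: \<theta>_def carrier_class_group div_class_mult complex_units_def)
    ultimately have c: "div_char UNIV \<theta>"
      by (simp add: div_char_def div_subgroup_def)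
    have "\<theta> a = 1" if "a \<in> principal_divisors \<nu>" for a
    proof -
      have "div_class \<nu> a = div_class \<nu> (\<lambda>i. 0)" using that by (simp add: div_class_eq_iff)
      then show ?thesis using div_charD(4)[OF c] by (simp add: \<theta>_def)
    qed
    from div_char_UNIV_torus(1)[OF c this] show "y \<in> (\<lambda>t. tact t z) ` torus \<nu>"
      by (intro image_eqI[of _ _ "\<chi> i. \<theta> (unit_div i)"]) (auto simp: g(2) tact_def \<theta>_def deg_var_eq)
  qed
  show "(\<lambda>t. tact t z) ` torus \<nu> \<subseteq> orbit \<nu> z"
  proof
    fix y assume "y \<in> (\<lambda>t. tact t z) ` torus \<nu>"
    then obtain t where t: "t \<in> torus \<nu>" "y = tact t z" by blast
    define g where "g C = tchar t (SOME a. div_class \<nu> a = C)" for C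
    have g: "g (div_class \<nu> a) = tchar t a" for a
      unfolding g_def by (rule tchar_class[OF t(1)]) (rule someI[of _ a], simp)
    have "g \<in> hom (class_group \<nu>) complex_units"
      using tchar_nonzero[OF t(1)] tchar_add[OF t(1)]
      by (auto simp: hom_def carrier_class_group complex_units_def div_class_mult g)
    moreover have "y = (\<chi> i. g (deg_var \<nu> i) * z $ i)"
      by (simp add: t(2) tact_def deg_var_eq g tchar_unit)
    ultimately show "y \<in> orbit \<nu> z" unfolding orbit_def by blast
  qed
qed

lemma orbit_self: "z \<in> orbit \<nu> z"
  unfolding orbit_eq by (rule image_eqI[OF _ torus_1]) (simp add: tact_def)

lemma orbit_tact: "t \<in> torus \<nu> \<Longrightarrow> orbit \<nu> (tact t z) = orbit \<nu> z"
proof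
  assume t: "t \<in> torus \<nu>"
  show "orbit \<nu> (tact t z) \<subseteq> orbit \<nu> z"
    unfolding orbit_eq using t torus_mult by (force simp: tact_tact)
  show "orbit \<nu> z \<subseteq> orbit \<nu> (tact t z)"
    unfolding orbit_eq
  proof
    fix y assume "y \<in> (\<lambda>t. tact t z) ` torus \<nu>"
    then obtain s where s: "s \<in> torus \<nu>" "y = tact s z" by blast
    have "y = tact (tact s (\<chi> i. inverse (t $ i))) (tact t z)"
      using tact_inverse[OF t, of z] by (simp add: s(2) flip: tact_tact)
    then show "y \<in> (\<lambda>s. tact s (tact t z)) ` torus \<nu>"
      using torus_mult[OF s(1) torus_inverse[OF t]] by blast
  qed
qed

lemma orbit_eqD: "orbit \<nu> y = orbit \<nu> z \<Longrightarrow> \<exists>t\<in>torus \<nu>. y = tact t z"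
  using orbit_self[of y \<nu>] unfolding orbit_eq[of \<nu> z] by blast

lemma tact_irrelevant:
  "t \<in> torus \<nu> \<Longrightarrow> tact t z \<in> irrelevant_locus \<Delta> \<nu> \<longleftrightarrow> z \<in> irrelevant_locus \<Delta> \<nu>"
  by (simp add: irrelevant_locus_def tact_def torus_nonzero)

lemma tchar_expo: "tchar t (expo m) = (\<Prod>i\<in>UNIV. (t $ i) ^ Poly_Mapping.lookup m i)"
  by (simp add: tchar_def expo_def)

lemma eval_poly_tact:
  "eval_poly p (tact t z) = (\<Sum>m\<in>Poly_Mapping.keys p.
     Poly_Mapping.lookup p m * (tchar t (expo m) * (\<Prod>i\<in>UNIV. (z $ i) ^ Poly_Mapping.lookup m i)))"
  by (simp add: eval_poly_def tact_def power_mult_distrib prod.distrib tchar_expo)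

lemma eval_graded_tact:
  assumes "p \<in> graded \<nu> a" "t \<in> torus \<nu>"
  shows "eval_poly p (tact t z) = tchar t a * eval_poly p z"
proof -
  have "tchar t (expo m) = tchar t a" if "m \<in> Poly_Mapping.keys p" for m
    by (rule tchar_class[OF assms(2)]) (use assms(1) that in \<open>simp add: graded_part_iff\<close>)
  then show ?thesis
    unfolding eval_poly_tact by (simp add: eval_poly_def sum_distrib_left mult_ac)
qed

lemma graded_zero_orbit:
  assumes "p \<in> graded \<nu> a" "orbit \<nu> y = orbit \<nu> z" "eval_poly p z = 0"
  shows "eval_poly p y = 0"
proof -
  obtain t where t: "t \<in> torus \<nu>" "y = tact t z"
    using orbit_eqD[OF assms(2)] by blast
  show ?thesis
    using eval_graded_tact[OF assms(1) t(1), of z] assms(3) t(2) by simp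
qed

lemma eval_poly_eq_sum_component:
  "eval_poly p z = (\<Sum>C\<in>(\<lambda>m. div_class \<nu> (expo m)) ` Poly_Mapping.keys p. eval_poly (component \<nu> C p) z)"
proof -
  have "p = (\<Sum>C\<in>(\<lambda>m. div_class \<nu> (expo m)) ` Poly_Mapping.keys p. component \<nu> C p)"
    unfolding component_def
    by (rule trans[OF cpoly_eq_sum_single], rule sum.image_gen[where g = "\<lambda>m. div_class \<nu> (expo m)"]) simp
  from arg_cong[OF this, of "\<lambda>q. eval_poly q z"] show ?thesis by simp
qed

text \<open>On the orbit of z the components of p are multiplied by the characters of their classes,
  which are pairwise distinct; their independence makes each component vanish separately.\<close>

lemma component_vanishes:
  fixes \<nu> :: "'k::finite \<Rightarrow> int ^ 'n"
  assumes "\<And>t. t \<in> torus \<nu> \<Longrightarrow> eval_poly p (tact t z) = 0"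
  shows "eval_poly (component \<nu> C p) z = 0"
proof -
  define S where "S = (\<lambda>m. div_class \<nu> (expo m)) ` Poly_Mapping.keys p"
  define r where "r C = (SOME a. div_class \<nu> a = C)" for C
  have rep: "div_class \<nu> (r C) = C" if "C \<in> S" for C
  proof -
    obtain m where "div_class \<nu> (expo m) = C" using \<open>C \<in> S\<close> unfolding S_def by blast
    then show ?thesis unfolding r_def by (rule someI[of "\<lambda>a. div_class \<nu> a = C"])
  qed
  have comp: "eval_poly (component \<nu> C p) (tact t z) = tchar t (r C) * eval_poly (component \<nu> C p) z"
    if "C \<in> S" "t \<in> torus \<nu>" for C t
    using eval_graded_tact[of "component \<nu> C p" \<nu> "r C"] component_graded[of \<nu> C p] that rep
    by simp
  have sum: "eval_poly p y = (\<Sum>C\<in>S. eval_poly (component \<nu> C p) y)" for y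
    unfolding S_def by (rule eval_poly_eq_sum_component)
  show ?thesis
  proof (cases "C \<in> S")
    case True
    show ?thesis
    proof (rule dedekind_independence[where S = S and T = "torus \<nu>" and mul = tact and e = "\<chi> i. 1"
          and \<phi> = "\<lambda>C t. tchar t (r C)"])
      show "finite S" by (simp add: S_def)
      show "tchar (tact g h) (r s) = tchar g (r s) * tchar h (r s)" for g h s
        by (simp add: tchar_def tact_def power_int_mult_distrib prod.distrib)
      show "\<exists>g\<in>torus \<nu>. tchar g (r s) \<noteq> tchar g (r s')" if "s \<in> S" "s' \<in> S" "s \<noteq> s'" for s s'
        using torus_separates[of \<nu> "r s" "r s'"] that rep by simp
      show "(\<Sum>s\<in>S. eval_poly (component \<nu> s p) z * tchar g (r s)) = 0" if "g \<in> torus \<nu>" for g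
        using assms[OF that] comp that by (simp add: sum mult.commute)
    qed (use True torus_mult torus_1 in \<open>auto simp: tchar_def\<close>)
  next
    case False
    then have "component \<nu> C p = 0"
      by (intro poly_mapping_eqI) (auto simp: lookup_component S_def in_keys_iff)
    then show ?thesis by simp
  qed
qed

section \<open>Homogeneous greatest common divisors\<close>

interpretation cconst_hom: const_hom cconst
  by unfold_locales simp_all

definition tscale :: "complex ^ 'k::finite \<Rightarrow> 'k cpoly \<Rightarrow> 'k cpoly" where
  "tscale t p = psubst cconst (\<lambda>i. cconst (t $ i) * cvar i) p"

lemma tscale_mult: "tscale t (p * q) = tscale t p * tscale t q"
  by (simp add: tscale_def cconst_hom.psubst_mult)

lemma eval_tscale: "eval_poly (tscale t p) z = eval_poly p (tact t z)"
  by (induction p rule: cpoly_algebra_induct)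
    (simp_all add: tscale_def cconst_hom.psubst_add cconst_hom.psubst_mult tact_def)

lemma lookup_tscale: "Poly_Mapping.lookup (tscale t p) m = tchar t (expo m) * Poly_Mapping.lookup p m"
proof -
  define q where "q = (\<Sum>m\<in>Poly_Mapping.keys p. Poly_Mapping.single m (tchar t (expo m) * Poly_Mapping.lookup p m))"
  have "tscale t p = q"
    by (rule eval_poly_eqI) (simp add: eval_tscale q_def eval_poly_single eval_poly_tact mult_ac)
  then show ?thesis
    by (simp add: q_def lookup_sum lookup_single when_def in_keys_iff)
qed

lemma tscale_graded:
  assumes "p \<in> graded \<nu> a" "t \<in> torus \<nu>"
  shows "tscale t p = cconst (tchar t a) * p"
  by (rule eval_poly_eqI) (simp add: eval_tscale eval_graded_tact[OF assms])

lemma cconst_mult_dvd_iff: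
  assumes "c \<noteq> 0"
  shows "(g :: 'k::finite cpoly) dvd cconst c * f \<longleftrightarrow> g dvd f"
proof
  assume "g dvd cconst c * f"
  then have "g dvd cconst (1 / c) * (cconst c * f)" by simp
  then show "g dvd f" using assms by (simp flip: mult.assoc cconst_simps(4))
qed simp

text \<open>An element of G multiplies f and h by constants, so it takes g to another common divisor
  of the same degree, that is to a constant multiple of g. All monomials of g then agree under every
  character, and characters separate classes.\<close>

theorem exists_graded_gcd:
  fixes f h :: "'k::{finite,linorder} cpoly"
  assumes "f \<noteq> 0" "f \<in> graded \<nu> a" "h \<in> graded \<nu> b"
  shows "\<exists>g c. g \<in> graded \<nu> c \<and> g dvd f \<and> g dvd h \<and> (\<forall>q. q dvd f \<and> q dvd h \<longrightarrow> q dvd g) \<and>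
    (\<forall>q. f dvd h * q \<longrightarrow> f dvd g * q)"
proof -
  obtain g where g: "g dvd f" "g dvd h" "\<And>q. q dvd f \<Longrightarrow> q dvd h \<Longrightarrow> q dvd g"
    "\<And>q. f dvd h * q \<Longrightarrow> f dvd g * q"
    using exists_gcd_cpoly[OF assms(1), of h] by blast
  have "g \<noteq> 0" using g(1) assms(1) by auto
  have const: "\<exists>c. \<forall>m\<in>Poly_Mapping.keys g. tchar t (expo m) = c" if t: "t \<in> torus \<nu>" for t
  proof -
    have "tscale t g dvd tscale t f" "tscale t g dvd tscale t h"
      using g(1,2) by (auto simp: dvd_def tscale_mult)
    then have "tscale t g dvd f" "tscale t g dvd h"
      unfolding tscale_graded[OF assms(2) t] tscale_graded[OF assms(3) t]
        cconst_mult_dvd_iff[OF tchar_nonzero[OF t]] .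
    then have "tscale t g dvd g" by (rule g(3))
    then obtain u where u: "g = tscale t g * u" by (elim dvdE)
    have nz: "tscale t g \<noteq> 0" "u \<noteq> 0" using u \<open>g \<noteq> 0\<close> by auto
    \<comment> \<open>Rescaling does not change which monomials occur, so the degrees agree and the
      cofactor \<open>u\<close> is constant.\<close>
    have "Poly_Mapping.keys (tscale t g) = Poly_Mapping.keys g"
      using tchar_nonzero[OF t] by (auto simp: in_keys_iff lookup_tscale)
    then have "tdeg (tscale t g) = tdeg g"
      using nz \<open>g \<noteq> 0\<close> by (simp add: tdeg_def)
    then have "tdeg u = 0"
      using tdeg_mult[OF nz] u by simp
    then obtain c where "u = cconst c" using tdeg_eq_0_imp by blast
    then have "Poly_Mapping.lookup g m = c * (tchar t (expo m) * Poly_Mapping.lookup g m)" for m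
      using arg_cong[OF u, of "\<lambda>p. Poly_Mapping.lookup p m"]
      by (simp add: mult.commute[of "tscale t g"] lookup_cconst_mult lookup_tscale)
    then have "c * tchar t (expo m) = 1" if "m \<in> Poly_Mapping.keys g" for m
      using that[unfolded in_keys_iff] by (metis mult.assoc mult_cancel_right1)
    then have "inverse c = tchar t (expo m)" if "m \<in> Poly_Mapping.keys g" for m
      using inverse_unique that by blast
    then show ?thesis by (intro exI[of _ "inverse c"]) simp
  qed
  obtain m0 where m0: "m0 \<in> Poly_Mapping.keys g"
    using \<open>g \<noteq> 0\<close> by (metis all_not_in_conv keys_eq_empty)
  have "g \<in> graded \<nu> (expo m0)"
    unfolding graded_part_iff
  proof (intro ballI, rule ccontr)
    fix m assume m: "m \<in> Poly_Mapping.keys g" "div_class \<nu> (expo m) \<noteq> div_class \<nu> (expo m0)"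
    then obtain t where "t \<in> torus \<nu>" "tchar t (expo m) \<noteq> tchar t (expo m0)"
      using torus_separates by blast
    with const m(1) m0 show False by metis
  qed
  with g show ?thesis by blast
qed

section \<open>Graded pieces are finite dimensional\<close>

lemma convex_cone_combinations:
  "convex_cone {\<Sum>i\<in>I. c i *\<^sub>R w i |c. \<forall>i\<in>I. 0 \<le> (c i :: real)}"
  unfolding convex_cone_iff
proof (intro conjI ballI allI impI)
  show "0 \<in> {\<Sum>i\<in>I. c i *\<^sub>R w i |c. \<forall>i\<in>I. 0 \<le> (c i :: real)}"
    by (intro CollectI exI[of _ "\<lambda>i. 0"]) simp
  fix x assume "x \<in> {\<Sum>i\<in>I. c i *\<^sub>R w i |c. \<forall>i\<in>I. 0 \<le> (c i :: real)}"
  then obtain c where c: "x = (\<Sum>i\<in>I. c i *\<^sub>R w i)" "\<forall>i\<in>I. 0 \<le> c i" by blast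
  show "a *\<^sub>R x \<in> {\<Sum>i\<in>I. c i *\<^sub>R w i |c. \<forall>i\<in>I. 0 \<le> (c i :: real)}" if "0 \<le> a" for a
    using that c by (intro CollectI exI[of _ "\<lambda>i. a * c i"]) (simp add: scaleR_sum_right)
  fix y assume "y \<in> {\<Sum>i\<in>I. c i *\<^sub>R w i |c. \<forall>i\<in>I. 0 \<le> (c i :: real)}"
  then obtain d where d: "y = (\<Sum>i\<in>I. d i *\<^sub>R w i)" "\<forall>i\<in>I. 0 \<le> d i" by blast
  show "x + y \<in> {\<Sum>i\<in>I. c i *\<^sub>R w i |c. \<forall>i\<in>I. 0 \<le> (c i :: real)}"
    using c d by (intro CollectI exI[of _ "\<lambda>i. c i + d i"]) (simp add: sum.distrib scaleR_add_left)
qed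

lemma mem_combinations:
  fixes w :: "'i \<Rightarrow> 'a::real_vector"
  assumes "finite I" "i \<in> I"
  shows "w i \<in> {\<Sum>i\<in>I. c i *\<^sub>R w i |c. \<forall>i\<in>I. 0 \<le> (c i :: real)}"
proof (intro CollectI exI conjI)
  show "w i = (\<Sum>j\<in>I. (if j = i then 1 else 0) *\<^sub>R w j)"
  proof -
    have "(\<Sum>j\<in>I. (if j = i then 1 else 0) *\<^sub>R w j) = (\<Sum>j\<in>I. if j = i then w i else 0)"
      by (intro sum.cong) auto
    with assms show ?thesis by simp
  qed
qed simp

lemma convex_cone_hull_finite:
  assumes "finite B" "x \<in> convex_cone hull B"
  shows "\<exists>c. (\<forall>b\<in>B. 0 \<le> c b) \<and> x = (\<Sum>b\<in>B. c b *\<^sub>R b)"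
proof -
  have "convex_cone hull B \<subseteq> {\<Sum>i\<in>B. c i *\<^sub>R i |c. \<forall>i\<in>B. 0 \<le> (c i :: real)}"
    by (rule hull_minimal) (use mem_combinations[OF assms(1), where w = "\<lambda>b. b"] convex_cone_combinations[where w = "\<lambda>b. b"] in auto)
  with assms(2) show ?thesis by blast
qed

text \<open>In coordinates with respect to B the cone is an orthant: a convex combination of
  nonnegative coordinates vanishes only if both coordinates do.\<close>

lemma simplicial_ray_face:
  fixes B :: "(real ^ 'n) set"
  assumes "independent B" "b \<in> B"
  shows "convex_cone hull {b} face_of convex_cone hull B"
  unfolding face_of_def
proof (intro conjI ballI impI)
  have fin: "finite B" using assms(1) by (rule independent_imp_finite)
  show "convex_cone hull {b} \<subseteq> convex_cone hull B" using assms(2) by (intro hull_mono) auto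
  show "convex (convex_cone hull {b})" by (rule convex_convex_cone_hull)
  fix y y' x
  assume y: "y \<in> convex_cone hull B" and y': "y' \<in> convex_cone hull B"
    and x: "x \<in> convex_cone hull {b}" and seg: "x \<in> open_segment y y'"
  obtain c where c: "\<forall>b\<in>B. 0 \<le> c b" "y = (\<Sum>b\<in>B. c b *\<^sub>R b)"
    using convex_cone_hull_finite[OF fin y] by blast
  obtain c' where c': "\<forall>b\<in>B. 0 \<le> c' b" "y' = (\<Sum>b\<in>B. c' b *\<^sub>R b)"
    using convex_cone_hull_finite[OF fin y'] by blast
  obtain e where "x = (\<Sum>b\<in>{b}. e b *\<^sub>R b)"
    using convex_cone_hull_finite[OF _ x] by blast
  moreover have "(\<Sum>a\<in>B. (if a = b then e b else 0) *\<^sub>R a) = (\<Sum>a\<in>B. if a = b then e b *\<^sub>R b else 0)"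
    by (intro sum.cong) auto
  ultimately have e: "x = (\<Sum>a\<in>B. (if a = b then e b else 0) *\<^sub>R a)"
    using fin assms(2) by simp
  obtain u where u: "0 < u" "u < 1" "x = (1 - u) *\<^sub>R y + u *\<^sub>R y'"
    using seg by (auto simp: in_segment)
  define r where "r a = (1 - u) * c a + u * c' a - (if a = b then e b else 0)" for a
  have "(\<Sum>a\<in>B. r a *\<^sub>R a) = 0"
    using u(3) unfolding c(2) c'(2) e r_def
    by (simp add: scaleR_diff_left scaleR_add_left sum.distrib sum_subtractf scaleR_sum_right)
  then have r0: "r a = 0" if "a \<in> B" for a
    using assms(1) dependent_finite[OF fin] that by blast
  then have zero: "(1 - u) * c a + u * c' a = (if a = b then e b else 0)" if "a \<in> B" for a
    using r0[OF that] by (simp add: r_def)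
  have "c a = 0 \<and> c' a = 0" if "a \<in> B" "a \<noteq> b" for a
  proof -
    have "(1 - u) * c a + u * c' a = 0" using zero[OF that(1)] that(2) by simp
    moreover have "0 \<le> (1 - u) * c a" "0 \<le> u * c' a"
      using c(1) c'(1) u that by auto
    ultimately have "(1 - u) * c a = 0" "u * c' a = 0" by linarith+
    with u show ?thesis by simp
  qed
  then have "(\<Sum>a\<in>B. c a *\<^sub>R a) = c b *\<^sub>R b" "(\<Sum>a\<in>B. c' a *\<^sub>R a) = c' b *\<^sub>R b"
    using fin assms(2) by (auto simp: sum.remove[of B b])
  moreover have "b \<in> convex_cone hull {b}" by (rule hull_inc) simp
  ultimately show "y \<in> convex_cone hull {b}" "y' \<in> convex_cone hull {b}"
    using c c' assms(2) by (auto intro!: convex_cone_hull_mul)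
qed

text \<open>By completeness x lies in some cone, and the generators of a simplicial cone span faces
  of it, which are rays of the fan.\<close>

lemma complete_fan_combination:
  fixes \<nu> :: "'k::finite \<Rightarrow> int ^ 'n"
  assumes "fan \<Delta>" "complete_fan \<Delta>" "simplicial_fan \<Delta>" "ray_generators \<Delta> \<nu>"
  shows "\<exists>c. (\<forall>i. 0 \<le> c i) \<and> x = (\<Sum>i\<in>UNIV. c i *\<^sub>R rvec (\<nu> i))"
proof -
  define K where "K = {\<Sum>i\<in>UNIV. c i *\<^sub>R rvec (\<nu> i) |c. \<forall>i\<in>UNIV. 0 \<le> (c i :: real)}"
  have K: "convex_cone K" unfolding K_def by (rule convex_cone_combinations)
  obtain \<sigma> where \<sigma>: "\<sigma> \<in> \<Delta>" "x \<in> \<sigma>"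
    using assms(2) by (auto simp: complete_fan_def)
  obtain B where B: "independent B" "\<sigma> = convex_cone hull B"
    using assms(3) \<sigma>(1) by (auto simp: simplicial_fan_def)
  have "b \<in> K" if b: "b \<in> B" for b
  proof -
    have "cone_face (convex_cone hull {b}) \<sigma>"
      unfolding cone_face_def B(2) using simplicial_ray_face[OF B(1) b] convex_cone_hull_nonempty by blast
    then have "convex_cone hull {b} \<in> \<Delta>"
      using assms(1) \<sigma>(1) unfolding fan_def by blast
    moreover have "dim (convex_cone hull {b}) = 1"
    proof -
      have "b \<noteq> 0" using B(1) b dependent_zero by blast
      have "convex_cone hull {b} \<subseteq> span {b}"
        by (rule hull_minimal) (auto simp: convex_cone_iff span_base span_add span_scale span_zero)
      then have "span (convex_cone hull {b}) = span {b}"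
        by (metis hull_subset span_eq span_mono span_span subset_antisym)
      then have "dim (convex_cone hull {b}) = dim {b}" by (metis dim_span)
      then show ?thesis using \<open>b \<noteq> 0\<close> by (simp add: dim_singleton)
    qed
    ultimately have "convex_cone hull {b} \<in> range (\<lambda>i. ray (\<nu> i))"
      using assms(4) unfolding ray_generators_def bij_betw_def rays_def by auto
    then obtain i where "convex_cone hull {b} = ray (\<nu> i)" by blast
    then have "b \<in> convex_cone hull {rvec (\<nu> i)}"
      unfolding ray_def by (metis hull_inc singletonI)
    moreover have "convex_cone hull {rvec (\<nu> i)} \<subseteq> K"
      using K mem_combinations[of UNIV i "\<lambda>i. rvec (\<nu> i)"]
      by (intro hull_minimal) (auto simp: K_def)
    ultimately show ?thesis by blast
  qed
  then have "\<sigma> \<subseteq> K"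
    unfolding B(2) using K by (intro hull_minimal) auto
  then show ?thesis using \<sigma>(2) unfolding K_def by auto
qed

lemma finite_bounded_int_vec: "finite {u :: int ^ 'n. \<forall>j. \<bar>u $ j\<bar> \<le> M j}"
proof (rule finite_subset)
  show "{u :: int ^ 'n. \<forall>j. \<bar>u $ j\<bar> \<le> M j} \<subseteq> vec_lambda ` (\<Pi>\<^sub>E j\<in>UNIV. {- M j..M j})"
  proof
    fix u :: "int ^ 'n" assume "u \<in> {u. \<forall>j. \<bar>u $ j\<bar> \<le> M j}"
    then have "- M j \<le> u $ j \<and> u $ j \<le> M j" for j
      using abs_le_D1[of "u $ j" "M j"] abs_le_D2[of "u $ j" "M j"] by auto
    then have "(\<lambda>j. u $ j) \<in> (\<Pi>\<^sub>E j\<in>UNIV. {- M j..M j})"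
      by (simp add: PiE_iff extensional_def)
    then show "u \<in> vec_lambda ` (\<Pi>\<^sub>E j\<in>UNIV. {- M j..M j})"
      by (intro image_eqI[of _ _ "\<lambda>j. u $ j"]) auto
  qed
  show "finite (vec_lambda ` (\<Pi>\<^sub>E j\<in>(UNIV :: 'n set). {- M j..M j}))"
    by (intro finite_imageI finite_PiE) auto
qed

text \<open>The exponents in a class are the translates of one exponent by characters u satisfying
  an inequality for each ray. Since the rays positively span the space, these inequalities cut out a
  bounded set of lattice points.\<close>

lemma finite_graded_monomials:
  fixes \<nu> :: "'k::finite \<Rightarrow> int ^ 'n"
  assumes "fan \<Delta>" "complete_fan \<Delta>" "simplicial_fan \<Delta>" "ray_generators \<Delta> \<nu>"
  shows "finite {m. div_class \<nu> (expo m) = C}"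
proof (cases "{m. div_class \<nu> (expo m) = C} = {}")
  case False
  then obtain m0 where m0: "div_class \<nu> (expo m0) = C" by blast
  have bound: "\<exists>M::int. \<forall>u. (\<forall>i. 0 \<le> expo m0 i + pairing u (\<nu> i)) \<longrightarrow> s * u $ j \<le> M"
    if s: "s = 1 \<or> s = (-1::int)" for s and j :: 'n
  proof -
    \<comment> \<open>Summing the inequalities with the coefficients that express - s e_j through
      the rays leaves an upper bound for s u_j; both signs bound the absolute value.\<close>
    obtain c where c: "\<And>i. 0 \<le> c i"
      "(\<chi> l. if l = j then - real_of_int s else 0) = (\<Sum>i\<in>UNIV. c i *\<^sub>R rvec (\<nu> i))"
      using complete_fan_combination[OF assms] by blast
    define M where "M = (\<Sum>i\<in>UNIV. c i * expo m0 i)"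
    have "s * u $ j \<le> \<lfloor>M\<rfloor>" if u: "\<forall>i. 0 \<le> expo m0 i + pairing u (\<nu> i)" for u
    proof -
      have comp: "(\<Sum>i\<in>UNIV. c i * real_of_int (\<nu> i $ l)) = (if l = j then - real_of_int s else 0)" for l
        using arg_cong[OF c(2), of "\<lambda>v. v $ l"] by (simp add: rvec_def)
      have "(\<Sum>i\<in>UNIV. c i * pairing u (\<nu> i)) = (\<Sum>i\<in>UNIV. \<Sum>l\<in>UNIV. u $ l * (c i * \<nu> i $ l))"
        by (simp add: pairing_def sum_distrib_left algebra_simps)
      also have "\<dots> = (\<Sum>l\<in>UNIV. u $ l * (\<Sum>i\<in>UNIV. c i * \<nu> i $ l))"
        by (subst sum.swap) (simp add: sum_distrib_left)
      also have "\<dots> = - (s * u $ j)"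
        by (simp add: comp if_distrib cong: if_cong)
      finally have eq: "(\<Sum>i\<in>UNIV. c i * pairing u (\<nu> i)) = - (s * u $ j)" .
      have "0 \<le> (\<Sum>i\<in>UNIV. c i * real_of_int (expo m0 i + pairing u (\<nu> i)))"
        using u c(1) by (intro sum_nonneg mult_nonneg_nonneg) (auto simp del: of_int_add)
      also have "\<dots> = M - real_of_int (s * u $ j)"
        using eq by (simp add: M_def algebra_simps sum.distrib)
      finally show ?thesis by (simp add: le_floor_iff)
    qed
    then show ?thesis by blast
  qed
  have "\<exists>M::int. \<forall>u. (\<forall>i. 0 \<le> expo m0 i + pairing u (\<nu> i)) \<longrightarrow> \<bar>u $ j\<bar> \<le> M" for j
  proof -
    obtain M1 M2 where "\<forall>u. (\<forall>i. 0 \<le> expo m0 i + pairing u (\<nu> i)) \<longrightarrow> 1 * u $ j \<le> M1"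
      "\<forall>u. (\<forall>i. 0 \<le> expo m0 i + pairing u (\<nu> i)) \<longrightarrow> - 1 * u $ j \<le> M2"
      using bound[of 1 j] bound[of "- 1" j] by blast
    then show ?thesis by (intro exI[of _ "max M1 M2"]) (force simp: abs_le_iff)
  qed
  then obtain M where M: "\<And>u j. (\<forall>i. 0 \<le> expo m0 i + pairing u (\<nu> i)) \<Longrightarrow> \<bar>u $ j\<bar> \<le> M j"
    by metis
  have "expo ` {m. div_class \<nu> (expo m) = C} \<subseteq>
      (\<lambda>u i. expo m0 i + pairing u (\<nu> i)) ` {u. \<forall>j. \<bar>u $ j\<bar> \<le> M j}"
  proof (intro image_subsetI)
    fix m assume "m \<in> {m. div_class \<nu> (expo m) = C}"
    then have "(\<lambda>i. expo m i - expo m0 i) \<in> principal_divisors \<nu>"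
      using m0 by (simp flip: div_class_eq_iff)
    then obtain u where "(\<lambda>i. expo m i - expo m0 i) = (\<lambda>i. pairing u (\<nu> i))"
      by (auto simp: principal_divisors_def)
    then have u: "expo m i = expo m0 i + pairing u (\<nu> i)" for i
      by (metis add.commute diff_add_cancel)
    have "0 \<le> expo m0 i + pairing u (\<nu> i)" for i
      unfolding u[symmetric] by (simp add: expo_def)
    with u M show "expo m \<in> (\<lambda>u i. expo m0 i + pairing u (\<nu> i)) ` {u. \<forall>j. \<bar>u $ j\<bar> \<le> M j}"
      by (intro image_eqI[of _ _ u]) auto
  qed
  then have "finite (expo ` {m. div_class \<nu> (expo m) = C})"
    by (rule finite_subset) (intro finite_imageI finite_bounded_int_vec)
  moreover have "inj expo"
    by (rule injI, rule poly_mapping_eqI) (simp add: expo_def fun_eq_iff)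
  ultimately show ?thesis
    using finite_imageD inj_on_subset by blast
qed simp

section \<open>Dimension counts\<close>

lemma hdim_eq_card: "hdim \<nu> C = card {m. div_class \<nu> (expo m) = C}"
proof -
  interpret vector_space cscale by (rule vector_space_cscale)
  define e :: "('a \<Rightarrow>\<^sub>0 nat) \<Rightarrow> 'a cpoly" where "e m = Poly_Mapping.single m 1" for m
  have inj: "inj e"
    by (rule injI) (metis e_def keys_single one_neq_zero singleton_inject)
  have scale: "cscale a (e m) = Poly_Mapping.single m a" for a m
    by (simp add: cscale_def cconst_def e_def mult_single)
  define M where "M = {m. div_class \<nu> (expo m) = C}"
  have "independent (e ` M)"
    unfolding independent_explicit_module
  proof (intro allI impI)
    fix t u v assume t: "finite t" "t \<subseteq> e ` M" "(\<Sum>v\<in>t. cscale (u v) v) = 0" "v \<in> t"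
    then obtain N where N: "t = e ` N" "finite N"
      by (metis finite_subset_image)
    obtain m where m: "v = e m" "m \<in> N" using t(4) N(1) by blast
    have "(\<Sum>n\<in>N. Poly_Mapping.single n (u (e n))) = 0"
      using t(3) inj_on_subset[OF inj, of N] by (simp add: N(1) sum.reindex scale)
    then have "Poly_Mapping.lookup (\<Sum>n\<in>N. Poly_Mapping.single n (u (e n))) m = 0" by simp
    then show "u v = 0"
      using N(2) m by (simp add: lookup_sum lookup_single when_def)
  qed
  moreover have "span (e ` M) = span (graded_part \<nu> C)"
    unfolding span_eq
  proof (intro conjI subsetI)
    fix p assume "p \<in> graded_part \<nu> C"
    then have "(\<Sum>m\<in>Poly_Mapping.keys p. cscale (Poly_Mapping.lookup p m) (e m)) \<in> span (e ` M)"
      by (intro span_sum span_scale span_base) (auto simp: M_def graded_part_iff)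
    then show "p \<in> span (e ` M)"
      by (simp add: scale flip: cpoly_eq_sum_single)
  next
    fix p assume "p \<in> e ` M"
    then show "p \<in> span (graded_part \<nu> C)"
      by (intro span_base) (auto simp: M_def graded_part_iff e_def)
  qed
  ultimately have "dim (graded_part \<nu> C) = card (e ` M)"
    by (intro dim_eq_card) auto
  then show ?thesis
    using card_image[OF inj_on_subset[OF inj], of M] by (simp add: hdim_def M_def)
qed

text \<open>Gaussian elimination: solving equation x for an unknown W with nonzero coefficient
  removes one equation and one unknown.\<close>

lemma exists_linear_relation:
  fixes c :: "'h \<Rightarrow> 'i \<Rightarrow> complex"
  assumes "finite I" "finite H" "card I < card H"
  shows "\<exists>l. (\<exists>V\<in>H. l V \<noteq> 0) \<and> (\<forall>x\<in>I. (\<Sum>V\<in>H. l V * c V x) = 0)"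
  using assms
proof (induction I arbitrary: H c rule: finite_induct)
  case empty
  then obtain V where "V \<in> H" by fastforce
  then show ?case by (intro exI[of _ "\<lambda>V. 1"]) auto
next
  case (insert x I)
  show ?case
  proof (cases "\<forall>V\<in>H. c V x = 0")
    case True
    obtain l where "\<exists>V\<in>H. l V \<noteq> 0" "\<forall>y\<in>I. (\<Sum>V\<in>H. l V * c V y) = 0"
      using insert.IH[of H c] insert.prems insert.hyps by auto
    with True show ?thesis by (intro exI[of _ l]) auto
  next
    case False
    then obtain W where W: "W \<in> H" "c W x \<noteq> 0" by blast
    define c' where "c' V y = c V y - c V x / c W x * c W y" for V y
    have "card I < card (H - {W})"
      using insert.prems insert.hyps W(1) by simp
    then obtain l where l: "\<exists>V\<in>H - {W}. l V \<noteq> 0" "\<forall>y\<in>I. (\<Sum>V\<in>H - {W}. l V * c' V y) = 0"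
      using insert.IH[of "H - {W}" c'] insert.prems by auto
    define r where "r = (\<Sum>V\<in>H - {W}. l V * c V x) / c W x"
    define l' where "l' = l(W := - r)"
    have sum: "(\<Sum>V\<in>H. l' V * c V y) = (\<Sum>V\<in>H - {W}. l V * c V y) - r * c W y" for y
      using insert.prems W(1) by (simp add: sum.remove[of H W] l'_def)
    have "(\<Sum>V\<in>H. l' V * c V x) = 0"
      using W(2) by (simp add: sum r_def)
    moreover have "(\<Sum>V\<in>H. l' V * c V y) = 0" if "y \<in> I" for y
    proof -
      have "(\<Sum>V\<in>H - {W}. l V * c' V y) = (\<Sum>V\<in>H - {W}. l V * c V y) - r * c W y"
        by (simp add: c'_def r_def algebra_simps sum_subtractf sum_distrib_left sum_divide_distrib)
      with l(2) that sum show ?thesis by simp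
    qed
    moreover have "\<exists>V\<in>H. l' V \<noteq> 0"
      using l(1) by (auto simp: l'_def)
    ultimately show ?thesis by (intro exI[of _ l']) auto
  qed
qed

section \<open>Closed subsets and hypersurfaces\<close>

lemma zariski_closedE:
  assumes "zariski_closed \<Delta> \<nu> W"
  obtains I where "\<And>z. z \<notin> irrelevant_locus \<Delta> \<nu> \<Longrightarrow> orbit \<nu> z \<in> W \<longleftrightarrow> (\<forall>p\<in>I. eval_poly p z = 0)"
proof -
  obtain I where "{z \<in> - irrelevant_locus \<Delta> \<nu>. orbit \<nu> z \<in> W} =
      {z \<in> - irrelevant_locus \<Delta> \<nu>. \<forall>p\<in>I. eval_poly p z = 0}"
    using assms unfolding zariski_closed_def by blast
  then have "orbit \<nu> z \<in> W \<longleftrightarrow> (\<forall>p\<in>I. eval_poly p z = 0)" if "z \<notin> irrelevant_locus \<Delta> \<nu>" for z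
    using that unfolding set_eq_iff by blast
  then show ?thesis by (rule that)
qed

lemma zariski_closedI:
  assumes "W \<subseteq> toric_variety \<Delta> \<nu>"
    and "\<And>z. z \<notin> irrelevant_locus \<Delta> \<nu> \<Longrightarrow> orbit \<nu> z \<in> W \<longleftrightarrow> (\<forall>p\<in>I. eval_poly p z = 0)"
  shows "zariski_closed \<Delta> \<nu> W"
  unfolding zariski_closed_def using assms by (intro conjI exI[of _ I]) auto

lemma zariski_closed_subset: "zariski_closed \<Delta> \<nu> W \<Longrightarrow> W \<subseteq> toric_variety \<Delta> \<nu>"
  by (simp add: zariski_closed_def)

lemma zariski_closed_Int:
  assumes "zariski_closed \<Delta> \<nu> V" "zariski_closed \<Delta> \<nu> W"
  shows "zariski_closed \<Delta> \<nu> (V \<inter> W)"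
proof -
  obtain I where I: "\<And>z. z \<notin> irrelevant_locus \<Delta> \<nu> \<Longrightarrow> orbit \<nu> z \<in> V \<longleftrightarrow> (\<forall>p\<in>I. eval_poly p z = 0)"
    using zariski_closedE[OF assms(1)] by blast
  obtain J where J: "\<And>z. z \<notin> irrelevant_locus \<Delta> \<nu> \<Longrightarrow> orbit \<nu> z \<in> W \<longleftrightarrow> (\<forall>p\<in>J. eval_poly p z = 0)"
    using zariski_closedE[OF assms(2)] by blast
  show ?thesis
    using zariski_closed_subset[OF assms(1)] I J by (intro zariski_closedI[where I = "I \<union> J"]) auto
qed

lemma zariski_closed_Un:
  assumes "zariski_closed \<Delta> \<nu> V" "zariski_closed \<Delta> \<nu> W"
  shows "zariski_closed \<Delta> \<nu> (V \<union> W)"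
proof -
  obtain I where I: "\<And>z. z \<notin> irrelevant_locus \<Delta> \<nu> \<Longrightarrow> orbit \<nu> z \<in> V \<longleftrightarrow> (\<forall>p\<in>I. eval_poly p z = 0)"
    using zariski_closedE[OF assms(1)] by blast
  obtain J where J: "\<And>z. z \<notin> irrelevant_locus \<Delta> \<nu> \<Longrightarrow> orbit \<nu> z \<in> W \<longleftrightarrow> (\<forall>p\<in>J. eval_poly p z = 0)"
    using zariski_closedE[OF assms(2)] by blast
  show ?thesis
  proof (rule zariski_closedI[where I = "{p * q |p q. p \<in> I \<and> q \<in> J}"])
    show "V \<union> W \<subseteq> toric_variety \<Delta> \<nu>"
      using zariski_closed_subset assms by blast
    fix z assume z: "z \<notin> irrelevant_locus \<Delta> \<nu>"
    have "(\<forall>r\<in>{p * q |p q. p \<in> I \<and> q \<in> J}. eval_poly r z = 0) \<longleftrightarrow>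
        (\<forall>p\<in>I. \<forall>q\<in>J. eval_poly p z = 0 \<or> eval_poly q z = 0)"
      by (auto; metis eval_poly_simps(2) mult_eq_0_iff)
    then show "orbit \<nu> z \<in> V \<union> W \<longleftrightarrow> (\<forall>r\<in>{p * q |p q. p \<in> I \<and> q \<in> J}. eval_poly r z = 0)"
      using I[OF z] J[OF z] by blast
  qed
qed

lemma zariski_closed_empty: "zariski_closed \<Delta> \<nu> {}"
  by (rule zariski_closedI[where I = "{1}"]) auto

lemma zariski_closed_Union:
  "finite K \<Longrightarrow> (\<And>W. W \<in> K \<Longrightarrow> zariski_closed \<Delta> \<nu> W) \<Longrightarrow> zariski_closed \<Delta> \<nu> (\<Union>K)"
  by (induction K rule: finite_induct) (simp_all add: zariski_closed_empty zariski_closed_Un)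

lemma irreducible_imp_zariski_closed: "irreducible_closed \<Delta> \<nu> V \<Longrightarrow> zariski_closed \<Delta> \<nu> V"
  by (simp add: irreducible_closed_def)

lemma irreducible_covered:
  assumes V: "irreducible_closed \<Delta> \<nu> V"
    and "finite K" "\<And>W. W \<in> K \<Longrightarrow> zariski_closed \<Delta> \<nu> W" "V \<subseteq> \<Union>K"
  shows "\<exists>W\<in>K. V \<subseteq> W"
  using assms(2-)
proof (induction K rule: finite_induct)
  case empty
  with V show ?case by (auto simp: irreducible_closed_def)
next
  case (insert W K)
  have "zariski_closed \<Delta> \<nu> (V \<inter> W)" "zariski_closed \<Delta> \<nu> (V \<inter> \<Union>K)"
    using irreducible_imp_zariski_closed[OF V] insert.prems(1) insert.hyps(1)
    by (simp_all add: zariski_closed_Int zariski_closed_Union)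
  moreover have "V = (V \<inter> W) \<union> (V \<inter> \<Union>K)" using insert.prems(2) by auto
  ultimately have "V \<inter> W = V \<or> V \<inter> \<Union>K = V"
    using V unfolding irreducible_closed_def by blast
  then show ?case
    using insert.IH insert.prems(1) by blast
qed

lemma orbit_in_hypersurface_iff:
  assumes "f \<in> graded \<nu> a" "z \<notin> irrelevant_locus \<Delta> \<nu>"
  shows "orbit \<nu> z \<in> hypersurface \<Delta> \<nu> f \<longleftrightarrow> eval_poly f z = 0"
proof
  assume "orbit \<nu> z \<in> hypersurface \<Delta> \<nu> f"
  then obtain y where "orbit \<nu> z = orbit \<nu> y" "eval_poly f y = 0"
    by (auto simp: hypersurface_def)
  then show "eval_poly f z = 0"
    by (rule graded_zero_orbit[OF assms(1)])
qed (use assms(2) in \<open>auto simp: hypersurface_def\<close>)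

lemma zariski_closed_hypersurface:
  assumes "f \<in> graded \<nu> a"
  shows "zariski_closed \<Delta> \<nu> (hypersurface \<Delta> \<nu> f)"
proof (rule zariski_closedI[where I = "{f}"])
  show "hypersurface \<Delta> \<nu> f \<subseteq> toric_variety \<Delta> \<nu>"
    by (auto simp: hypersurface_def toric_variety_def)
qed (simp add: orbit_in_hypersurface_iff[OF assms])

text \<open>
  Among the hypersurfaces with a nonzero coefficient take one that is maximal under inclusion. By
  irreducibility it has a point outside all the others, and along a line through that point the
  term of this hypersurface vanishes to a lower order than all the other terms.
\<close>

lemma log_forms_independent:
  fixes F :: "(complex ^ 'k::finite) set set \<Rightarrow> 'k cpoly" and l :: "(complex ^ 'k) set set \<Rightarrow> complex"
  assumes "finite K" "K \<noteq> {}"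
    and V: "\<And>V. V \<in> K \<Longrightarrow> irreducible_closed \<Delta> \<nu> V \<and> V = hypersurface \<Delta> \<nu> (F V) \<and> F V \<noteq> 0 \<and> l V \<noteq> 0"
  shows "\<exists>i. (\<Sum>V\<in>K. cconst (l V) * pdiff i (F V) * (\<Prod>W\<in>K - {V}. F W)) \<noteq> 0"
proof (rule ccontr)
  assume "\<not> ?thesis"
  then have zero: "(\<Sum>V\<in>K. cconst (l V) * pdiff i (F V) * (\<Prod>W\<in>K - {V}. F W)) = 0" for i
    by blast
  obtain V where VK: "V \<in> K" "\<And>W. W \<in> K \<Longrightarrow> V \<subseteq> W \<Longrightarrow> V = W"
    using finite_has_maximal[OF assms(1,2)] by blast
  have "\<not> V \<subseteq> \<Union>(K - {V})"
  proof
    assume "V \<subseteq> \<Union>(K - {V})"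
    moreover have "irreducible_closed \<Delta> \<nu> V" "\<And>W. W \<in> K - {V} \<Longrightarrow> zariski_closed \<Delta> \<nu> W"
      using V VK(1) irreducible_imp_zariski_closed[of \<Delta> \<nu>] by blast+
    ultimately have "\<exists>W\<in>K - {V}. V \<subseteq> W"
      using assms(1) by (intro irreducible_covered) auto
    with VK(2) show False by blast
  qed
  then obtain x where x: "x \<in> V" "\<And>W. W \<in> K - {V} \<Longrightarrow> x \<notin> W" by blast
  have hyp: "hypersurface \<Delta> \<nu> (F W) = W" if "W \<in> K" for W
    using V[OF that] by blast
  have "x \<in> hypersurface \<Delta> \<nu> (F V)"
    unfolding hyp[OF VK(1)] by (rule x(1))
  then obtain z where z: "x = orbit \<nu> z" "z \<notin> irrelevant_locus \<Delta> \<nu>" "eval_poly (F V) z = 0"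
    by (auto simp: hypersurface_def)
  have other: "eval_poly (F W) z \<noteq> 0" if "W \<in> K - {V}" for W
  proof
    assume "eval_poly (F W) z = 0"
    then have "x \<in> hypersurface \<Delta> \<nu> (F W)" using z by (auto simp: hypersurface_def)
    with x(2)[OF that] hyp[of W] that show False by auto
  qed
  \<comment> \<open>A point where \<open>F V\<close> is nonzero fixes the direction, so that
    \<open>F V\<close> is not identically zero on the line.\<close>
  obtain w where w: "eval_poly (F V) w \<noteq> 0"
    using exists_eval_nonzero[of "F V"] V[OF VK(1)] by blast
  define v where "v = w - z"
  define a where "a W = fline v z (F W)" for W
  define rest where "rest U = (\<Prod>W\<in>K - {U}. a W)" for U
  have "(\<Sum>U\<in>K. [:l U:] * pderiv (a U) * rest U) =
      (\<Sum>i\<in>UNIV. [:v $ i:] * fline v z (\<Sum>U\<in>K. cconst (l U) * pdiff i (F U) * (\<Prod>W\<in>K - {U}. F W)))"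
    unfolding a_def rest_def pderiv_fline fline_simps sum_distrib_left sum_distrib_right
    by (subst sum.swap) (intro sum.cong refl, simp only: mult_ac)
  then have "(\<Sum>U\<in>K. [:l U:] * pderiv (a U) * rest U) = 0"
    by (simp add: zero del: fline_simps(10))
  then have eq: "[:l V:] * pderiv (a V) * rest V = - (\<Sum>U\<in>K - {V}. [:l U:] * pderiv (a U) * rest U)"
    using assms(1) VK(1) by (simp add: sum.remove[of K V] eq_neg_iff_add_eq_0)
  \<comment> \<open>Every other product still contains \<open>a V\<close>, so by \<open>eq\<close>
    the term of V is divisible by it too.\<close>
  have "a V dvd rest U" if "U \<in> K - {V}" for U
    unfolding rest_def using assms(1) VK(1) that by (intro dvd_prodI) auto
  then have dvd: "a V dvd [:l V:] * pderiv (a V) * rest V"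
    unfolding eq dvd_minus_iff by (intro dvd_sum dvd_mult) auto
  have aV0: "poly (a V) 0 = 0" using z(3) by (simp add: a_def poly_fline)
  have "poly (a V) 1 \<noteq> 0" using w by (simp add: a_def poly_fline v_def)
  then have aV: "a V \<noteq> 0" by auto
  have "pderiv (a V) \<noteq> 0"
  proof
    assume "pderiv (a V) = 0"
    then obtain c where "a V = [:c:]"
      using pderiv_eq_0_iff degree_eq_zeroE by blast
    with aV0 aV show False by simp
  qed
  moreover have "poly (rest V) 0 \<noteq> 0"
    using other assms(1) by (simp add: rest_def poly_prod a_def poly_fline)
  moreover have "l V \<noteq> 0" using V VK(1) by blast
  ultimately have nz: "[:l V:] * pderiv (a V) * rest V \<noteq> 0" and ord: "Polynomial.order 0 (rest V) = 0" "Polynomial.order 0 [:l V:] = 0"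
    by (auto intro!: order_0I)
  \<comment> \<open>Since \<open>rest V\<close> is nonzero at t = 0, divisibility bounds the order
    of \<open>a V\<close> by that of its derivative, which is one less.\<close>
  have "Polynomial.order 0 (a V) \<le> Polynomial.order 0 ([:l V:] * pderiv (a V) * rest V)"
    by (rule dvd_imp_order_le[OF nz dvd])
  also have "\<dots> = Polynomial.order 0 (pderiv (a V))"
    using nz ord order_mult by (metis add.right_neutral add_0 mult_eq_0_iff)
  finally show False
    using order_pderiv[OF aV aV0] by simp
qed

section \<open>From invariant hypersurfaces to a first integral\<close>

lemma holomorphic_several_isCont: "holomorphic_several h U \<Longrightarrow> z \<in> U \<Longrightarrow> isCont h z"
proof -
  assume "holomorphic_several h U" "z \<in> U"
  then obtain h' where "(h has_derivative h') (at z)"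
    by (auto simp: holomorphic_several_def)
  then show ?thesis by (rule has_derivative_continuous)
qed

text \<open>Holomorphy makes \<Theta> continuous off the irrelevant locus, and there a continuous
  quotient of polynomials is already a polynomial.\<close>

lemma invariant_equation_quotient:
  fixes \<nu> :: "'k::{finite,linorder} \<Rightarrow> int ^ 'n"
  assumes "fan \<Delta>" "ray_generators \<Delta> \<nu>" "f \<noteq> 0" "invariant_equation \<Delta> \<nu> \<omega> f"
  shows "\<exists>q. \<forall>i j. wedge11 \<omega> (d0 f) i j = f * q i j"
proof -
  obtain \<Theta> where \<Theta>: "\<And>i j. holomorphic_several (\<Theta> i j) (- irrelevant_locus \<Delta> \<nu>)"
    "\<And>i j z. z \<in> - irrelevant_locus \<Delta> \<nu> \<Longrightarrow> eval_poly (wedge11 \<omega> (d0 f) i j) z = eval_poly f z * \<Theta> i j z"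
    using assms(4) unfolding invariant_equation_def by blast
  have "f dvd wedge11 \<omega> (d0 f) i j" for i j
  proof (rule dvd_if_continuous_quotient[OF assms(1-3), where \<Theta> = "\<Theta> i j"])
    show "isCont (\<Theta> i j) z" if "z \<notin> irrelevant_locus \<Delta> \<nu>" for z
      using that by (intro holomorphic_several_isCont[OF \<Theta>(1)]) simp
  qed (use \<Theta>(2) in simp)
  then have "\<forall>i j. \<exists>q. wedge11 \<omega> (d0 f) i j = f * q"
    by (simp add: dvd_def)
  then show ?thesis by metis
qed

text \<open>The numerator of the logarithmic form \<Sum> l_V df_V / f_V over the common denominator
  \<Prod> f_V.\<close>

definition logsum :: "('v \<Rightarrow> 'k::{finite,linorder} cpoly) \<Rightarrow> 'v set \<Rightarrow> ('v \<Rightarrow> complex) \<Rightarrow> 'k \<Rightarrow> 'k cpoly" where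
  "logsum f H l i = (\<Sum>V\<in>H. cconst (l V) * pdiff i (f V) * (\<Prod>W\<in>H - {V}. f W))"

lemma logsum_graded:
  assumes "finite H" "\<And>V. V \<in> H \<Longrightarrow> f V \<in> graded \<nu> (a V)"
  shows "logsum f H l i \<in> graded \<nu> (\<lambda>x. (\<Sum>V\<in>H. a V x) - unit_div i x)"
  unfolding logsum_def
proof (rule graded_part_sum)
  fix V assume V: "V \<in> H"
  have "pdiff i (f V) * (\<Prod>W\<in>H - {V}. f W) \<in>
      graded \<nu> (\<lambda>x. (\<lambda>x. a V x - unit_div i x) x + (\<lambda>x. \<Sum>W\<in>H - {V}. a W x) x)"
    using assms(2) V by (intro graded_mult graded_pdiff graded_prod) auto
  moreover have "(\<lambda>x. (\<lambda>x. a V x - unit_div i x) x + (\<lambda>x. \<Sum>W\<in>H - {V}. a W x) x) =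
      (\<lambda>x. (\<Sum>V\<in>H. a V x) - unit_div i x)"
    using assms(1) V by (simp add: fun_eq_iff sum.remove[of H V])
  ultimately show "cconst (l V) * pdiff i (f V) * (\<Prod>W\<in>H - {V}. f W) \<in>
      graded \<nu> (\<lambda>x. (\<Sum>V\<in>H. a V x) - unit_div i x)"
    by (simp add: mult.assoc graded_part_cconst_mult)
qed

text \<open>Closedness of the logarithmic form, with denominators cleared: d(A / p) = 0 means p dA =
  dp \<and> A. It is checked for each summand.\<close>

lemma logsum_closed:
  fixes f :: "'v \<Rightarrow> 'k::{finite,linorder} cpoly"
  assumes "finite H"
  defines "p \<equiv> \<Prod>V\<in>H. f V"
  shows "p * (pdiff i (logsum f H l j) - pdiff j (logsum f H l i)) =
    logsum f H l j * pdiff i p - logsum f H l i * pdiff j p"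
proof -
  define T where "T V i = cconst (l V) * pdiff i (f V) * (\<Prod>W\<in>H - {V}. f W)" for V i
  have "p * (pdiff i (T V j) - pdiff j (T V i)) = T V j * pdiff i p - T V i * pdiff j p"
    if "V \<in> H" for V
  proof -
    define R where "R = (\<Prod>W\<in>H - {V}. f W)"
    have p: "p = f V * R" using assms(1) that by (simp add: p_def R_def prod.remove[of H V])
    show ?thesis
      unfolding T_def R_def[symmetric] p pdiff_mult pdiff_cconst pdiff_commute[of i j]
      by (simp add: algebra_simps)
  qed
  moreover have "logsum f H l i = (\<Sum>V\<in>H. T V i)" for i
    by (simp add: logsum_def T_def)
  ultimately show ?thesis
    by (simp add: pdiff_sum sum_distrib_left sum_distrib_right sum_subtractf[symmetric])
qed

text \<open>The wedge of \<omega> with the logarithmic form is \<Sum> l_V q_V. A linear relation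
  among the q_V therefore makes the two forms proportional.\<close>

lemma logsum_wedge:
  fixes f :: "'v \<Rightarrow> 'k::{finite,linorder} cpoly"
  assumes "finite H" "\<And>V i j. V \<in> H \<Longrightarrow> wedge11 \<omega> (d0 (f V)) i j = f V * q V i j"
  shows "\<omega> i * logsum f H l j - \<omega> j * logsum f H l i =
    (\<Prod>V\<in>H. f V) * (\<Sum>V\<in>H. cconst (l V) * q V i j)"
proof -
  have "\<omega> i * (cconst (l V) * pdiff j (f V) * (\<Prod>W\<in>H - {V}. f W)) -
      \<omega> j * (cconst (l V) * pdiff i (f V) * (\<Prod>W\<in>H - {V}. f W)) =
      (\<Prod>V\<in>H. f V) * (cconst (l V) * q V i j)" if "V \<in> H" for V
  proof -
    define R where "R = (\<Prod>W\<in>H - {V}. f W)"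
    have p: "(\<Prod>V\<in>H. f V) = f V * R" using assms(1) that by (simp add: R_def prod.remove[of H V])
    have "\<omega> i * pdiff j (f V) - \<omega> j * pdiff i (f V) = f V * q V i j"
      using assms(2)[OF that, of i j] by (simp add: wedge11_def d0_def)
    then have "cconst (l V) * R * (\<omega> i * pdiff j (f V) - \<omega> j * pdiff i (f V)) =
        cconst (l V) * R * (f V * q V i j)" by simp
    then show ?thesis
      unfolding R_def[symmetric] p by (simp add: algebra_simps)
  qed
  then show ?thesis
    by (simp add: logsum_def sum_distrib_left flip: sum_subtractf)
qed

text \<open>Independence was shown for nonzero coefficients; restricting to their support K only
  splits off the nonzero factor \<Prod> f_W over H - K.\<close>

lemma logsum_nonzero:
  fixes f :: "(complex, 'k) vec set set \<Rightarrow> 'k::{finite,linorder} cpoly"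
  assumes "finite H" "\<And>V. V \<in> H \<Longrightarrow> irreducible_closed \<Delta> \<nu> V"
    "\<And>V. V \<in> H \<Longrightarrow> V = hypersurface \<Delta> \<nu> (f V)" "\<And>V. V \<in> H \<Longrightarrow> f V \<noteq> 0"
    and "\<exists>V\<in>H. l V \<noteq> 0"
  shows "\<exists>i. logsum f H l i \<noteq> 0"
proof -
  define K where "K = {V \<in> H. l V \<noteq> 0}"
  have K: "finite K" "K \<noteq> {}" "K \<subseteq> H" using assms(1,5) by (auto simp: K_def)
  obtain i where i: "(\<Sum>V\<in>K. cconst (l V) * pdiff i (f V) * (\<Prod>W\<in>K - {V}. f W)) \<noteq> 0"
    using log_forms_independent[OF K(1,2), of \<Delta> \<nu> f l] assms(2-4) by (auto simp: K_def)
  have "logsum f H l i = (\<Sum>V\<in>K. cconst (l V) * pdiff i (f V) * (\<Prod>W\<in>H - {V}. f W))"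
    unfolding logsum_def using assms(1) by (intro sum.mono_neutral_right) (auto simp: K_def)
  also have "\<dots> = (\<Sum>V\<in>K. (\<Prod>W\<in>H - K. f W) * (cconst (l V) * pdiff i (f V) * (\<Prod>W\<in>K - {V}. f W)))"
  proof (rule sum.cong[OF refl])
    fix V assume V: "V \<in> K"
    have "H - {V} = (H - K) \<union> (K - {V})" using V K(3) by auto
    moreover have "(\<Prod>W\<in>(H - K) \<union> (K - {V}). f W) = (\<Prod>W\<in>H - K. f W) * (\<Prod>W\<in>K - {V}. f W)"
      by (rule prod.union_disjoint) (use assms(1) K(1) in auto)
    ultimately have "(\<Prod>W\<in>H - {V}. f W) = (\<Prod>W\<in>H - K. f W) * (\<Prod>W\<in>K - {V}. f W)"
      by simp
    then show "cconst (l V) * pdiff i (f V) * (\<Prod>W\<in>H - {V}. f W) =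
        (\<Prod>W\<in>H - K. f W) * (cconst (l V) * pdiff i (f V) * (\<Prod>W\<in>K - {V}. f W))"
      by (simp add: mult_ac)
  qed
  also have "\<dots> = (\<Prod>W\<in>H - K. f W) * (\<Sum>V\<in>K. cconst (l V) * pdiff i (f V) * (\<Prod>W\<in>K - {V}. f W))"
    by (simp add: sum_distrib_left)
  finally show ?thesis
    using i assms(1,4) by (intro exI[of _ i]) auto
qed

lemma wedge_d_quotient_eq_0_iff:
  fixes P Q :: "'k::{finite,linorder} cpoly"
  assumes "Q \<noteq> 0"
  shows "wedge11 (\<lambda>l. Fract (\<omega> l) 1) (d_quotient P Q) i j = 0 \<longleftrightarrow>
    \<omega> i * (Q * pdiff j P - P * pdiff j Q) = \<omega> j * (Q * pdiff i P - P * pdiff i Q)"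
proof -
  have "wedge11 (\<lambda>l. Fract (\<omega> l) 1) (d_quotient P Q) i j = 0 \<longleftrightarrow>
      Fract (\<omega> i * (Q * pdiff j P - P * pdiff j Q)) (Q ^ 2) =
      Fract (\<omega> j * (Q * pdiff i P - P * pdiff i Q)) (Q ^ 2)"
    by (simp only: wedge11_def d_quotient_def right_minus_eq mult_fract mult_1_left)
  also have "\<dots> \<longleftrightarrow> \<omega> i * (Q * pdiff j P - P * pdiff j Q) = \<omega> j * (Q * pdiff i P - P * pdiff i Q)"
    using assms by (simp add: eq_fract del: mult_cancel_left)
  finally show ?thesis .
qed

text \<open>
  Two closed forms \<open>A / p\<close> and \<open>B / p\<close> proportional to \<open>\<omega>\<close>: differentiating
  \<open>A / p = (P / Q) B / p\<close> gives \<open>d (P / Q) \<and> B = 0\<close>, hence \<open>d (P / Q) \<and> \<omega> = 0\<close>.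
\<close>

lemma quotient_of_closed_forms:
  fixes A B \<omega> :: "'k::{finite,linorder} \<Rightarrow> 'k cpoly"
  assumes "p \<noteq> 0" "\<omega> s \<noteq> 0" "B s \<noteq> 0"
    and A: "\<And>i j. \<omega> i * A j = \<omega> j * A i" and B: "\<And>i j. \<omega> i * B j = \<omega> j * B i"
    and cA: "\<And>i j. p * (pdiff i (A j) - pdiff j (A i)) = A j * pdiff i p - A i * pdiff j p"
    and cB: "\<And>i j. p * (pdiff i (B j) - pdiff j (B i)) = B j * pdiff i p - B i * pdiff j p"
  shows "\<omega> i * (B s * pdiff j (A s) - A s * pdiff j (B s)) =
    \<omega> j * (B s * pdiff i (A s) - A s * pdiff i (B s))"
proof -
  define P Q where "P = A s" and "Q = B s"
  have Q: "Q \<noteq> 0" using assms(3) by (simp add: Q_def)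
  have proportional: "Q * A j = P * B j" for j
  proof -
    have "\<omega> s * (Q * A j) = Q * (\<omega> s * A j)" by (simp add: mult_ac)
    also have "\<dots> = P * (\<omega> j * B s)" unfolding A[of s j] by (simp add: P_def Q_def mult_ac)
    also have "\<dots> = \<omega> s * (P * B j)" unfolding B[of j s] by (simp add: mult_ac)
    finally show ?thesis using assms(2) by simp
  qed
  have dprop: "pdiff i Q * A j + Q * pdiff i (A j) = pdiff i P * B j + P * pdiff i (B j)" for i j
    using arg_cong[OF proportional[of j], of "pdiff i"] by (simp add: pdiff_mult)
  \<comment> \<open>Antisymmetrised derivative of Q A = P B. Closedness turns the derivatives of A
    and B into multiples of P B - Q A, which is zero.\<close>
  have "p * (pdiff i Q * A j - pdiff j Q * A i - (pdiff i P * B j - pdiff j P * B i)) =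
      p * ((P * pdiff i (B j) - Q * pdiff i (A j)) - (P * pdiff j (B i) - Q * pdiff j (A i)))"
  proof -
    have e: "pdiff i Q * A j - pdiff i P * B j = P * pdiff i (B j) - Q * pdiff i (A j)"
      "pdiff j Q * A i - pdiff j P * B i = P * pdiff j (B i) - Q * pdiff j (A i)"
      using dprop[of i j] dprop[of j i] by (simp_all add: algebra_simps)
    have "pdiff i Q * A j - pdiff j Q * A i - (pdiff i P * B j - pdiff j P * B i) =
        (pdiff i Q * A j - pdiff i P * B j) - (pdiff j Q * A i - pdiff j P * B i)"
      by (simp add: algebra_simps)
    then show ?thesis by (simp only: e)
  qed
  also have "\<dots> = P * (p * (pdiff i (B j) - pdiff j (B i))) - Q * (p * (pdiff i (A j) - pdiff j (A i)))"
    by (simp add: algebra_simps)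
  also have "\<dots> = (P * B j - Q * A j) * pdiff i p - (P * B i - Q * A i) * pdiff j p"
    unfolding cA cB by (simp add: algebra_simps)
  also have "\<dots> = 0" by (simp add: proportional)
  finally have "pdiff i Q * A j - pdiff j Q * A i = pdiff i P * B j - pdiff j P * B i"
    using assms(1) by simp
  \<comment> \<open>The factor Q allows \<open>Q * A\<close> to be replaced by \<open>P * B\<close>,
    which gives d(P / Q) \<and> B = 0.\<close>
  from arg_cong[OF this, of "(*) Q"]
  have "pdiff i Q * (Q * A j) - pdiff j Q * (Q * A i) = Q * (pdiff i P * B j - pdiff j P * B i)"
    by (simp only: right_diff_distrib mult.left_commute)
  then have "(Q * pdiff j P - P * pdiff j Q) * B i = (Q * pdiff i P - P * pdiff i Q) * B j"
    unfolding proportional by (simp add: algebra_simps)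
  \<comment> \<open>With the factor \<open>\<omega> s\<close>, proportionality exchanges B for
    \<omega>.\<close>
  then have "\<omega> s * ((Q * pdiff j P - P * pdiff j Q) * B i) = \<omega> s * ((Q * pdiff i P - P * pdiff i Q) * B j)"
    by simp
  then have "(Q * pdiff j P - P * pdiff j Q) * (\<omega> s * B i) = (Q * pdiff i P - P * pdiff i Q) * (\<omega> s * B j)"
    by (simp add: mult_ac)
  then have "(Q * pdiff j P - P * pdiff j Q) * (\<omega> i * Q) = (Q * pdiff i P - P * pdiff i Q) * (\<omega> j * Q)"
    unfolding B[of s] by (simp add: Q_def)
  then have "Q * (\<omega> i * (Q * pdiff j P - P * pdiff j Q)) = Q * (\<omega> j * (Q * pdiff i P - P * pdiff i Q))"
    by (simp only: mult_ac)
  then show ?thesis using Q by (simp add: P_def Q_def)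
qed

text \<open>One equation for each pair i < j and each monomial of class \<open>C i j\<close>, one
  unknown for each hypersurface. Antisymmetry settles the other pairs.\<close>

lemma exists_form_relation:
  fixes \<nu> :: "'k::{finite,linorder} \<Rightarrow> int ^ 'n" and q :: "'v \<Rightarrow> 'k \<Rightarrow> 'k \<Rightarrow> 'k cpoly"
  assumes fan: "fan \<Delta>" "complete_fan \<Delta>" "simplicial_fan \<Delta>" "ray_generators \<Delta> \<nu>"
    and "finite H" "(\<Sum>(i, j)\<in>{(i, j). i < j}. hdim \<nu> (C i j)) < card H"
    and graded: "\<And>V i j. V \<in> H \<Longrightarrow> q V i j \<in> graded_part \<nu> (C i j)"
    and anti: "\<And>V i j. V \<in> H \<Longrightarrow> q V j i = - q V i j"
  shows "\<exists>l. (\<exists>V\<in>H. l V \<noteq> 0) \<and> (\<forall>i j. (\<Sum>V\<in>H. cconst (l V) * q V i j) = 0)"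
proof -
  define M where "M i j = {m. div_class \<nu> (expo m) = C i j}" for i j
  define I where "I = (SIGMA ij:{(i, j). i < j}. M (fst ij) (snd ij))"
  have fin: "finite (M i j)" for i j
    unfolding M_def by (rule finite_graded_monomials[OF fan])
  then have "finite I" unfolding I_def by (intro finite_SigmaI) auto
  moreover have "card I = (\<Sum>ij\<in>{(i, j). i < j}. card (M (fst ij) (snd ij)))"
    unfolding I_def using fin by (intro card_SigmaI) auto
  then have "card I < card H"
    using assms(6) by (simp add: M_def hdim_eq_card split_def)
  ultimately obtain l where l: "\<exists>V\<in>H. l V \<noteq> 0"
    "\<forall>x\<in>I. (\<Sum>V\<in>H. l V * Poly_Mapping.lookup (q V (fst (fst x)) (snd (fst x))) (snd x)) = 0"
    using exists_linear_relation[of I H "\<lambda>V x. Poly_Mapping.lookup (q V (fst (fst x)) (snd (fst x))) (snd x)"]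
      assms(5) by blast
  have lt: "(\<Sum>V\<in>H. cconst (l V) * q V i j) = 0" if "i < j" for i j
  proof (rule poly_mapping_eqI)
    fix m
    have "(\<Sum>V\<in>H. l V * Poly_Mapping.lookup (q V i j) m) = 0"
    proof (cases "m \<in> M i j")
      case True
      with that have "((i, j), m) \<in> I" by (simp add: I_def)
      with l(2) show ?thesis by force
    next
      case False
      then have "Poly_Mapping.lookup (q V i j) m = 0" if "V \<in> H" for V
        using graded[OF that, of i j] by (auto simp: M_def graded_part_iff in_keys_iff)
      then show ?thesis by simp
    qed
    then show "Poly_Mapping.lookup (\<Sum>V\<in>H. cconst (l V) * q V i j) m = Poly_Mapping.lookup 0 m"
      by (simp add: lookup_sum lookup_cconst_mult)
  qed
  have "(\<Sum>V\<in>H. cconst (l V) * q V i j) = 0" for i j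
  proof -
    have swap: "(\<Sum>V\<in>H. cconst (l V) * q V i j) = - (\<Sum>V\<in>H. cconst (l V) * q V j i)" for i j
      unfolding sum_negf[symmetric]
    proof (rule sum.cong[OF refl])
      show "cconst (l V) * q V i j = - (cconst (l V) * q V j i)" if "V \<in> H" for V
        unfolding anti[OF that, of i j] by simp
    qed
    \<comment> \<open>Diagonal entries equal their own negatives; evaluation reduces this to complex
      numbers.\<close>
    have "p = 0" if "p = - p" for p :: "'k cpoly"
    proof (rule eval_poly_eq_0_imp)
      fix z
      have "eval_poly p z = - eval_poly p z" using arg_cong[OF that, of "\<lambda>p. eval_poly p z"] by simp
      then show "eval_poly p z = 0" by simp
    qed
    note self = this[OF swap[of i i]]
    show ?thesis
    proof (cases i j rule: linorder_cases)
      case greater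
      then show ?thesis unfolding swap[of i j] by (simp add: lt)
    qed (use lt self in auto)
  qed
  with l(1) show ?thesis by blast
qed

theorem first_integral_of_hypersurfaces:
  fixes \<Delta> :: "(real ^ 'n) set set" and \<nu> :: "'k::{finite,linorder} \<Rightarrow> int ^ 'n"
  assumes fan: "fan \<Delta>" "complete_fan \<Delta>" "simplicial_fan \<Delta>" "ray_generators \<Delta> \<nu>"
    and dist: "distribution \<Delta> \<nu> d \<omega>"
    and H: "H \<subseteq> invariant_irreducible_hypersurfaces \<Delta> \<nu> \<omega>"
      "card H = 2 + (\<Sum>(i, j) \<in> {(i, j). i < j}.
        hdim \<nu> (class_minus \<nu> (class_minus \<nu> (div_class \<nu> d) (deg_var \<nu> i)) (deg_var \<nu> j)))"
  shows "\<exists>F. rational_first_integral \<nu> \<omega> F"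
proof -
  define C where "C i j = class_minus \<nu> (class_minus \<nu> (div_class \<nu> d) (deg_var \<nu> i)) (deg_var \<nu> j)" for i j
  have C: "C i j = div_class \<nu> (\<lambda>x. d x - unit_div i x - unit_div j x)" for i j
    by (simp add: C_def deg_var_eq class_minus_div_class)
  have \<omega>: "\<omega> i \<in> graded \<nu> (\<lambda>x. d x - unit_div i x)" for i
    using dist by (simp add: distribution_def deg_var_eq class_minus_div_class)
  obtain s where s: "\<omega> s \<noteq> 0" using dist by (auto simp: distribution_def)
  have fin: "finite H" using H(2) by (intro card_ge_0_finite) simp
  have "\<exists>f a q. f \<in> graded \<nu> a \<and> f \<noteq> 0 \<and> V = hypersurface \<Delta> \<nu> f \<and> irreducible_closed \<Delta> \<nu> V \<and>
      (\<forall>i j. wedge11 \<omega> (d0 f) i j = f * q i j)" if "V \<in> H" for V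
  proof -
    obtain \<alpha> f where f: "\<alpha> \<in> carrier (class_group \<nu>)" "f \<in> graded_part \<nu> \<alpha>" "f \<noteq> 0"
      "V = hypersurface \<Delta> \<nu> f" "irreducible_closed \<Delta> \<nu> V" "invariant_equation \<Delta> \<nu> \<omega> f"
      using H(1) \<open>V \<in> H\<close> unfolding invariant_irreducible_hypersurfaces_def by blast
    obtain a where "\<alpha> = div_class \<nu> a" using f(1) by (auto simp: carrier_class_group)
    with f invariant_equation_quotient[OF fan(1,4) f(3,6)] show ?thesis by blast
  qed
  then obtain f a q where f: "\<And>V. V \<in> H \<Longrightarrow> f V \<in> graded \<nu> (a V)" "\<And>V. V \<in> H \<Longrightarrow> f V \<noteq> 0"
    "\<And>V. V \<in> H \<Longrightarrow> V = hypersurface \<Delta> \<nu> (f V)" "\<And>V. V \<in> H \<Longrightarrow> irreducible_closed \<Delta> \<nu> V"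
    "\<And>V i j. V \<in> H \<Longrightarrow> wedge11 \<omega> (d0 (f V)) i j = f V * q V i j"
    by metis
  have q: "q V i j \<in> graded_part \<nu> (C i j)" if V: "V \<in> H" for V i j
  proof -
    \<comment> \<open>The common degree of both terms of the wedge; removing the degree of
      \<open>f V\<close> leaves the class \<open>C i j\<close>.\<close>
    define E where "E x = d x - unit_div i x - unit_div j x + a V x" for x
    have "\<omega> i * pdiff j (f V) \<in> graded \<nu> (\<lambda>x. (\<lambda>x. d x - unit_div i x) x + (\<lambda>x. a V x - unit_div j x) x)"
      "\<omega> j * pdiff i (f V) \<in> graded \<nu> (\<lambda>x. (\<lambda>x. d x - unit_div j x) x + (\<lambda>x. a V x - unit_div i x) x)"
      by (intro graded_mult \<omega> graded_pdiff f(1) V)+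
    moreover have "(\<lambda>x. (\<lambda>x. d x - unit_div i x) x + (\<lambda>x. a V x - unit_div j x) x) = E"
      "(\<lambda>x. (\<lambda>x. d x - unit_div j x) x + (\<lambda>x. a V x - unit_div i x) x) = E"
      by (simp_all add: E_def fun_eq_iff)
    ultimately have "\<omega> i * pdiff j (f V) - \<omega> j * pdiff i (f V) \<in> graded \<nu> E"
      by (intro graded_part_diff) simp_all
    then have "f V * q V i j \<in> graded \<nu> (\<lambda>x. d x - unit_div i x - unit_div j x + a V x)"
      unfolding f(5)[OF V, of i j, symmetric] by (simp add: wedge11_def d0_def E_def[abs_def])
    from graded_quotient[OF f(1)[OF V] f(2)[OF V] this] show ?thesis by (simp add: C)
  qed
  have anti: "q V j i = - q V i j" if V: "V \<in> H" for V i j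
  proof -
    have "f V * q V j i = - (f V * q V i j)"
      unfolding f(5)[OF V, symmetric] by (simp add: wedge11_def)
    then have "f V * q V j i = f V * (- q V i j)" by simp
    then show ?thesis using f(2)[OF V] by (simp only: mult_cancel_left) simp
  qed
  define h where "h = (\<Sum>(i, j)\<in>{(i, j). i < j}. hdim \<nu> (C i j))"
  have card: "card H = 2 + h" using H(2) by (simp add: h_def C_def)
  \<comment> \<open>The first of the two additional hypersurfaces secures a relation, the second the
    freedom to give W the coefficient zero.\<close>
  have rel: "\<exists>l. (\<exists>V\<in>H - {W}. l V \<noteq> 0) \<and> l W = 0 \<and> (\<forall>i j. (\<Sum>V\<in>H. cconst (l V) * q V i j) = 0)"
    if W: "W \<in> H" for W
  proof -
    have "h < card (H - {W})" using card fin W by simp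
    then have "\<exists>l. (\<exists>V\<in>H - {W}. l V \<noteq> 0) \<and> (\<forall>i j. (\<Sum>V\<in>H - {W}. cconst (l V) * q V i j) = 0)"
      unfolding h_def using fin q anti by (intro exists_form_relation[OF fan, of "H - {W}" C q]) blast+
    then obtain l where l: "\<exists>V\<in>H - {W}. l V \<noteq> 0" "\<And>i j. (\<Sum>V\<in>H - {W}. cconst (l V) * q V i j) = 0"
      by blast
    then show ?thesis
      using fin W by (intro exI[of _ "l(W := 0)"]) (auto simp: sum.remove[of H W])
  qed
  \<comment> \<open>\<open>W0\<close> is arbitrary. The W found next has a nonzero coefficient in
    the first relation, and the second relation is made to vanish there.\<close>
  obtain W0 where "W0 \<in> H" using card fin by fastforce
  from rel[OF this] obtain l W where l: "W \<in> H" "l W \<noteq> 0" "\<And>i j. (\<Sum>V\<in>H. cconst (l V) * q V i j) = 0"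
    by blast
  from rel[OF l(1)] obtain k where k: "\<exists>V\<in>H. k V \<noteq> 0" "k W = 0" "\<And>i j. (\<Sum>V\<in>H. cconst (k V) * q V i j) = 0"
    by blast
  define A B where "A = logsum f H l" and "B = logsum f H k"
  have proportional: "\<omega> i * logsum f H t j = \<omega> j * logsum f H t i"
    if "\<And>i j. (\<Sum>V\<in>H. cconst (t V) * q V i j) = 0" for t i j
    using logsum_wedge[where f = f and q = q and \<omega> = \<omega> and i = i and j = j and l = t, OF fin] f(5) that
    by simp
  \<comment> \<open>Proportionality to \<omega> with \<open>\<omega> s\<close> nonzero means that
    the s-component vanishes only together with the whole form. So \<open>A s / B s\<close> is the
    ratio of the two forms.\<close>
  have nz: "logsum f H t s \<noteq> 0"
    if "\<And>i j. (\<Sum>V\<in>H. cconst (t V) * q V i j) = 0" "\<exists>V\<in>H. t V \<noteq> 0" for t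
  proof
    assume "logsum f H t s = 0"
    then have "\<omega> s * logsum f H t j = 0" for j
      using proportional[OF that(1), of s j] by simp
    then have "logsum f H t j = 0" for j using s by simp
    with logsum_nonzero[OF fin f(4,3,2) that(2)] show False by blast
  qed
  have B: "B s \<noteq> 0" unfolding B_def by (rule nz[OF k(3,1)])
  \<comment> \<open>A constant ratio c would make l - c k a nontrivial relation whose form has zero
    s-component.\<close>
  have "Fract (A s) (B s) \<noteq> Fract (cconst c) 1" for c
  proof
    assume "Fract (A s) (B s) = Fract (cconst c) 1"
    then have AB: "A s = cconst c * B s" using B by (simp add: eq_fract)
    define t where "t V = l V - c * k V" for V
    have "(\<Sum>V\<in>H. cconst (t V) * q V i j) = 0" for i j
    proof -
      have "(\<Sum>V\<in>H. cconst (t V) * q V i j) =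
          (\<Sum>V\<in>H. cconst (l V) * q V i j) - cconst c * (\<Sum>V\<in>H. cconst (k V) * q V i j)"
        by (simp add: t_def algebra_simps sum_subtractf sum_distrib_left)
      then show ?thesis by (simp add: l(3) k(3))
    qed
    moreover have "t W \<noteq> 0" using l(2) k(2) by (simp add: t_def)
    ultimately have "logsum f H t s \<noteq> 0" using nz l(1) by blast
    moreover have "logsum f H t s = A s - cconst c * B s"
      by (simp add: A_def B_def logsum_def t_def algebra_simps sum_subtractf sum_distrib_left)
    ultimately show False using AB by simp
  qed
  moreover have "wedge11 (\<lambda>l. Fract (\<omega> l) 1) (d_quotient (A s) (B s)) i j = 0" for i j
    unfolding wedge_d_quotient_eq_0_iff[OF B]
  proof (rule quotient_of_closed_forms[where p = "\<Prod>V\<in>H. f V" and A = A and B = B and \<omega> = \<omega> and s = s, OF _ s B])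
    show "(\<Prod>V\<in>H. f V) \<noteq> 0" using f(2) fin by simp
  qed (unfold A_def B_def, (rule proportional[OF l(3)] proportional[OF k(3)] logsum_closed[OF fin])+)
  moreover have "A s \<in> graded \<nu> (\<lambda>x. (\<Sum>V\<in>H. a V x) - unit_div s x)"
    "B s \<in> graded \<nu> (\<lambda>x. (\<Sum>V\<in>H. a V x) - unit_div s x)"
    unfolding A_def B_def by (intro logsum_graded fin f(1); assumption)+
  moreover have "div_class \<nu> (\<lambda>x. (\<Sum>V\<in>H. a V x) - unit_div s x) \<in> carrier (class_group \<nu>)"
    by (simp add: carrier_class_group)
  ultimately show ?thesis
    unfolding rational_first_integral_def using B by blast
qed

section \<open>From a first integral to invariant hypersurfaces\<close>

lemma eval_poly_holomorphic: "holomorphic_several (eval_poly p) U"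
proof -
  have "\<exists>h'. (eval_poly p has_derivative h') (at z) \<and> (\<forall>c v. h' (c *s v) = c * h' v)" for z
  proof (induction p rule: cpoly_algebra_induct)
    case (const a)
    show ?case by (intro exI[of _ "\<lambda>v. 0"]) simp
  next
    case (var i)
    have "((\<lambda>z. z $ i) has_derivative (\<lambda>v. v $ i)) (at z)"
      by (rule bounded_linear.has_derivative[OF bounded_linear_vec_nth has_derivative_ident])
    then show ?case by (intro exI[of _ "\<lambda>v. v $ i"]) simp
  next
    case (add p q)
    then obtain p' q' where "(eval_poly p has_derivative p') (at z)" "\<forall>c v. p' (c *s v) = c * p' v"
      "(eval_poly q has_derivative q') (at z)" "\<forall>c v. q' (c *s v) = c * q' v" by blast
    then show ?case
      by (intro exI[of _ "\<lambda>v. p' v + q' v"]) (auto intro!: has_derivative_add simp: algebra_simps)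
  next
    case (mult p q)
    then obtain p' q' where "(eval_poly p has_derivative p') (at z)" "\<forall>c v. p' (c *s v) = c * p' v"
      "(eval_poly q has_derivative q') (at z)" "\<forall>c v. q' (c *s v) = c * q' v" by blast
    note D = this
    have "((\<lambda>y. eval_poly p y * eval_poly q y) has_derivative
        (\<lambda>v. eval_poly p z * q' v + p' v * eval_poly q z)) (at z)"
      by (rule has_derivative_mult[OF D(1,3)])
    moreover have "eval_poly (p * q) = (\<lambda>y. eval_poly p y * eval_poly q y)"
      by (simp add: fun_eq_iff)
    ultimately show ?case
      using D(2,4)
      by (intro exI[of _ "\<lambda>v. eval_poly p z * q' v + p' v * eval_poly q z"])
        (simp add: distrib_left mult.left_commute)
  qed
  then show ?thesis by (simp add: holomorphic_several_def)
qed

lemma wedge11_antisym: "wedge11 \<omega> \<eta> j i = - wedge11 \<omega> \<eta> i j"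
  by (simp add: wedge11_def)

text \<open>Cancelling h makes the polynomial quotient antisymmetric at every point, also on the
  irrelevant locus, as \<Theta> has to be.\<close>

lemma invariant_equation_if_dvd:
  fixes h :: "'k::{finite,linorder} cpoly"
  assumes "h \<noteq> 0" "\<And>i j. h dvd wedge11 \<omega> (d0 h) i j"
  shows "invariant_equation \<Delta> \<nu> \<omega> h"
proof -
  obtain q where q: "\<And>i j. wedge11 \<omega> (d0 h) i j = h * q i j"
    using assms(2) unfolding dvd_def by metis
  have anti: "q i j = - q j i" for i j
  proof -
    have "h * q i j = - (h * q j i)"
      unfolding q[symmetric] by (rule wedge11_antisym)
    then have "h * q i j = h * (- q j i)" by simp
    with assms(1) show ?thesis by (simp only: mult_cancel_left) simp
  qed
  have eval: "eval_poly (q i j) z = - eval_poly (q j i) z" for i j z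
    using arg_cong[OF anti[of i j], of "\<lambda>p. eval_poly p z"] by simp
  show ?thesis
    unfolding invariant_equation_def
  proof (intro exI[of _ "\<lambda>i j. eval_poly (q i j)"] conjI allI ballI)
    show "eval_poly (q i j) z = - eval_poly (q j i) z" for i j z by (rule eval)
  qed (simp_all add: eval_poly_holomorphic q)
qed

section \<open>Homogeneous primes\<close>

lemma dvd_1_iff_tdeg:
  fixes p :: "'k::{finite,linorder} cpoly"
  shows "p dvd 1 \<longleftrightarrow> p \<noteq> 0 \<and> tdeg p = 0"
proof
  assume "p dvd 1"
  then obtain u where u: "1 = p * u" by (elim dvdE)
  then have "p \<noteq> 0" "u \<noteq> 0" by auto
  then have "tdeg (1 :: 'k cpoly) = tdeg p + tdeg u"
    by (subst u) (rule tdeg_mult)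
  moreover have "tdeg (1 :: 'k cpoly) = 0"
    using tdeg_cconst[where 'a = 'k, of 1] by simp
  ultimately show "p \<noteq> 0 \<and> tdeg p = 0" using \<open>p \<noteq> 0\<close> by linarith
next
  assume p: "p \<noteq> 0 \<and> tdeg p = 0"
  then obtain c where c: "p = cconst c" using tdeg_eq_0_imp by blast
  with p have "c \<noteq> 0" by auto
  then have "1 = p * cconst (1 / c)" by (simp add: c flip: cconst_simps(4))
  then show "p dvd 1" by (rule dvdI)
qed

lemma tdeg_dvd_le:
  fixes p q :: "'k::{finite,linorder} cpoly"
  assumes "p dvd q" "q \<noteq> 0"
  shows "tdeg p \<le> tdeg q"
  using assms by (auto simp: dvd_def tdeg_mult)

text \<open>Euclid's lemma: the second property of the greatest common divisor g replaces h by g,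
  and g is a unit here. The factor q may be inhomogeneous.\<close>

lemma dvd_of_coprime:
  fixes f h q :: "'k::{finite,linorder} cpoly"
  assumes "f \<noteq> 0" "f \<in> graded \<nu> a" "h \<in> graded \<nu> b"
    and "\<And>g. g dvd f \<Longrightarrow> g dvd h \<Longrightarrow> g dvd 1" and "f dvd h * q"
  shows "f dvd q"
proof -
  obtain g where g: "g dvd f" "g dvd h" "\<And>q. f dvd h * q \<Longrightarrow> f dvd g * q"
    using exists_graded_gcd[OF assms(1-3)] by blast
  have "g dvd 1" using assms(4) g by blast
  then have "g * q dvd 1 * q" by (rule mult_dvd_mono) simp
  then have "g * q dvd q" by (simp only: mult_1_left)
  with g(3)[OF assms(5)] show ?thesis by (rule dvd_trans)
qed

text \<open>Only one of the two factors has to be homogeneous. If the class group has torsion, such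
  an h may still split into inhomogeneous polynomials.\<close>

definition graded_prime :: "('k \<Rightarrow> int ^ 'n) \<Rightarrow> 'k::{finite,linorder} cpoly \<Rightarrow> bool" where
  "graded_prime \<nu> h \<longleftrightarrow> h \<noteq> 0 \<and> \<not> h dvd 1 \<and> (\<exists>a. h \<in> graded \<nu> a) \<and>
     (\<forall>u b q. u \<in> graded \<nu> b \<longrightarrow> h dvd u * q \<longrightarrow> h dvd u \<or> h dvd q)"

text \<open>A nonunit homogeneous divisor h of least degree works: its greatest common divisor with
  a homogeneous u is homogeneous, hence a unit, where Euclid's lemma applies, or associated to
  h.\<close>

lemma exists_graded_prime_divisor:
  fixes f :: "'k::{finite,linorder} cpoly"
  assumes "f \<in> graded \<nu> a" "f \<noteq> 0" "\<not> f dvd 1"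
  shows "\<exists>h. graded_prime \<nu> h \<and> h dvd f"
proof -
  define P where "P h \<longleftrightarrow> (\<exists>a. h \<in> graded \<nu> a) \<and> h dvd f \<and> \<not> h dvd 1" for h
  define h where "h = arg_min tdeg P"
  have "P f" using assms by (auto simp: P_def)
  then have h: "P h" and min: "\<And>g. P g \<Longrightarrow> tdeg h \<le> tdeg g"
    using arg_min_natI[of P f tdeg] arg_min_nat_le[of P _ tdeg] by (auto simp: h_def)
  have nz: "h \<noteq> 0" using h assms(2) by (auto simp: P_def)
  obtain e where e: "h \<in> graded \<nu> e" using h by (auto simp: P_def)
  have "h dvd u \<or> h dvd q" if u: "u \<in> graded \<nu> b" "h dvd u * q" for u b q
  proof -
    obtain g c where g: "g \<in> graded \<nu> c" "g dvd h" "g dvd u" "\<And>q. q dvd h \<and> q dvd u \<Longrightarrow> q dvd g"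
      using exists_graded_gcd[OF nz e u(1)] by blast
    show ?thesis
    proof (cases "g dvd 1")
      case True
      then have "\<And>q. q dvd h \<Longrightarrow> q dvd u \<Longrightarrow> q dvd 1" using g(4) dvd_trans by blast
      from dvd_of_coprime[OF nz e u(1) this u(2)] show ?thesis by simp
    next
      case False
      have "P g" using g(1,2) False h unfolding P_def by (auto intro: dvd_trans)
      obtain w where w: "h = g * w" using g(2) by (elim dvdE)
      have nz': "g \<noteq> 0" "w \<noteq> 0" using nz w by auto
      then have "tdeg w = 0" using min[OF \<open>P g\<close>] tdeg_mult[of g w] w by simp
      then have "w dvd 1" using nz' by (simp add: dvd_1_iff_tdeg)
      then have "g * w dvd g * 1" by (intro mult_dvd_mono) simp_all
      then have "h dvd g" unfolding w by (simp only: mult_1_right)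
      then have "h dvd u" using g(3) by (rule dvd_trans)
      then show ?thesis by simp
    qed
  qed
  with nz h e have "graded_prime \<nu> h" unfolding graded_prime_def P_def by blast
  moreover have "h dvd f" using h by (simp add: P_def)
  ultimately show ?thesis by blast
qed

lemma graded_prime_power:
  assumes "graded_prime \<nu> h" "u \<in> graded \<nu> b" "h dvd u ^ n"
  shows "h dvd u"
  using assms(3)
proof (induction n)
  case 0
  then show ?case using assms(1) by (simp add: graded_prime_def)
next
  case (Suc n)
  then have "h dvd u * u ^ n" by simp
  then have "h dvd u \<or> h dvd u ^ n"
    using assms(1,2) unfolding graded_prime_def by blast
  with Suc.IH show ?case by blast
qed

lemma graded_prime_dvd_if_vanishes:
  fixes \<nu> :: "'k::{finite,linorder} \<Rightarrow> int ^ 'n"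
  assumes "fan \<Delta>" "ray_generators \<Delta> \<nu>" "graded_prime \<nu> h" "u \<in> graded \<nu> b"
    and "\<And>z. z \<notin> irrelevant_locus \<Delta> \<nu> \<Longrightarrow> eval_poly h z = 0 \<Longrightarrow> eval_poly u z = 0"
  shows "h dvd u"
proof -
  have "h \<noteq> 0" using assms(3) by (simp add: graded_prime_def)
  from nullstellensatz_hypersurface[OF assms(1,2) this assms(5)] show ?thesis
    by (rule graded_prime_power[OF assms(3,4)])
qed

lemma cconst_of_nat: "cconst (of_nat n) = of_nat n"
  by (induction n) simp_all

text \<open>Closed sets are given by arbitrary polynomials. Since W consists of whole orbits, the
  homogeneous components of such a polynomial vanish on it as well, and one of them is nonzero at
  z.\<close>

lemma closed_separating_form:
  fixes \<nu> :: "'k::finite \<Rightarrow> int ^ 'n"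
  assumes "zariski_closed \<Delta> \<nu> W" "z \<notin> irrelevant_locus \<Delta> \<nu>" "orbit \<nu> z \<notin> W"
  shows "\<exists>p a. p \<in> graded \<nu> a \<and> eval_poly p z \<noteq> 0 \<and>
    (\<forall>y. y \<notin> irrelevant_locus \<Delta> \<nu> \<longrightarrow> orbit \<nu> y \<in> W \<longrightarrow> eval_poly p y = 0)"
proof -
  obtain I where I: "\<And>z. z \<notin> irrelevant_locus \<Delta> \<nu> \<Longrightarrow> orbit \<nu> z \<in> W \<longleftrightarrow> (\<forall>p\<in>I. eval_poly p z = 0)"
    using zariski_closedE[OF assms(1)] by blast
  then obtain p where p: "p \<in> I" "eval_poly p z \<noteq> 0" using assms(2,3) by blast
  have comp: "eval_poly (component \<nu> C p) y = 0"
    if y: "y \<notin> irrelevant_locus \<Delta> \<nu>" "orbit \<nu> y \<in> W" for C y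
  proof (rule component_vanishes)
    fix t assume t: "t \<in> torus \<nu>"
    have "tact t y \<notin> irrelevant_locus \<Delta> \<nu>" "orbit \<nu> (tact t y) \<in> W"
      using y t by (simp_all add: tact_irrelevant orbit_tact)
    then show "eval_poly p (tact t y) = 0" using I p(1) by blast
  qed
  have "\<exists>C\<in>(\<lambda>m. div_class \<nu> (expo m)) ` Poly_Mapping.keys p. eval_poly (component \<nu> C p) z \<noteq> 0"
  proof (rule ccontr)
    assume "\<not> ?thesis"
    then have "(\<Sum>C\<in>(\<lambda>m. div_class \<nu> (expo m)) ` Poly_Mapping.keys p. eval_poly (component \<nu> C p) z) = 0"
      by (intro sum.neutral) blast
    with p(2) show False using eval_poly_eq_sum_component[of p z \<nu>] by simp
  qed
  then obtain m where m: "eval_poly (component \<nu> (div_class \<nu> (expo m)) p) z \<noteq> 0" by blast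
  show ?thesis
    by (intro exI[of _ "component \<nu> (div_class \<nu> (expo m)) p"] exI[of _ "expo m"] conjI)
      (use m comp component_graded in auto)
qed

text \<open>Were V a union of two proper closed subsets, homogeneous p and q would vanish on one
  each but not on V. Their product vanishes on V, so h would divide p or q.\<close>

lemma graded_prime_irreducible:
  fixes \<nu> :: "'k::{finite,linorder} \<Rightarrow> int ^ 'n"
  assumes "fan \<Delta>" "ray_generators \<Delta> \<nu>" and h: "graded_prime \<nu> h"
  shows "irreducible_closed \<Delta> \<nu> (hypersurface \<Delta> \<nu> h)"
proof -
  obtain a where a: "h \<in> graded \<nu> a" using h by (auto simp: graded_prime_def)
  define V where "V = hypersurface \<Delta> \<nu> h"
  have mem: "orbit \<nu> z \<in> V \<longleftrightarrow> eval_poly h z = 0" if "z \<notin> irrelevant_locus \<Delta> \<nu>" for z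
    unfolding V_def by (rule orbit_in_hypersurface_iff[OF a that])
  \<comment> \<open>If V were empty, the constant 1 would vacuously vanish on it and h would divide
    1.\<close>
  have "V \<noteq> {}"
  proof
    assume "V = {}"
    then have "h dvd 1"
      using mem by (intro graded_prime_dvd_if_vanishes[OF assms graded_1]) blast
    with h show False by (simp add: graded_prime_def)
  qed
  moreover have "W1 = V \<or> W2 = V"
    if W: "zariski_closed \<Delta> \<nu> W1" "zariski_closed \<Delta> \<nu> W2" "V = W1 \<union> W2" for W1 W2
  proof (rule ccontr)
    assume "\<not> (W1 = V \<or> W2 = V)"
    then obtain x1 x2 where x: "x1 \<in> V" "x1 \<notin> W1" "x2 \<in> V" "x2 \<notin> W2" using W(3) by blast
    obtain z1 where z1: "x1 = orbit \<nu> z1" "z1 \<notin> irrelevant_locus \<Delta> \<nu>" "eval_poly h z1 = 0"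
      using x(1) by (auto simp: V_def hypersurface_def)
    obtain z2 where z2: "x2 = orbit \<nu> z2" "z2 \<notin> irrelevant_locus \<Delta> \<nu>" "eval_poly h z2 = 0"
      using x(3) by (auto simp: V_def hypersurface_def)
    obtain p b where p: "p \<in> graded \<nu> b" "eval_poly p z1 \<noteq> 0"
      "\<And>y. y \<notin> irrelevant_locus \<Delta> \<nu> \<Longrightarrow> orbit \<nu> y \<in> W1 \<Longrightarrow> eval_poly p y = 0"
      using closed_separating_form[OF W(1) z1(2)] x(2) z1(1) by blast
    obtain q c where q: "q \<in> graded \<nu> c" "eval_poly q z2 \<noteq> 0"
      "\<And>y. y \<notin> irrelevant_locus \<Delta> \<nu> \<Longrightarrow> orbit \<nu> y \<in> W2 \<Longrightarrow> eval_poly q y = 0"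
      using closed_separating_form[OF W(2) z2(2)] x(4) z2(1) by blast
    have "eval_poly (p * q) z = 0" if z: "z \<notin> irrelevant_locus \<Delta> \<nu>" "eval_poly h z = 0" for z
    proof -
      have "orbit \<nu> z \<in> W1 \<union> W2" using mem[OF z(1)] z(2) W(3) by blast
      then show ?thesis using p(3)[OF z(1)] q(3)[OF z(1)] by auto
    qed
    then have "h dvd p * q"
      by (intro graded_prime_dvd_if_vanishes[OF assms graded_mult[OF p(1) q(1)]]) blast+
    then have "h dvd p \<or> h dvd q"
      using h p(1) unfolding graded_prime_def by blast
    then show False using p(2) q(2) z1(3) z2(3) by auto
  qed
  ultimately show ?thesis
    unfolding irreducible_closed_def V_def[symmetric]
    using zariski_closed_hypersurface[OF a] by (auto simp: V_def)
qed

lemma pdiff_power_Suc: "pdiff i (h ^ Suc n) = of_nat (Suc n) * h ^ n * pdiff i h"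
proof (induction n)
  case (Suc n)
  have "pdiff i (h ^ Suc (Suc n)) = pdiff i h * h ^ Suc n + h * pdiff i (h ^ Suc n)"
    by (simp only: power_Suc pdiff_mult)
  also have "\<dots> = of_nat (Suc (Suc n)) * h ^ Suc n * pdiff i h"
    unfolding Suc by (simp add: algebra_simps)
  finally show ?case .
qed simp

lemma graded_power: "p \<in> graded \<nu> a \<Longrightarrow> \<exists>b. p ^ n \<in> graded \<nu> b"
proof (induction n)
  case 0
  show ?case using graded_1 by auto
next
  case (Suc n)
  then obtain b where "p ^ n \<in> graded \<nu> b" by blast
  from graded_mult[OF Suc.prems this] show ?case by auto
qed

text \<open>With f = h^N u and u prime to h, modulo h^N the form \<omega> \<and> df is N h^(N-1) u
  \<omega> \<and> dh.\<close>

lemma graded_prime_divisor_invariant: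
  fixes f h :: "'k::{finite,linorder} cpoly"
  assumes h: "graded_prime \<nu> h" and "h dvd f" "f \<noteq> 0" "f \<in> graded \<nu> b"
    and inv: "\<And>i j. f dvd wedge11 \<omega> (d0 f) i j"
  shows "h dvd wedge11 \<omega> (d0 h) i j"
proof -
  have h0: "h \<noteq> 0" "tdeg h > 0" using h by (auto simp: graded_prime_def dvd_1_iff_tdeg)
  obtain a where a: "h \<in> graded \<nu> a" using h by (auto simp: graded_prime_def)
  have tdeg_power: "tdeg (h ^ n) = n * tdeg h" for n
  proof (induction n)
    case 0
    show ?case using tdeg_cconst[of 1] by simp
  qed (use h0 in \<open>simp add: tdeg_mult\<close>)
  have bounded: "n \<le> tdeg f" if "h ^ n dvd f" for n
  proof -
    have "n * tdeg h \<le> tdeg f" using tdeg_dvd_le[OF that assms(3)] by (simp add: tdeg_power)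
    moreover have "n \<le> n * tdeg h" using h0(2) by (cases "tdeg h") auto
    ultimately show ?thesis by linarith
  qed
  \<comment> \<open>The multiplicity of h in f: bounded because h has positive degree, and at least
    1 because h divides f.\<close>
  define N where "N = (GREATEST n. h ^ n dvd f)"
  have one: "h ^ 1 dvd f" using assms(2) by simp
  have N: "h ^ N dvd f" "\<And>n. h ^ n dvd f \<Longrightarrow> n \<le> N"
    unfolding N_def using GreatestI_nat[of "\<lambda>n. h ^ n dvd f", OF one bounded]
      Greatest_le_nat[of "\<lambda>n. h ^ n dvd f" _ "tdeg f"] bounded by blast+
  then obtain n where n: "N = Suc n" using one not0_implies_Suc[of N] by fastforce
  obtain u where u: "f = h ^ N * u" using N(1) by (elim dvdE)
  have "\<not> h dvd u"
  proof
    assume "h dvd u"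
    then have "h ^ Suc N dvd f" unfolding u power_Suc2 by (rule mult_dvd_mono[OF dvd_refl])
    with N(2)[of "Suc N"] show False by simp
  qed
  obtain e where e: "h ^ N \<in> graded \<nu> e" using graded_power[OF a] by blast
  have hN: "h ^ N \<noteq> 0" using h0(1) by simp
  have ugr: "u \<in> graded \<nu> (\<lambda>x. b x - e x)"
    using graded_quotient[OF e hN] assms(4) u by simp
  have df: "pdiff i f = of_nat N * h ^ n * u * pdiff i h + h ^ N * pdiff i u" for i
    unfolding u pdiff_mult n pdiff_power_Suc by (simp add: algebra_simps)
  have "wedge11 \<omega> (d0 f) i j = h ^ n * (of_nat N * u * wedge11 \<omega> (d0 h) i j) + h ^ N * wedge11 \<omega> (d0 u) i j"
    by (simp add: wedge11_def d0_def df algebra_simps)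
  moreover have "h ^ N dvd wedge11 \<omega> (d0 f) i j"
    using N(1) inv dvd_trans by blast
  ultimately have "h ^ N dvd h ^ n * (of_nat N * u * wedge11 \<omega> (d0 h) i j)"
    by (simp add: dvd_add_left_iff)
  then have "h ^ n * h dvd h ^ n * (of_nat N * u * wedge11 \<omega> (d0 h) i j)"
    by (simp add: n mult.commute)
  \<comment> \<open>N is a nonzero constant, and h does not divide the homogeneous u, so h divides
    the remaining factor.\<close>
  then have "h dvd cconst (of_nat N) * (u * wedge11 \<omega> (d0 h) i j)"
    using h0(1) by (simp add: cconst_of_nat mult.assoc)
  then have "h dvd u * wedge11 \<omega> (d0 h) i j"
    using cconst_mult_dvd_iff[of "of_nat N" h] n by (simp del: of_nat_Suc)
  with h ugr \<open>\<not> h dvd u\<close> show ?thesis unfolding graded_prime_def by blast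
qed

theorem infinitely_many_invariant_hypersurfaces:
  fixes \<Delta> :: "(real ^ 'n) set set" and \<nu> :: "'k::{finite,linorder} \<Rightarrow> int ^ 'n"
  assumes fan: "fan \<Delta>" "ray_generators \<Delta> \<nu>"
    and F: "rational_first_integral \<nu> \<omega> F"
  shows "infinite (invariant_irreducible_hypersurfaces \<Delta> \<nu> \<omega>)"
proof -
  obtain \<alpha> P0 Q0 where PQ0: "\<alpha> \<in> carrier (class_group \<nu>)" "P0 \<in> graded_part \<nu> \<alpha>" "Q0 \<in> graded_part \<nu> \<alpha>"
    "Q0 \<noteq> 0" "F = Fract P0 Q0" "\<And>c. F \<noteq> Fract (cconst c) 1"
    "\<And>i j. wedge11 (\<lambda>l. Fract (\<omega> l) 1) (d_quotient P0 Q0) i j = 0"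
    using F unfolding rational_first_integral_def by blast
  obtain a0 where a0: "\<alpha> = div_class \<nu> a0" using PQ0(1) by (auto simp: carrier_class_group)
  obtain g c0 where g: "g \<in> graded \<nu> c0" "g dvd Q0" "g dvd P0" "\<And>q. q dvd Q0 \<and> q dvd P0 \<Longrightarrow> q dvd g"
    using exists_graded_gcd[of Q0 \<nu> a0 P0 a0] PQ0(2-4) a0 by blast
  obtain P Q where PQ: "P0 = g * P" "Q0 = g * Q" using g(2,3) by (auto elim!: dvdE)
  have nz: "g \<noteq> 0" "Q \<noteq> 0" using PQ0(4) PQ(2) by auto
  define a where "a = (\<lambda>i. a0 i - c0 i)"
  have gr: "P \<in> graded \<nu> a" "Q \<in> graded \<nu> a"
    unfolding a_def using graded_quotient[OF g(1) nz(1)] PQ0(2,3) PQ a0 by auto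
  have coprime: "q dvd 1" if "q dvd Q" "q dvd P" for q
  proof -
    \<comment> \<open>The product of g with a common divisor of P and Q divides \<open>P0\<close>
      and \<open>Q0\<close>, hence divides g.\<close>
    have "g * q dvd g" using that by (intro g(4)) (simp add: PQ)
    then obtain k where "g = g * q * k" by (elim dvdE)
    then have "g * 1 = g * (q * k)" by (simp add: mult.assoc)
    with nz(1) have "1 = q * k" by (simp only: mult_cancel_left) simp
    then show ?thesis by (rule dvdI)
  qed
  have nonconst: "P \<noteq> cconst c * Q" for c
  proof
    assume "P = cconst c * Q"
    then have "F = Fract (cconst c) 1"
      using PQ0(4,5) PQ by (simp add: eq_fract mult_ac)
    with PQ0(6) show False by blast
  qed
  define X where "X i = Q * pdiff i P - P * pdiff i Q" for i
  have X: "\<omega> i * X j = \<omega> j * X i" for i j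
  proof -
    have "Q0 * pdiff i P0 - P0 * pdiff i Q0 = g ^ 2 * X i" for i
      by (simp add: PQ X_def pdiff_mult power2_eq_square algebra_simps)
    then have "g ^ 2 * (\<omega> i * X j) = g ^ 2 * (\<omega> j * X i)"
      using PQ0(7)[of i j] unfolding wedge_d_quotient_eq_0_iff[OF PQ0(4)] by (simp add: mult_ac)
    then show ?thesis using nz(1) by simp
  qed
  define f where "f c = P - cconst c * Q" for c
  have f: "f c \<noteq> 0" "f c \<in> graded \<nu> a" for c
    using nonconst[of c] gr by (simp_all add: f_def graded_part_diff graded_part_cconst_mult)
  have f_inv: "f c dvd wedge11 \<omega> (d0 (f c)) i j" for c i j
  \<comment> \<open>A common divisor of \<open>f c\<close> and Q divides P as well, so the two are
    coprime. The first integral gives Q \<omega> \<and> df_c = f_c \<omega> \<and> dQ.\<close>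
  proof (rule dvd_of_coprime[OF f gr(2)])
    fix q assume "q dvd f c" "q dvd Q"
    then have "q dvd f c + cconst c * Q" by simp
    then show "q dvd 1" using coprime \<open>q dvd Q\<close> by (simp add: f_def)
  next
    have "Q * pdiff i (f c) = X i + f c * pdiff i Q" for i
      by (simp add: f_def X_def pdiff_diff pdiff_mult algebra_simps)
    then have "\<omega> i * (Q * pdiff j (f c)) - \<omega> j * (Q * pdiff i (f c)) =
        f c * (\<omega> i * pdiff j Q - \<omega> j * pdiff i Q)"
      using X[of i j] by (simp add: algebra_simps)
    then have "Q * wedge11 \<omega> (d0 (f c)) i j = f c * (\<omega> i * pdiff j Q - \<omega> j * pdiff i Q)"
      by (simp add: wedge11_def d0_def algebra_simps)
    then show "f c dvd Q * wedge11 \<omega> (d0 (f c)) i j" by simp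
  qed
  define S where "S = {c. \<not> f c dvd 1}"
  have "\<exists>h. graded_prime \<nu> h \<and> h dvd f c" if "c \<in> S" for c
    using exists_graded_prime_divisor[OF f(2,1)] that by (simp add: S_def)
  then obtain h where h: "\<And>c. c \<in> S \<Longrightarrow> graded_prime \<nu> (h c)" "\<And>c. c \<in> S \<Longrightarrow> h c dvd f c"
    by metis
  have mem: "hypersurface \<Delta> \<nu> (h c) \<in> invariant_irreducible_hypersurfaces \<Delta> \<nu> \<omega>" if c: "c \<in> S" for c
  proof -
    obtain b where b: "h c \<in> graded \<nu> b" using h(1)[OF c] by (auto simp: graded_prime_def)
    have "h c \<noteq> 0" using h(1)[OF c] by (simp add: graded_prime_def)
    moreover have "invariant_equation \<Delta> \<nu> \<omega> (h c)"
      using graded_prime_divisor_invariant[OF h(1,2)[OF c] f f_inv] \<open>h c \<noteq> 0\<close>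
      by (intro invariant_equation_if_dvd)
    moreover have "irreducible_closed \<Delta> \<nu> (hypersurface \<Delta> \<nu> (h c))"
      by (rule graded_prime_irreducible[OF fan h(1)[OF c]])
    moreover have "div_class \<nu> b \<in> carrier (class_group \<nu>)" by (simp add: carrier_class_group)
    ultimately show ?thesis
      unfolding invariant_irreducible_hypersurfaces_def using b by blast
  qed
  have "inj_on (\<lambda>c. hypersurface \<Delta> \<nu> (h c)) S"
  proof (rule inj_onI, rule ccontr)
    fix c c' assume c: "c \<in> S" "c' \<in> S" "hypersurface \<Delta> \<nu> (h c) = hypersurface \<Delta> \<nu> (h c')" "c \<noteq> c'"
    obtain b b' where b: "h c \<in> graded \<nu> b" "h c' \<in> graded \<nu> b'"
      using h(1)[OF c(1)] h(1)[OF c(2)] by (auto simp: graded_prime_def)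
    \<comment> \<open>A common zero of two members of the pencil is a zero of both P and Q.\<close>
    have van: "eval_poly P z = 0 \<and> eval_poly Q z = 0"
      if z: "z \<notin> irrelevant_locus \<Delta> \<nu>" "eval_poly (h c) z = 0" for z
    proof -
      have "eval_poly (h c') z = 0"
        using z c(3) orbit_in_hypersurface_iff[OF b(1) z(1)] orbit_in_hypersurface_iff[OF b(2) z(1)] by simp
      then have "eval_poly (f c) z = 0" "eval_poly (f c') z = 0"
        using h(2)[OF c(1)] h(2)[OF c(2)] z(2) by (auto simp: dvd_def)
      then have e: "eval_poly P z = c * eval_poly Q z" "eval_poly P z = c' * eval_poly Q z"
        by (simp_all add: f_def)
      then have "eval_poly Q z = 0" using c(4) mult_cancel_right by metis
      with e show ?thesis by simp
    qed
    have "h c dvd P"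
      by (rule graded_prime_dvd_if_vanishes[OF fan h(1)[OF c(1)] gr(1)]) (use van in blast)
    moreover have "h c dvd Q"
      by (rule graded_prime_dvd_if_vanishes[OF fan h(1)[OF c(1)] gr(2)]) (use van in blast)
    ultimately have "h c dvd 1" by (intro coprime)
    with h(1)[OF c(1)] show False by (simp add: graded_prime_def)
  qed
  \<comment> \<open>At most one member of the pencil is constant: two would make P and Q constant,
    and P / Q with them.\<close>
  moreover have "infinite S"
  proof
    assume "finite S"
    then have "infinite (- S)" using infinite_UNIV_char_0 by (metis Compl_UNIV_eq finite_compl)
    then obtain c where c: "c \<in> - S" by (metis ex_in_conv finite.emptyI)
    have "infinite (- S - {c})" using \<open>infinite (- S)\<close> by simp
    then obtain c' where c': "c' \<in> - S - {c}" by (metis ex_in_conv finite.emptyI)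
    obtain k k' where k: "f c = cconst k" "f c' = cconst k'"
    proof -
      have "tdeg (f c) = 0" "tdeg (f c') = 0"
        using c c' by (auto simp: S_def dvd_1_iff_tdeg)
      then show ?thesis using tdeg_eq_0_imp that by blast
    qed
    define r where "r = (k' - k) / (c - c')"
    have cc: "c - c' \<noteq> 0" using c' by auto
    have "cconst (c - c') * Q = cconst (k' - k)"
      using k by (simp add: f_def algebra_simps)
    also have "\<dots> = cconst ((c - c') * r)" using cc by (simp add: r_def)
    also have "\<dots> = cconst (c - c') * cconst r" by (rule cconst_simps(4))
    finally have r: "Q = cconst r"
      using cc by (simp only: mult_cancel_left cconst_eq_0_iff) simp
    have "r \<noteq> 0" using r nz(2) by auto
    have "P = f c + cconst c * Q" by (simp add: f_def)
    also have "\<dots> = cconst (k + c * r)" by (simp only: k r cconst_simps(3,4))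
    also have "k + c * r = ((k + c * r) / r) * r" using \<open>r \<noteq> 0\<close> by simp
    also have "cconst (((k + c * r) / r) * r) = cconst ((k + c * r) / r) * Q"
      unfolding r by (rule cconst_simps(4))
    finally show False using nonconst by blast
  qed
  ultimately have "infinite ((\<lambda>c. hypersurface \<Delta> \<nu> (h c)) ` S)"
    using finite_imageD by blast
  moreover have "(\<lambda>c. hypersurface \<Delta> \<nu> (h c)) ` S \<subseteq> invariant_irreducible_hypersurfaces \<Delta> \<nu> \<omega>"
    using mem by blast
  ultimately show ?thesis by (rule infinite_super[rotated])
qed

theorem proposition3p2:
  fixes \<Delta> :: "(real ^ 'n) set set"
    and \<nu> :: "'k::{finite,linorder} \<Rightarrow> int ^ 'n"
    and d :: "'k \<Rightarrow> int"
    and \<omega> :: "'k \<Rightarrow> 'k cpoly"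
  assumes "fan \<Delta>" and "complete_fan \<Delta>" and "simplicial_fan \<Delta>"
    and "ray_generators \<Delta> \<nu>"
    and "foliation \<Delta> \<nu> d \<omega>"
  shows "((\<exists>H \<subseteq> invariant_irreducible_hypersurfaces \<Delta> \<nu> \<omega>.
             card H = 2 + (\<Sum>(i, j) \<in> {(i, j). i < j}.
               hdim \<nu> (class_minus \<nu> (class_minus \<nu> (div_class \<nu> d) (deg_var \<nu> i)) (deg_var \<nu> j))))
           \<longrightarrow> (\<exists>F. rational_first_integral \<nu> \<omega> F))
         \<and> ((\<exists>F. rational_first_integral \<nu> \<omega> F)
           \<longleftrightarrow> infinite (invariant_irreducible_hypersurfaces \<Delta> \<nu> \<omega>))"
proof -
  have dist: "distribution \<Delta> \<nu> d \<omega>" using assms(5) by (simp add: foliation_def)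
  note integral = first_integral_of_hypersurfaces[OF assms(1-4) dist]
  \<comment> \<open>An infinite set has subsets of every finite cardinality, in particular of the
    required one.\<close>
  have "\<exists>F. rational_first_integral \<nu> \<omega> F"
    if "infinite (invariant_irreducible_hypersurfaces \<Delta> \<nu> \<omega>)"
    using infinite_arbitrarily_large[OF that] integral by metis
  then show ?thesis
    using integral infinitely_many_invariant_hypersurfaces[OF assms(1,4)] by blast
qed

end
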